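(* Let $\epsilon\ge 0$ and let $f:M\hookrightarrow N$ be a monomorphism of pointwise finite dimensional free $\mathbb R^2$-indexed modules with $\epsilon$-trivial cokernel. Let $\operatorname{im} f\overset{f_1}{\hookrightarrow}L^\epsilon(f)\overset{f_2}{\hookrightarrow}N$ be the associated factorization, where $L^\epsilon(f)$ is free. Then the composition of direction-$2$ and direction-$1$ induced matchings $$\chi(f):=\chi(f_2;2)\circ\chi(f_1;1):\mathcal B(M)\nrightarrow\mathcal B(N)$$ is a bijective matching such that for each $b^{\llcorner}\in\mathcal B(M)$ we have $\chi(f)(b^{\llcorner})=b'^{\llcorner}$ with $b_i-\epsilon\le b_i'\le b_i$ for $i\in\{1,2\}$.
   Context: Fix a field $k$. An $\mathbb R^n$-indexed module is a functor $M:\mathbb R^n\to\mathrm{Vec}_k$ (product order on $\mathbb R^n$), with internal maps $\varphi_M(a,b):M_a\to M_b$; it is pointwise finite dimensional (p.f.d.) if each $M_a$ is finite dimensional. $M$ is $\epsilon$-trivial if all maps $\varphi_M(a,a+\epsilon(1,\dots,1))$ vanish. For an interval $\mathcal J$ (nonempty, convex, connected subset), $I^{\mathcal J}$ is $k$ on $\mathcal J$, $0$ elsewhere, with identity maps within $\mathcal J$. The barcode $\mathcal B(M)$ of $M\cong\bigoplus_{\mathcal J\in\mathcal B(M)}I^{\mathcal J}$ is the unique multiset of intervals in such a decomposition. For $a\in\mathbb R^2$ let $a^{\llcorner}=\{b\in\mathbb R^2:a\le b\}$. An $\mathbb R^2$-indexed module is free if it is isomorphic to a direct sum of modules $I^{a^{\llcorner}}$.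 $\mathbf e_1,\mathbf e_2$ is the standard basis of $\mathbb R^2$. A matching $\sigma:S\nrightarrow T$ of multisets is a bijection between sub-multisets $\mathrm{coim}\,\sigma\subseteq S$ and $\mathrm{im}\,\sigma\subseteq T$; it is bijective if these are all of $S$ and $T$. Matchings are composed as relations. Factorization: $L^\epsilon(f)\subseteq N$ is the submodule $L^\epsilon(f)_a=\{n\in N_a:\varphi_N(a,a+\epsilon\mathbf e_1)(n)\in\operatorname{im}f\}$, and $f_1,f_2$ are the inclusions. For $f$ a monomorphism of p.f.d. free modules, $L^\epsilon(f)$ is free. Since $M\cong\operatorname{im}f$, $\mathcal B(M)=\mathcal B(\operatorname{im}f)$. Induced matchings in one dimension: for a morphism $h:P\to Q$ of p.f.d. $\mathbb R$-indexed modules, factor $h$ as $P\twoheadrightarrow\operatorname{im}h\hookrightarrow Q$. For a monomorphism $A\hookrightarrow B$, match, for every right endpoint (including its open/closed decoration and possibly $\infty$), the $j$-th longest interval of $\mathcal B(A)$ with that right endpoint with the $j$-th longest interval of $\mathcal B(B)$ with that right endpoint, whenever both exist. For an epimorphism do the same using left endpoints. $\chi(h):\mathcal B(P)\nrightarrow\mathcal B(Q)$ is the composite of the matching for the epimorphism followed by that for the monomorphism. Direction-$i$ induced matchings: let $i\in\{1,2\}$, let $\mathbb L_i\subset\mathbb R^2$ be the line $x_i=0$, and for $a\in\mathbb L_i$ let $\mathbb T_a=\{a+t\mathbf e_i:t\in\mathbb R\}$. For $c\in\mathbb R^2$ write $c<\mathbb T_a$ if $c=\hat c+c_i\mathbf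 e_i$ with $\hat c\in\mathbb L_i$ and $\hat c<a$. For an $\mathbb R^2$-indexed module $Q$ let $Q''\subseteq Q$ be $Q''_b=\{m\in Q_b: m\in\operatorname{im}\varphi_Q(c,b)\text{ for some }c<\mathbb T_a\}$ and $Q'=Q/Q''$. A morphism $g:P\to Q$ induces $g':P'\to Q'$, and by restriction a morphism $\bar g=g'|_{\mathbb T_a}:P'|_{\mathbb T_a}\to Q'|_{\mathbb T_a}$ of $\mathbb R$-indexed modules (parametrize $\mathbb T_a$ by $t$). For $P,Q$ p.f.d. free, the intervals of $\mathcal B(P'|_{\mathbb T_a})$ have the form $[t,\infty)$, and sending $[t,\infty)\in\mathcal B(P'|_{\mathbb T_a})$ to $(a+t\mathbf e_i)^{\llcorner}$ gives a bijection $\bigsqcup_{a\in\mathbb L_i}\mathcal B(P'|_{\mathbb T_a})\to\mathcal B(P)$ (and likewise for $Q$). Via these bijections the disjoint union of the matchings $\chi(\bar g)$ over all $a\in\mathbb L_i$ becomes a matching $\chi(g;i):\mathcal B(P)\nrightarrow\mathcal B(Q)$, the direction-$i$ matching induced by $g$. *)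

theory Defs
  imports "HOL-Analysis.Analysis" "HOL-Algebra.AbelCoset" "Jordan_Normal_Form.Missing_VectorSpace"
begin

section \<open>Persistence modules over a poset\<close>

text \<open>
  A functor from the poset \<open>'i\<close> to vector spaces over the field \<open>K\<close>. The carriers of all
  the spaces live in one type \<open>'v\<close>; this loses no generality, since they are not required to be
  disjoint or related in any way. The functions \<open>Tr M a b\<close> are meaningful only for \<open>a \<le> b\<close>,
  and only on the carrier of \<open>Sp M a\<close>.
\<close>

record ('i, 'k, 'v) pmod =
  Sp :: "'i \<Rightarrow> ('k, 'v) module"
  Tr :: "'i \<Rightarrow> 'i \<Rightarrow> 'v \<Rightarrow> 'v"

locale pmodule =
  fixes K :: "('k, 'm) ring_scheme" and M :: "('i::order, 'k, 'v) pmod"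
  assumes space: "vectorspace K (Sp M a)"
    and transition: "a \<le> b \<Longrightarrow> linear_map K (Sp M a) (Sp M b) (Tr M a b)"
    and transition_id: "x \<in> carrier (Sp M a) \<Longrightarrow> Tr M a a x = x"
    and transition_comp: "a \<le> b \<Longrightarrow> b \<le> c \<Longrightarrow> x \<in> carrier (Sp M a) \<Longrightarrow>
      Tr M b c (Tr M a b x) = Tr M a c x"

locale pmod_hom =
  source: pmodule K M + target: pmodule K N
  for K :: "('k, 'm) ring_scheme" and M :: "('i::order, 'k, 'v) pmod"
    and N :: "('i, 'k, 'w) pmod" +
  fixes f :: "'i \<Rightarrow> 'v \<Rightarrow> 'w"
  assumes component: "linear_map K (Sp M a) (Sp N a) (f a)"
    and natural: "a \<le> b \<Longrightarrow> x \<in> carrier (Sp M a) \<Longrightarrow>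
      f b (Tr M a b x) = Tr N a b (f a x)"

definition pmod_mono ::
  "('k, 'm) ring_scheme \<Rightarrow> ('i::order, 'k, 'v) pmod \<Rightarrow> ('i, 'k, 'w) pmod \<Rightarrow>
    ('i \<Rightarrow> 'v \<Rightarrow> 'w) \<Rightarrow> bool" where
  "pmod_mono K M N f \<longleftrightarrow> pmod_hom K M N f \<and> (\<forall>a. inj_on (f a) (carrier (Sp M a)))"

definition pmod_iso ::
  "('k, 'm) ring_scheme \<Rightarrow> ('i::order, 'k, 'v) pmod \<Rightarrow> ('i, 'k, 'w) pmod \<Rightarrow> bool" where
  "pmod_iso K M N \<longleftrightarrow>
    (\<exists>g. pmod_hom K M N g \<and> (\<forall>a. bij_betw (g a) (carrier (Sp M a)) (carrier (Sp N a))))"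

definition pfd :: "('k, 'm) ring_scheme \<Rightarrow> ('i, 'k, 'v) pmod \<Rightarrow> bool" where
  "pfd K M \<longleftrightarrow> (\<forall>a. vectorspace.fin_dim K (Sp M a))"

definition eps_trivial :: "real \<Rightarrow> (real^'n, 'k, 'v) pmod \<Rightarrow> bool" where
  "eps_trivial \<epsilon> M \<longleftrightarrow>
    (\<forall>a. \<forall>x \<in> carrier (Sp M a). Tr M a (a + vec \<epsilon>) x = \<zero>\<^bsub>Sp M (a + vec \<epsilon>)\<^esub>)"


section \<open>Submodules, images and quotients\<close>

definition sub_mod :: "('i, 'k, 'v) pmod \<Rightarrow> ('i \<Rightarrow> 'v set) \<Rightarrow> ('i, 'k, 'v) pmod" where
  "sub_mod N S = \<lparr>Sp = (\<lambda>a. (Sp N a)\<lparr>carrier := S a\<rparr>), Tr = Tr N\<rparr>"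

definition im_set :: "('i, 'k, 'v) pmod \<Rightarrow> ('i \<Rightarrow> 'v \<Rightarrow> 'w) \<Rightarrow> 'i \<Rightarrow> 'w set" where
  "im_set M f a = f a ` carrier (Sp M a)"

definition im_mod ::
  "('i, 'k, 'v) pmod \<Rightarrow> ('i, 'k, 'w) pmod \<Rightarrow> ('i \<Rightarrow> 'v \<Rightarrow> 'w) \<Rightarrow> ('i, 'k, 'w) pmod" where
  "im_mod M N f = sub_mod N (im_set M f)"

text \<open>
  If \<open>h\<close> is a linear map from \<open>U\<close> to \<open>V\<close> carrying a subspace \<open>U\<^sub>0\<close> into the subspace \<open>W\<close>, then
  \<open>quot_map V W h\<close> is the induced map on cosets from \<open>U/U\<^sub>0\<close> to \<open>V/W\<close>: all the cosets in the
  union coincide.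
\<close>

definition quot_map ::
  "('k, 'w) module \<Rightarrow> 'w set \<Rightarrow> ('v \<Rightarrow> 'w) \<Rightarrow> 'v set \<Rightarrow> 'w set" where
  "quot_map V W h X = (\<Union>x\<in>X. W +>\<^bsub>V\<^esub> h x)"

text \<open>The ring fields \<open>mult\<close> and \<open>one\<close> of a \<open>module\<close> record play no role in a vector space.\<close>

definition quot_vs :: "('k, 'v) module \<Rightarrow> 'v set \<Rightarrow> ('k, 'v set) module" where
  "quot_vs V W = \<lparr>carrier = a_rcosets\<^bsub>V\<^esub> W, mult = undefined, one = undefined,
     zero = W, add = set_add V, smult = (\<lambda>c. quot_map V W (\<lambda>x. c \<odot>\<^bsub>V\<^esub> x))\<rparr>"

definition quot_mod :: "('i, 'k, 'v) pmod \<Rightarrow> ('i \<Rightarrow> 'v set) \<Rightarrow> ('i, 'k, 'v set) pmod" where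
  "quot_mod N S = \<lparr>Sp = (\<lambda>a. quot_vs (Sp N a) (S a)),
     Tr = (\<lambda>a b. quot_map (Sp N b) (S b) (Tr N a b))\<rparr>"

definition coker_mod ::
  "('i, 'k, 'v) pmod \<Rightarrow> ('i, 'k, 'w) pmod \<Rightarrow> ('i \<Rightarrow> 'v \<Rightarrow> 'w) \<Rightarrow> ('i, 'k, 'w set) pmod" where
  "coker_mod M N f = quot_mod N (im_set M f)"


section \<open>Interval modules, direct sums and free modules\<close>

definition poset_interval :: "'i::order set \<Rightarrow> bool" where
  "poset_interval J \<longleftrightarrow> J \<noteq> {} \<and>
    (\<forall>a\<in>J. \<forall>c\<in>J. \<forall>b. a \<le> b \<and> b \<le> c \<longrightarrow> b \<in> J) \<and>
    (\<forall>a\<in>J. \<forall>b\<in>J. (a, b) \<in> {(x, y). x \<in> J \<and> y \<in> J \<and> (x \<le> y \<or> y \<le> x)}\<^sup>*)"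

definition interval_mod :: "('k, 'm) ring_scheme \<Rightarrow> 'i set \<Rightarrow> ('i, 'k, 'k) pmod" where
  "interval_mod K J =
    \<lparr>Sp = (\<lambda>a. \<lparr>carrier = (if a \<in> J then carrier K else {\<zero>\<^bsub>K\<^esub>}), mult = mult K, one = one K,
                zero = zero K, add = add K, smult = mult K\<rparr>),
     Tr = (\<lambda>a b x. if a \<in> J \<and> b \<in> J then x else \<zero>\<^bsub>K\<^esub>)\<rparr>"

definition dsum :: "'e set \<Rightarrow> ('e \<Rightarrow> ('i, 'k, 'v) pmod) \<Rightarrow> ('i, 'k, 'e \<Rightarrow> 'v) pmod" where
  "dsum E P =
    \<lparr>Sp = (\<lambda>a. \<lparr>carrier = {x \<in> (\<Pi>\<^sub>E e\<in>E. carrier (Sp (P e) a)).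
                           finite {e \<in> E. x e \<noteq> \<zero>\<^bsub>Sp (P e) a\<^esub>}},
                mult = undefined, one = undefined,
                zero = (\<lambda>e\<in>E. \<zero>\<^bsub>Sp (P e) a\<^esub>),
                add = (\<lambda>x y. \<lambda>e\<in>E. x e \<oplus>\<^bsub>Sp (P e) a\<^esub> y e),
                smult = (\<lambda>c x. \<lambda>e\<in>E. c \<odot>\<^bsub>Sp (P e) a\<^esub> x e)\<rparr>),
     Tr = (\<lambda>a b x. \<lambda>e\<in>E. Tr (P e) a b (x e))\<rparr>"

text \<open>
  The summands are indexed by a subset of \<open>(real^2) \<times> 'v\<close>. This is no restriction: a summand
  generated in degree \<open>a\<close> can be labelled by \<open>a\<close> together with the image of its generator in
  the space at \<open>a\<close>. The set \<open>{d..}\<close> is the quadrant of all points above \<open>d\<close>.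
\<close>

definition free_mod :: "('k, 'm) ring_scheme \<Rightarrow> (real^2, 'k, 'v) pmod \<Rightarrow> bool" where
  "free_mod K M \<longleftrightarrow>
    (\<exists>(E :: ((real^2) \<times> 'v) set) deg. pmod_iso K M (dsum E (\<lambda>e. interval_mod K {deg e..})))"


section \<open>Barcodes and matchings\<close>

text \<open>
  Barcodes may be infinite, but the barcode of a pointwise finite dimensional module has finite
  multiplicities. A multiset is therefore a multiplicity function, and the elements of
  \<open>rep B\<close> are the individual copies of the elements of \<open>B\<close>. Matchings of multisets are
  relations between these copies.
\<close>

type_synonym 'a mset = "'a \<Rightarrow> nat"

definition rep :: "'a mset \<Rightarrow> ('a \<times> nat) set" where
  "rep B = {(x, j). j < B x}"

definition interval_decomposition ::
  "('k, 'm) ring_scheme \<Rightarrow> ('i::order, 'k, 'v) pmod \<Rightarrow> 'i set mset \<Rightarrow> bool" where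
  "interval_decomposition K M B \<longleftrightarrow> (\<forall>J. B J > 0 \<longrightarrow> poset_interval J) \<and>
    pmod_iso K M (dsum (rep B) (\<lambda>(J, j). interval_mod K J))"

definition barcode ::
  "('k, 'm) ring_scheme \<Rightarrow> ('i::order, 'k, 'v) pmod \<Rightarrow> 'i set mset" where
  "barcode K M = (THE B. interval_decomposition K M B)"

type_synonym ('a, 'b) matching = "(('a \<times> nat) \<times> ('b \<times> nat)) set"

definition is_matching :: "'a mset \<Rightarrow> 'b mset \<Rightarrow> ('a, 'b) matching \<Rightarrow> bool" where
  "is_matching S T \<sigma> \<longleftrightarrow>
    \<sigma> \<subseteq> rep S \<times> rep T \<and> single_valued \<sigma> \<and> single_valued (\<sigma>\<inverse>)"

definition bijective_matching :: "'a mset \<Rightarrow> 'b mset \<Rightarrow> ('a, 'b) matching \<Rightarrow> bool" where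
  "bijective_matching S T \<sigma> \<longleftrightarrow>
    is_matching S T \<sigma> \<and> Domain \<sigma> = rep S \<and> Range \<sigma> = rep T"


section \<open>Induced matchings of one-parameter modules\<close>

text \<open>The second component records whether the endpoint is attained (closed) or not (open).\<close>

definition right_end :: "real set \<Rightarrow> ereal \<times> bool" where
  "right_end J = (Sup (ereal ` J), Sup (ereal ` J) \<in> ereal ` J)"

definition left_end :: "real set \<Rightarrow> ereal \<times> bool" where
  "left_end J = (Inf (ereal ` J), Inf (ereal ` J) \<in> ereal ` J)"

text \<open>
  Intervals sharing an endpoint are ordered by length, which for infinite intervals is understood
  as inclusion; copies of the same interval are ordered by their index. An element of \<open>rep B\<close>
  is the \<open>j\<close>-th longest with its endpoint iff exactly \<open>j - 1\<close> copies precede it. For the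
  barcode of a pointwise finite dimensional module the set counted here is finite, because each
  of these intervals contains \<open>J\<close>.
\<close>

definition predecessors ::
  "(real set \<Rightarrow> ereal \<times> bool) \<Rightarrow> real set mset \<Rightarrow> real set \<times> nat \<Rightarrow> (real set \<times> nat) set" where
  "predecessors endpt B = (\<lambda>(J, j).
    {(J', j') \<in> rep B. endpt J' = endpt J \<and> (J \<subset> J' \<or> (J' = J \<and> j' < j))})"

definition endpoint_matching ::
  "(real set \<Rightarrow> ereal \<times> bool) \<Rightarrow> real set mset \<Rightarrow> real set mset \<Rightarrow>
    (real set, real set) matching" where
  "endpoint_matching endpt A B = {(p, q). p \<in> rep A \<and> q \<in> rep B \<and>
     endpt (fst p) = endpt (fst q) \<and>
     card (predecessors endpt A p) = card (predecessors endpt B q)}"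

definition induced_matching ::
  "('k, 'm) ring_scheme \<Rightarrow> (real, 'k, 'v) pmod \<Rightarrow> (real, 'k, 'w) pmod \<Rightarrow>
    (real \<Rightarrow> 'v \<Rightarrow> 'w) \<Rightarrow> (real set, real set) matching" where
  "induced_matching K P Q h =
    endpoint_matching left_end (barcode K P) (barcode K (im_mod P Q h)) O
    endpoint_matching right_end (barcode K (im_mod P Q h)) (barcode K Q)"


section \<open>Direction-\<open>i\<close> induced matchings of two-parameter modules\<close>

definition on_line :: "2 \<Rightarrow> real^2 \<Rightarrow> real \<Rightarrow> real^2" where
  "on_line i a t = a + t *\<^sub>R axis i 1"

definition below_line :: "2 \<Rightarrow> real^2 \<Rightarrow> real^2 \<Rightarrow> bool" where
  "below_line i a c \<longleftrightarrow> (\<exists>c'. c' $ i = 0 \<and> c = c' + (c $ i) *\<^sub>R axis i 1 \<and> c' < a)"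

definition below_set :: "2 \<Rightarrow> real^2 \<Rightarrow> (real^2, 'k, 'v) pmod \<Rightarrow> real^2 \<Rightarrow> 'v set" where
  "below_set i a Q b = {m \<in> carrier (Sp Q b).
     \<exists>c. below_line i a c \<and> c \<le> b \<and> m \<in> Tr Q c b ` carrier (Sp Q c)}"

definition line_mod :: "2 \<Rightarrow> real^2 \<Rightarrow> (real^2, 'k, 'v) pmod \<Rightarrow> (real, 'k, 'v set) pmod" where
  "line_mod i a Q = (let Q' = quot_mod Q (below_set i a Q) in
     \<lparr>Sp = (\<lambda>t. Sp Q' (on_line i a t)),
      Tr = (\<lambda>s t. Tr Q' (on_line i a s) (on_line i a t))\<rparr>)"

definition line_map ::
  "2 \<Rightarrow> real^2 \<Rightarrow> (real^2, 'k, 'w) pmod \<Rightarrow> (real^2 \<Rightarrow> 'v \<Rightarrow> 'w) \<Rightarrow>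
    real \<Rightarrow> 'v set \<Rightarrow> 'w set" where
  "line_map i a Q g t =
    quot_map (Sp Q (on_line i a t)) (below_set i a Q (on_line i a t)) (g (on_line i a t))"

definition dir_matching ::
  "('k, 'm) ring_scheme \<Rightarrow> (real^2, 'k, 'v) pmod \<Rightarrow> (real^2, 'k, 'w) pmod \<Rightarrow>
    (real^2 \<Rightarrow> 'v \<Rightarrow> 'w) \<Rightarrow> 2 \<Rightarrow> ((real^2) set, (real^2) set) matching" where
  "dir_matching K P Q g i =
    {(({on_line i a s..}, j), ({on_line i a t..}, k)) | a s j t k. a $ i = 0 \<and>
       (({s..}, j), ({t..}, k)) \<in>
         induced_matching K (line_mod i a P) (line_mod i a Q) (line_map i a Q g)}"


section \<open>The factorization through the intermediate submodule\<close>

definition L_mod ::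
  "real \<Rightarrow> (real^2, 'k, 'v) pmod \<Rightarrow> (real^2, 'k, 'w) pmod \<Rightarrow> (real^2 \<Rightarrow> 'v \<Rightarrow> 'w) \<Rightarrow>
    (real^2, 'k, 'w) pmod" where
  "L_mod \<epsilon> M N f = sub_mod N (\<lambda>a. {n \<in> carrier (Sp N a).
     Tr N a (a + \<epsilon> *\<^sub>R axis 1 1) n \<in> im_set M f (a + \<epsilon> *\<^sub>R axis 1 1)})"

text \<open>
  Both morphisms of the factorization are inclusions. Composition of matchings is relational, so
  the direction-1 matching is applied first.
\<close>

definition chi ::
  "('k, 'm) ring_scheme \<Rightarrow> real \<Rightarrow> (real^2, 'k, 'v) pmod \<Rightarrow> (real^2, 'k, 'w) pmod \<Rightarrow>
    (real^2 \<Rightarrow> 'v \<Rightarrow> 'w) \<Rightarrow> ((real^2) set, (real^2) set) matching" where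
  "chi K \<epsilon> M N f =
    dir_matching K (im_mod M N f) (L_mod \<epsilon> M N f) (\<lambda>a x. x) 1 O
    dir_matching K (L_mod \<epsilon> M N f) N (\<lambda>a x. x) 2"

end

theory Submission
  imports Defs
begin

text \<open>
  An isomorphism with a direct sum of interval modules amounts to coordinates: an element in degree
  \<open>a\<close> becomes a finitely supported function on the summands alive at \<open>a\<close>, and for a free module the
  transition maps do not change these coordinates. Hence all transition maps of a pointwise finite
  dimensional free module are injective, an element that lifts to two degrees lifts to their meet,
  and below any degree only finitely many degrees matter. These three properties force every
  interval in a decomposition to be principal, so barcodes are determined by dimensions; and in two
  parameters they conversely imply freeness: choose in each degree a complement of the elements
  that come from the left or from below; in a vanishing combination of the chosen elements the
  lexicographically greatest degree cannot occur. The intermediate module inherits the three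
  properties.

  On each line in direction \<open>i\<close> an inclusion with \<open>\<epsilon>\<close>-trivial cokernel in that direction stays
  injective, because for free modules coming from below the line is visible after a shift by \<open>\<epsilon>\<close>.
  Counting dimensions bounds the numbers \<open>p t\<close> and \<open>q t\<close> of generators up to \<open>t\<close> by
  \<open>p t \<le> q t \<le> p (t + \<epsilon>)\<close>, and the induced matching pairs the generators in sorted order.
\<close>

section \<open>Linear algebra\<close>

text \<open>\<open>barcode\<close> denotes the only interval decomposition, so the one obtained from
  generators has to be compared with decompositions into arbitrary intervals. The conditions in
  \<open>tame\<close> serve for this, and they mention no generators; hence they can be checked for
  \<open>L_mod\<close>, where none are known in advance. A lift there consists of a lift in
  \<open>N\<close> and a lift in the shifted image, which agree since the transitions of
  \<open>N\<close> are injective.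

  The freeness criterion is tied to two parameters: with three, kernels of maps between free modules
  satisfy the same conditions and need not be free. In the plane the degrees of a relation other
  than its greatest one lie either directly to the left of that degree or at a smaller height; one
  use of meets deals with the second kind, which need not lie below the greatest degree.

  The constant \<epsilon> is spent once in each direction: by construction moving \<epsilon> in
  direction 1 carries the intermediate module into \<open>im f\<close>, and moving \<epsilon> in
  direction 2 carries \<open>N\<close> into the intermediate module, because the diagonal shift is
  the sum of the two.\<close>

lemma linear_mapI:
  assumes "vectorspace K V" "vectorspace K W"
    and "\<And>x. x \<in> carrier V \<Longrightarrow> T x \<in> carrier W"
    and "\<And>x y. x \<in> carrier V \<Longrightarrow> y \<in> carrier V \<Longrightarrow> T (x \<oplus>\<^bsub>V\<^esub> y) = T x \<oplus>\<^bsub>W\<^esub> T y"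
    and "\<And>c x. c \<in> carrier K \<Longrightarrow> x \<in> carrier V \<Longrightarrow> T (c \<odot>\<^bsub>V\<^esub> x) = c \<odot>\<^bsub>W\<^esub> T x"
  shows "linear_map K V W T"
  using assms
  by (auto simp: linear_map_def mod_hom_def mod_hom_axioms_def vectorspace_def module_hom_def)

lemma linear_mapD:
  assumes "linear_map K V W T"
  shows linear_map_dom: "vectorspace K V"
    and linear_map_cod: "vectorspace K W"
    and linear_map_closed: "x \<in> carrier V \<Longrightarrow> T x \<in> carrier W"
    and linear_map_add: "x \<in> carrier V \<Longrightarrow> y \<in> carrier V \<Longrightarrow> T (x \<oplus>\<^bsub>V\<^esub> y) = T x \<oplus>\<^bsub>W\<^esub> T y"
    and linear_map_smult: "c \<in> carrier K \<Longrightarrow> x \<in> carrier V \<Longrightarrow> T (c \<odot>\<^bsub>V\<^esub> x) = c \<odot>\<^bsub>W\<^esub> T x"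
    and linear_map_zero: "T \<zero>\<^bsub>V\<^esub> = \<zero>\<^bsub>W\<^esub>"
    and linear_map_minus: "x \<in> carrier V \<Longrightarrow> T (\<ominus>\<^bsub>V\<^esub> x) = \<ominus>\<^bsub>W\<^esub> T x"
proof -
  interpret linear_map K V W T by fact
  show "vectorspace K V" "vectorspace K W" by unfold_locales
  show "x \<in> carrier V \<Longrightarrow> T x \<in> carrier W" by simp
  show "x \<in> carrier V \<Longrightarrow> y \<in> carrier V \<Longrightarrow> T (x \<oplus>\<^bsub>V\<^esub> y) = T x \<oplus>\<^bsub>W\<^esub> T y" by simp
  show "c \<in> carrier K \<Longrightarrow> x \<in> carrier V \<Longrightarrow> T (c \<odot>\<^bsub>V\<^esub> x) = c \<odot>\<^bsub>W\<^esub> T x" by simp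
  show "T \<zero>\<^bsub>V\<^esub> = \<zero>\<^bsub>W\<^esub>" by simp
  show "x \<in> carrier V \<Longrightarrow> T (\<ominus>\<^bsub>V\<^esub> x) = \<ominus>\<^bsub>W\<^esub> T x" by simp
qed

lemma linear_map_compose:
  assumes "linear_map K U V S" "linear_map K V W T"
  shows "linear_map K U W (\<lambda>x. T (S x))"
  by (rule linear_mapI) (auto simp: linear_mapD[OF assms(1)] linear_mapD[OF assms(2)])

lemma linear_map_restrict_codomain:
  assumes T: "linear_map K V W T" and "vectorspace K (W\<lparr>carrier := X\<rparr>)"
    and "\<And>x. x \<in> carrier V \<Longrightarrow> T x \<in> X"
  shows "linear_map K V (W\<lparr>carrier := X\<rparr>) T"
  by (rule linear_mapI) (use assms linear_mapD[OF T] in auto)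

lemma linear_map_inj_onI:
  assumes T: "linear_map K V W T"
    and ker: "\<And>x. x \<in> carrier V \<Longrightarrow> T x = \<zero>\<^bsub>W\<^esub> \<Longrightarrow> x = \<zero>\<^bsub>V\<^esub>"
  shows "inj_on T (carrier V)"
proof (rule inj_onI)
  fix x y assume xy: "x \<in> carrier V" "y \<in> carrier V" "T x = T y"
  interpret V: vectorspace K V using linear_map_dom[OF T] .
  interpret W: vectorspace K W using linear_map_cod[OF T] .
  have "T (x \<ominus>\<^bsub>V\<^esub> y) = \<zero>\<^bsub>W\<^esub>"
    using xy linear_map_closed[OF T]
    by (simp add: a_minus_def linear_map_add[OF T] linear_map_minus[OF T] W.M.r_neg)
  then have "x \<ominus>\<^bsub>V\<^esub> y = \<zero>\<^bsub>V\<^esub>" using ker xy by simp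
  moreover have "x = (x \<ominus>\<^bsub>V\<^esub> y) \<oplus>\<^bsub>V\<^esub> y"
    using xy by (simp add: a_minus_def V.M.a_assoc V.M.l_neg)
  ultimately show "x = y" using xy by simp
qed

lemma linear_map_inv:
  assumes T: "linear_map K V W T" and bij: "bij_betw T (carrier V) (carrier W)"
  shows "linear_map K W V (inv_into (carrier V) T)"
proof -
  interpret linear_map K V W T by fact
  have *: "inv_into (carrier V) T y \<in> carrier V" "T (inv_into (carrier V) T y) = y"
    if "y \<in> carrier W" for y
    using bij that by (auto simp: bij_betw_def inv_into_into f_inv_into_f)
  have eq: "inv_into (carrier V) T y = x" if "x \<in> carrier V" "T x = y" for x y
    using bij that by (auto simp: bij_betw_def inv_into_f_f)
  show ?thesis
    by (rule linear_mapI[OF linear_map_cod[OF T] linear_map_dom[OF T]]) (auto intro!: eq simp: *)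
qed

text \<open>Each axiom transfers along a surjection that respects the operations. Direct sums of
  interval modules and quotients enter as bare records, so their vector space laws are obtained in
  this way.\<close>

lemma vectorspace_image:
  assumes "vectorspace K V"
    and im: "h ` carrier V = carrier X"
    and add: "\<And>x y. x \<in> carrier V \<Longrightarrow> y \<in> carrier V \<Longrightarrow> h (x \<oplus>\<^bsub>V\<^esub> y) = h x \<oplus>\<^bsub>X\<^esub> h y"
    and smult: "\<And>c x. c \<in> carrier K \<Longrightarrow> x \<in> carrier V \<Longrightarrow> h (c \<odot>\<^bsub>V\<^esub> x) = c \<odot>\<^bsub>X\<^esub> h x"
    and zero: "h \<zero>\<^bsub>V\<^esub> = \<zero>\<^bsub>X\<^esub>"
  shows "vectorspace K X"
proof -
  interpret vectorspace K V by fact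
  have mem: "\<And>x. x \<in> carrier V \<Longrightarrow> h x \<in> carrier X" using im by auto
  show ?thesis
  proof (rule vs_criteria)
    show "field K" by unfold_locales
    show "\<zero>\<^bsub>X\<^esub> \<in> carrier X" by (simp add: zero[symmetric] mem)
    show "\<forall>v w. v \<in> carrier X \<and> w \<in> carrier X \<longrightarrow> v \<oplus>\<^bsub>X\<^esub> w \<in> carrier X"
      unfolding im[symmetric] by (auto simp: add[symmetric])
    show "\<forall>v\<in>carrier X. \<exists>w\<in>carrier X. v \<oplus>\<^bsub>X\<^esub> w = \<zero>\<^bsub>X\<^esub>"
    proof
      fix v assume "v \<in> carrier X"
      then obtain x where "x \<in> carrier V" "v = h x" using im by blast
      then have "h (\<ominus>\<^bsub>V\<^esub> x) \<in> carrier X" "v \<oplus>\<^bsub>X\<^esub> h (\<ominus>\<^bsub>V\<^esub> x) = \<zero>\<^bsub>X\<^esub>"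
        by (simp_all add: add[symmetric] zero[symmetric] mem M.r_neg)
      then show "\<exists>w\<in>carrier X. v \<oplus>\<^bsub>X\<^esub> w = \<zero>\<^bsub>X\<^esub>" by blast
    qed
    show "\<forall>c v. c \<in> carrier K \<and> v \<in> carrier X \<longrightarrow> c \<odot>\<^bsub>X\<^esub> v \<in> carrier X"
      unfolding im[symmetric] by (auto simp: smult[symmetric])
    show "\<forall>v w. v \<in> carrier X \<and> w \<in> carrier X \<longrightarrow> v \<oplus>\<^bsub>X\<^esub> w = w \<oplus>\<^bsub>X\<^esub> v"
      unfolding im[symmetric] by (auto simp: add[symmetric] M.a_comm)
    show "\<forall>v w x. v \<in> carrier X \<and> w \<in> carrier X \<and> x \<in> carrier X \<longrightarrow>
        (v \<oplus>\<^bsub>X\<^esub> w) \<oplus>\<^bsub>X\<^esub> x = v \<oplus>\<^bsub>X\<^esub> (w \<oplus>\<^bsub>X\<^esub> x)"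
      unfolding im[symmetric] by (auto simp: add[symmetric] M.a_assoc)
    show "\<forall>v\<in>carrier X. v \<oplus>\<^bsub>X\<^esub> \<zero>\<^bsub>X\<^esub> = v"
      unfolding im[symmetric] by (auto simp: add[symmetric] zero[symmetric])
    show "\<forall>a b v. a \<in> carrier K \<and> b \<in> carrier K \<and> v \<in> carrier X \<longrightarrow>
        (a \<otimes>\<^bsub>K\<^esub> b) \<odot>\<^bsub>X\<^esub> v = a \<odot>\<^bsub>X\<^esub> (b \<odot>\<^bsub>X\<^esub> v)"
      unfolding im[symmetric] by (auto simp: smult[symmetric] smult_assoc1)
    show "\<forall>v\<in>carrier X. \<one>\<^bsub>K\<^esub> \<odot>\<^bsub>X\<^esub> v = v"
      unfolding im[symmetric] by (auto simp: smult[symmetric])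
    show "\<forall>a b v. a \<in> carrier K \<and> b \<in> carrier K \<and> v \<in> carrier X \<longrightarrow>
        (a \<oplus>\<^bsub>K\<^esub> b) \<odot>\<^bsub>X\<^esub> v = a \<odot>\<^bsub>X\<^esub> v \<oplus>\<^bsub>X\<^esub> b \<odot>\<^bsub>X\<^esub> v"
      unfolding im[symmetric] by (auto simp: smult[symmetric] add[symmetric] smult_l_distr)
    show "\<forall>a v w. a \<in> carrier K \<and> v \<in> carrier X \<and> w \<in> carrier X \<longrightarrow>
        a \<odot>\<^bsub>X\<^esub> (v \<oplus>\<^bsub>X\<^esub> w) = a \<odot>\<^bsub>X\<^esub> v \<oplus>\<^bsub>X\<^esub> a \<odot>\<^bsub>X\<^esub> w"
      unfolding im[symmetric] by (auto simp: smult[symmetric] add[symmetric] smult_r_distr)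
  qed
qed

lemma vs_submoduleI:
  assumes "vectorspace K V" "W \<subseteq> carrier V" "\<zero>\<^bsub>V\<^esub> \<in> W"
    and "\<And>x y. x \<in> W \<Longrightarrow> y \<in> W \<Longrightarrow> x \<oplus>\<^bsub>V\<^esub> y \<in> W"
    and "\<And>c x. c \<in> carrier K \<Longrightarrow> x \<in> W \<Longrightarrow> c \<odot>\<^bsub>V\<^esub> x \<in> W"
  shows "submodule K W V"
  using assms by (auto simp: submodule_def vectorspace_def)

lemma submodule_vectorspace:
  assumes "vectorspace K V" "submodule K W V"
  shows "vectorspace K (V\<lparr>carrier := W\<rparr>)"
  using assms vectorspace.subspace_is_vs subspace_def by blast

section \<open>Linear combinations of finite families\<close>

text \<open>Combinations are indexed by labels instead of by vectors, since different generators may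
  a priori have the same image in a given degree.\<close>

definition fam_sum :: "('k, 'v) module \<Rightarrow> ('e \<Rightarrow> 'k) \<Rightarrow> ('e \<Rightarrow> 'v) \<Rightarrow> 'e set \<Rightarrow> 'v" where
  "fam_sum V c u D = (\<Oplus>\<^bsub>V\<^esub>e\<in>D. c e \<odot>\<^bsub>V\<^esub> u e)"

context
  fixes K :: "('k, 'm) ring_scheme" and V :: "('k, 'v) module"
  assumes V: "vectorspace K V"
begin

interpretation vectorspace K V by (rule V)

lemma fam_sum_empty [simp]: "fam_sum V c u {} = \<zero>\<^bsub>V\<^esub>"
  by (simp add: fam_sum_def)

lemma fam_sum_closed:
  assumes "\<And>e. e \<in> D \<Longrightarrow> c e \<in> carrier K" "\<And>e. e \<in> D \<Longrightarrow> u e \<in> carrier V"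
  shows "fam_sum V c u D \<in> carrier V"
  unfolding fam_sum_def using assms by (auto intro!: M.finsum_closed)

lemma fam_sum_insert:
  assumes "finite D" "d \<notin> D" "\<And>e. e \<in> insert d D \<Longrightarrow> c e \<in> carrier K"
    "\<And>e. e \<in> insert d D \<Longrightarrow> u e \<in> carrier V"
  shows "fam_sum V c u (insert d D) = c d \<odot>\<^bsub>V\<^esub> u d \<oplus>\<^bsub>V\<^esub> fam_sum V c u D"
  unfolding fam_sum_def using assms by (subst M.finsum_insert) auto

lemma fam_sum_in_submodule:
  assumes W: "submodule K W V" and "finite D"
    and "\<And>e. e \<in> D \<Longrightarrow> c e \<in> carrier K" "\<And>e. e \<in> D \<Longrightarrow> u e \<in> W"
  shows "fam_sum V c u D \<in> W"
  using assms(2-)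
proof (induction D rule: finite_induct)
  case empty
  then show ?case using submodule.zero_closed[OF W] by simp
next
  case (insert d D)
  have "u e \<in> carrier V" if "e \<in> insert d D" for e
    using insert.prems(2)[OF that] submodule.subset[OF W] by auto
  then show ?case
    using insert by (subst fam_sum_insert)
      (auto intro!: submodule.m_closed[OF W] submodule.smult_closed[OF W])
qed

lemma fam_sum_cong:
  assumes "\<And>e. e \<in> D \<Longrightarrow> c e = c' e" "\<And>e. e \<in> D \<Longrightarrow> u e = u' e"
    and "\<And>e. e \<in> D \<Longrightarrow> c e \<in> carrier K" "\<And>e. e \<in> D \<Longrightarrow> u e \<in> carrier V"
  shows "fam_sum V c u D = fam_sum V c' u' D"
  unfolding fam_sum_def using assms by (intro M.finsum_cong') auto

lemma fam_sum_Un: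
  assumes "finite C" "finite D" "C \<inter> D = {}" "\<And>e. e \<in> C \<union> D \<Longrightarrow> c e \<in> carrier K"
    "\<And>e. e \<in> C \<union> D \<Longrightarrow> u e \<in> carrier V"
  shows "fam_sum V c u (C \<union> D) = fam_sum V c u C \<oplus>\<^bsub>V\<^esub> fam_sum V c u D"
  unfolding fam_sum_def using assms by (subst M.finsum_Un_disjoint) auto

lemma fam_sum_zero:
  assumes "\<And>e. e \<in> D \<Longrightarrow> c e = \<zero>\<^bsub>K\<^esub>" "\<And>e. e \<in> D \<Longrightarrow> u e \<in> carrier V"
  shows "fam_sum V c u D = \<zero>\<^bsub>V\<^esub>"
proof -
  have "fam_sum V c u D = (\<Oplus>\<^bsub>V\<^esub>e\<in>D. \<zero>\<^bsub>V\<^esub>)"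
    unfolding fam_sum_def using assms by (intro M.finsum_cong') auto
  then show ?thesis by simp
qed

lemma fam_sum_superset:
  assumes "finite D" "C \<subseteq> D" "\<And>e. e \<in> D - C \<Longrightarrow> c e = \<zero>\<^bsub>K\<^esub>"
    "\<And>e. e \<in> C \<Longrightarrow> c e \<in> carrier K" "\<And>e. e \<in> D \<Longrightarrow> u e \<in> carrier V"
  shows "fam_sum V c u D = fam_sum V c u C"
proof -
  have *: "c e \<in> carrier K" if "e \<in> D" for e
    using assms(3)[of e] assms(4)[of e] that by (cases "e \<in> C") auto
  have "fam_sum V c u D = fam_sum V c u (C \<union> (D - C))"
    using assms(2) by (simp add: Un_absorb1)
  also have "\<dots> = fam_sum V c u C \<oplus>\<^bsub>V\<^esub> fam_sum V c u (D - C)"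
    using assms * by (intro fam_sum_Un) (auto intro: finite_subset)
  also have "fam_sum V c u (D - C) = \<zero>\<^bsub>V\<^esub>"
    using assms by (intro fam_sum_zero) auto
  finally show ?thesis using fam_sum_closed[of C c u] assms(2,4,5) by (simp add: subset_iff)
qed

lemma fam_sum_add:
  assumes "finite D" "\<And>e. e \<in> D \<Longrightarrow> c e \<in> carrier K" "\<And>e. e \<in> D \<Longrightarrow> c' e \<in> carrier K"
    "\<And>e. e \<in> D \<Longrightarrow> u e \<in> carrier V"
  shows "fam_sum V (\<lambda>e. c e \<oplus>\<^bsub>K\<^esub> c' e) u D = fam_sum V c u D \<oplus>\<^bsub>V\<^esub> fam_sum V c' u D"
proof -
  have "fam_sum V (\<lambda>e. c e \<oplus>\<^bsub>K\<^esub> c' e) u D = (\<Oplus>\<^bsub>V\<^esub>e\<in>D. c e \<odot>\<^bsub>V\<^esub> u e \<oplus>\<^bsub>V\<^esub> c' e \<odot>\<^bsub>V\<^esub> u e)"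
    unfolding fam_sum_def using assms by (intro M.finsum_cong') (auto simp: smult_l_distr)
  also have "\<dots> = fam_sum V c u D \<oplus>\<^bsub>V\<^esub> fam_sum V c' u D"
    unfolding fam_sum_def using assms by (intro M.finsum_addf) auto
  finally show ?thesis .
qed

lemma fam_sum_smult:
  assumes "finite D" "a \<in> carrier K" "\<And>e. e \<in> D \<Longrightarrow> c e \<in> carrier K"
    "\<And>e. e \<in> D \<Longrightarrow> u e \<in> carrier V"
  shows "fam_sum V (\<lambda>e. a \<otimes>\<^bsub>K\<^esub> c e) u D = a \<odot>\<^bsub>V\<^esub> fam_sum V c u D"
proof -
  have "fam_sum V (\<lambda>e. a \<otimes>\<^bsub>K\<^esub> c e) u D = (\<Oplus>\<^bsub>V\<^esub>e\<in>D. a \<odot>\<^bsub>V\<^esub> (c e \<odot>\<^bsub>V\<^esub> u e))"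
    unfolding fam_sum_def using assms by (intro M.finsum_cong') (auto simp: smult_assoc1)
  also have "\<dots> = a \<odot>\<^bsub>V\<^esub> fam_sum V c u D"
    unfolding fam_sum_def using assms by (intro finsum_smult[symmetric]) auto
  finally show ?thesis .
qed

lemma fam_sum_linear:
  assumes T: "linear_map K V W T" and "finite D" "\<And>e. e \<in> D \<Longrightarrow> c e \<in> carrier K"
    "\<And>e. e \<in> D \<Longrightarrow> u e \<in> carrier V"
  shows "T (fam_sum V c u D) = fam_sum W c (\<lambda>e. T (u e)) D"
  using assms(2-)
proof (induction D rule: finite_induct)
  case empty
  interpret W: vectorspace K W using linear_map_cod[OF T] .
  show ?case by (simp add: linear_map_zero[OF T] fam_sum_def)
next
  case (insert d D)
  interpret W: vectorspace K W using linear_map_cod[OF T] .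
  have "T (fam_sum V c u (insert d D)) = c d \<odot>\<^bsub>W\<^esub> T (u d) \<oplus>\<^bsub>W\<^esub> fam_sum W c (\<lambda>e. T (u e)) D"
    using insert fam_sum_closed[of D c u] by (subst fam_sum_insert) (auto simp: linear_mapD[OF T])
  also have "\<dots> = fam_sum W c (\<lambda>e. T (u e)) (insert d D)"
    unfolding fam_sum_def using insert
    by (subst W.M.finsum_insert) (auto simp: linear_map_closed[OF T])
  finally show ?case .
qed

text \<open>Independence of a family excludes repetitions, after which the bound for linearly
  independent sets applies to the set of its values.\<close>

lemma independent_family_card_le_dim:
  assumes fd: "fin_dim" and D: "finite D" and u: "\<And>e. e \<in> D \<Longrightarrow> u e \<in> carrier V"
    and ind: "\<And>c. (\<And>e. e \<in> D \<Longrightarrow> c e \<in> carrier K) \<Longrightarrow> fam_sum V c u D = \<zero>\<^bsub>V\<^esub> \<Longrightarrow>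
      (\<And>e. e \<in> D \<Longrightarrow> c e = \<zero>\<^bsub>K\<^esub>)"
  shows "card D \<le> dim"
proof -
  have inj: "inj_on u D"
  proof (rule inj_onI, rule ccontr)
    fix x y assume xy: "x \<in> D" "y \<in> D" "u x = u y" "x \<noteq> y"
    \<comment> \<open>If two labels carried the same vector, the coefficients 1 and -1 on them would
      give a vanishing combination.\<close>
    define c where "c = (\<lambda>e. if e = x then \<one>\<^bsub>K\<^esub> else if e = y then \<ominus>\<^bsub>K\<^esub> \<one>\<^bsub>K\<^esub> else \<zero>\<^bsub>K\<^esub>)"
    have c: "c e \<in> carrier K" for e by (auto simp: c_def)
    have "fam_sum V c u D = fam_sum V c u {x, y}"
      using xy D u c by (intro fam_sum_superset) (auto simp: c_def)
    also have "\<dots> = c x \<odot>\<^bsub>V\<^esub> u x \<oplus>\<^bsub>V\<^esub> (c y \<odot>\<^bsub>V\<^esub> u y \<oplus>\<^bsub>V\<^esub> \<zero>\<^bsub>V\<^esub>)"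
      using xy u c by (subst fam_sum_insert, auto)+
    also have "\<dots> = \<zero>\<^bsub>V\<^esub>"
      using xy u[of x] by (auto simp: c_def smult_l_minus M.r_neg)
    finally have "c x = \<zero>\<^bsub>K\<^esub>" using ind[of c x] c xy by auto
    then show False by (simp add: c_def)
  qed
  have "lin_indpt (u ` D)"
  proof (rule finite_lin_indpt2)
    show "finite (u ` D)" using D by simp
    show "u ` D \<subseteq> carrier V" using u by auto
    fix a assume a: "a \<in> u ` D \<rightarrow> carrier K" "lincomb a (u ` D) = \<zero>\<^bsub>V\<^esub>"
    have "lincomb a (u ` D) = fam_sum V (\<lambda>e. a (u e)) u D"
      unfolding lincomb_def fam_sum_def using a u inj by (subst M.finsum_reindex) auto
    then have "a (u e) = \<zero>\<^bsub>K\<^esub>" if "e \<in> D" for e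
      using ind[of "\<lambda>e. a (u e)" e] a that by auto
    then show "\<forall>v\<in>u ` D. a v = \<zero>\<^bsub>K\<^esub>" by auto
  qed
  then have "card (u ` D) \<le> dim" using li_le_dim(2)[OF fd, of "u ` D"] u by blast
  then show ?thesis using inj by (simp add: card_image)
qed

lemma spanning_family_dim_le:
  assumes D: "finite D" and u: "\<And>e. e \<in> D \<Longrightarrow> u e \<in> carrier V"
    and sp: "\<And>x. x \<in> carrier V \<Longrightarrow> \<exists>c. (\<forall>e\<in>D. c e \<in> carrier K) \<and> x = fam_sum V c u D"
  shows "fin_dim" "dim \<le> card D"
proof -
  have uD: "u ` D \<subseteq> carrier V" using u by auto
  have "x \<in> span (u ` D)" if "x \<in> carrier V" for x
  proof -
    obtain c where "\<forall>e\<in>D. c e \<in> carrier K" "x = fam_sum V c u D" using sp \<open>x \<in> carrier V\<close> by blast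
    moreover have "u e \<in> span (u ` D)" if "e \<in> D" for e
      using in_own_span[OF uD] that by auto
    ultimately show ?thesis using fam_sum_in_submodule[OF span_is_submodule[OF uD] D] by auto
  qed
  then have gen: "gen_set (u ` D)" using span_is_subset2[OF uD] by blast
  then show "fin_dim" unfolding fin_dim_def using D uD by blast
  have "dim \<le> card (u ` D)" using gen_ge_dim D uD gen by blast
  also have "\<dots> \<le> card D" using D by (rule card_image_le)
  finally show "dim \<le> card D" .
qed

end

section \<open>Injective linear maps and dimension\<close>

text \<open>A relation among the images pulls back along the injective map. Finite dimension is
  required of the target only, because \<open>injective_fin_dim\<close> uses the bound to establish
  it for the source.\<close>

lemma injective_independent:
  fixes V :: "('k, 'v) module" and W :: "('k, 'w) module"
  assumes T: "linear_map K V W T" and inj: "inj_on T (carrier V)"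
    and li: "\<not> module.lin_dep K V B" and B: "finite B" "B \<subseteq> carrier V"
    and fd: "vectorspace.fin_dim K W"
  shows "card B \<le> vectorspace.dim K W"
proof -
  have V: "vectorspace K V" and W: "vectorspace K W" using linear_mapD(1,2)[OF T] .
  interpret vectorspace K V by fact
  show ?thesis
  proof (rule independent_family_card_le_dim[OF W fd B(1), where u = T])
    show "\<And>e. e \<in> B \<Longrightarrow> T e \<in> carrier W" using B(2) linear_map_closed[OF T] by auto
    fix c e assume c: "\<And>e. e \<in> B \<Longrightarrow> c e \<in> carrier K" "fam_sum W c T B = \<zero>\<^bsub>W\<^esub>" "e \<in> B"
    have "T (fam_sum V c (\<lambda>v. v) B) = T \<zero>\<^bsub>V\<^esub>"
      using c B fam_sum_linear[OF V T B(1), of c "\<lambda>v. v"] by (auto simp: linear_map_zero[OF T])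
    then have "fam_sum V c (\<lambda>v. v) B = \<zero>\<^bsub>V\<^esub>"
      using inj fam_sum_closed[OF V, of B c "\<lambda>v. v"] c(1) B(2) by (auto dest!: inj_onD)
    then show "c e = \<zero>\<^bsub>K\<^esub>"
      using lin_dep_crit[of B B c e] li B c unfolding lincomb_def fam_sum_def by auto
  qed
qed

lemma injective_dim_le:
  fixes V :: "('k, 'v) module" and W :: "('k, 'w) module"
  assumes T: "linear_map K V W T" and inj: "inj_on T (carrier V)"
    and "vectorspace.fin_dim K V" "vectorspace.fin_dim K W"
  shows "vectorspace.dim K V \<le> vectorspace.dim K W"
proof -
  interpret vectorspace K V using linear_map_dom[OF T] .
  obtain B where B: "finite B" "basis B" using finite_basis_exists assms by blast
  then show ?thesis
    using injective_independent[OF T inj _ B(1) _ assms(4)] dim_basis by (simp add: basis_def)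
qed

lemma surjective_fin_dim:
  assumes T: "linear_map K V W T" and surj: "T ` carrier V = carrier W"
    and "vectorspace.fin_dim K V"
  shows "vectorspace.fin_dim K W"
proof -
  interpret linear_map K V W T by fact
  show ?thesis using rank_nullity_main(2) assms by blast
qed

text \<open>Independent sets in the source have at most \<open>dim W\<close> elements, so one of
  them is maximal, and a maximal independent set is a basis.\<close>

lemma injective_fin_dim:
  fixes V :: "('k, 'v) module" and W :: "('k, 'w) module"
  assumes T: "linear_map K V W T" and inj: "inj_on T (carrier V)"
    and fd: "vectorspace.fin_dim K W"
  shows "vectorspace.fin_dim K V"
proof -
  interpret vectorspace K V using linear_map_dom[OF T] .
  have fin: "finite A \<and> card A \<le> vectorspace.dim K W" if A: "A \<subseteq> carrier V \<and> lin_indpt A" for A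
  proof -
    have "card B \<le> vectorspace.dim K W" if B: "finite B" "B \<subseteq> A" for B
    proof (rule injective_independent[OF T inj _ B(1) _ fd])
      show "lin_indpt B" using A B(2) unfolding lin_dep_def by (meson order_trans)
    qed (use A B(2) in blast)
    then show ?thesis
      by (metis finite_if_finite_subsets_card_bdd order_refl)
  qed
  have "lin_indpt {}" by (auto simp: lin_dep_def)
  then obtain A where A: "finite A" "maximal A (\<lambda>S. S \<subseteq> carrier V \<and> lin_indpt S)"
    using maximal_exists[of "\<lambda>S. S \<subseteq> carrier V \<and> lin_indpt S" _ "{}"] fin by auto
  then show ?thesis using max_li_is_basis unfolding fin_dim_def basis_def by blast
qed

section \<open>Coordinates for direct sums of interval modules\<close>

text \<open>Total functions that vanish off \<open>A\<close> are used rather than functions on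
  \<open>A\<close>: then coordinates in different degrees, where different summands are alive, can
  be compared by plain equality.\<close>

definition fin_funs :: "('k, 'm) ring_scheme \<Rightarrow> 'e set \<Rightarrow> ('e \<Rightarrow> 'k) set" where
  "fin_funs K A = {c. (\<forall>e. c e \<in> carrier K) \<and> finite {e. c e \<noteq> \<zero>\<^bsub>K\<^esub>} \<and> (\<forall>e. e \<notin> A \<longrightarrow> c e = \<zero>\<^bsub>K\<^esub>)}"

definition fun_vs :: "('k, 'm) ring_scheme \<Rightarrow> 'e set \<Rightarrow> ('k, 'e \<Rightarrow> 'k) module" where
  "fun_vs K A = \<lparr>carrier = fin_funs K A, mult = undefined, one = undefined, zero = (\<lambda>_. \<zero>\<^bsub>K\<^esub>),
    add = (\<lambda>x y e. x e \<oplus>\<^bsub>K\<^esub> y e), smult = (\<lambda>c x e. c \<otimes>\<^bsub>K\<^esub> x e)\<rparr>"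

lemma fun_vs_simps [simp]:
  "carrier (fun_vs K A) = fin_funs K A"
  "\<zero>\<^bsub>fun_vs K A\<^esub> = (\<lambda>_. \<zero>\<^bsub>K\<^esub>)"
  "x \<oplus>\<^bsub>fun_vs K A\<^esub> y = (\<lambda>e. x e \<oplus>\<^bsub>K\<^esub> y e)"
  "c \<odot>\<^bsub>fun_vs K A\<^esub> x = (\<lambda>e. c \<otimes>\<^bsub>K\<^esub> x e)"
  by (simp_all add: fun_vs_def)

lemma fin_funsD:
  assumes "c \<in> fin_funs K A"
  shows "c e \<in> carrier K" "finite {e. c e \<noteq> \<zero>\<^bsub>K\<^esub>}" "e \<notin> A \<Longrightarrow> c e = \<zero>\<^bsub>K\<^esub>"
  using assms by (simp_all add: fin_funs_def)

lemma fin_funs_mono: "c \<in> fin_funs K A \<Longrightarrow> (\<And>e. e \<in> A \<Longrightarrow> c e \<noteq> \<zero>\<^bsub>K\<^esub> \<Longrightarrow> e \<in> B) \<Longrightarrow> c \<in> fin_funs K B"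
  by (auto simp: fin_funs_def)

lemma fin_funs_restrict:
  assumes K: "field K" and c: "c \<in> fin_funs K A"
  shows "(\<lambda>e. if e \<in> B then c e else \<zero>\<^bsub>K\<^esub>) \<in> fin_funs K (A \<inter> B)"
proof -
  interpret field K by fact
  have "finite {e. (if e \<in> B then c e else \<zero>\<^bsub>K\<^esub>) \<noteq> \<zero>\<^bsub>K\<^esub>}"
    by (rule finite_subset[OF _ fin_funsD(2)[OF c]]) auto
  then show ?thesis using c by (auto simp: fin_funs_def)
qed

lemma vectorspace_fun_vs:
  assumes K: "field K"
  shows "vectorspace K (fun_vs K A)"
proof -
  interpret field K by fact
  show ?thesis
  proof (rule vs_criteria, goal_cases)
    case 3
    have "finite {e. x e \<oplus>\<^bsub>K\<^esub> y e \<noteq> \<zero>\<^bsub>K\<^esub>}" if "x \<in> fin_funs K A" "y \<in> fin_funs K A" for x y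
      by (rule finite_subset[OF _ finite_UnI[OF that[THEN fin_funsD(2)]]]) auto
    then show ?case by (auto simp: fin_funs_def)
  next
    case 4
    show ?case
    proof
      fix x assume x: "x \<in> carrier (fun_vs K A)"
      have "finite {e. \<ominus>\<^bsub>K\<^esub> x e \<noteq> \<zero>\<^bsub>K\<^esub>}"
        by (rule finite_subset[OF _ fin_funsD(2)[of x K A]]) (use x in auto)
      then have "(\<lambda>e. \<ominus>\<^bsub>K\<^esub> x e) \<in> fin_funs K A" using x
        by (auto simp: fin_funs_def)
      moreover have "x \<oplus>\<^bsub>fun_vs K A\<^esub> (\<lambda>e. \<ominus>\<^bsub>K\<^esub> x e) = \<zero>\<^bsub>fun_vs K A\<^esub>"
        using x by (auto simp: r_neg fin_funs_def)
      ultimately show "\<exists>y\<in>carrier (fun_vs K A). x \<oplus>\<^bsub>fun_vs K A\<^esub> y = \<zero>\<^bsub>fun_vs K A\<^esub>"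
        by auto
    qed
  next
    case 5
    have "finite {e. c \<otimes>\<^bsub>K\<^esub> x e \<noteq> \<zero>\<^bsub>K\<^esub>}" if "x \<in> fin_funs K A" "c \<in> carrier K" for x c
      by (rule finite_subset[OF _ fin_funsD(2)[OF that(1)]]) (use that in auto)
    then show ?case by (auto simp: fin_funs_def)
  next
    case 1 show ?case by (rule K)
  next
    case 6 show ?case by (auto simp: fin_funs_def a_comm)
  qed (auto simp: fin_funs_def a_assoc m_assoc l_distr r_distr)
qed

definition delta :: "('k, 'm) ring_scheme \<Rightarrow> 'e \<Rightarrow> 'e \<Rightarrow> 'k" where
  "delta K e = (\<lambda>e'. if e' = e then \<one>\<^bsub>K\<^esub> else \<zero>\<^bsub>K\<^esub>)"

lemma delta_in_fin_funs: "field K \<Longrightarrow> e \<in> A \<Longrightarrow> delta K e \<in> fin_funs K A"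
proof -
  assume "field K" "e \<in> A"
  interpret field K by fact
  have "finite {e'. delta K e e' \<noteq> \<zero>\<^bsub>K\<^esub>}"
    by (rule finite_subset[of _ "{e}"]) (auto simp: delta_def)
  then show ?thesis using \<open>e \<in> A\<close> by (auto simp: fin_funs_def delta_def)
qed

lemma fam_sum_delta:
  assumes K: "field K" and "finite D" "D \<subseteq> A" "\<And>e. e \<in> D \<Longrightarrow> c e \<in> carrier K"
  shows "fam_sum (fun_vs K A) c (delta K) D = (\<lambda>e. if e \<in> D then c e else \<zero>\<^bsub>K\<^esub>)"
  using assms(2-)
proof (induction D rule: finite_induct)
  case empty
  then show ?case by (simp add: fam_sum_empty[OF vectorspace_fun_vs[OF K]])
next
  case (insert d D)
  interpret field K by fact
  have d: "delta K e \<in> fin_funs K A" if "e \<in> insert d D" for e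
    using insert.prems that by (auto intro: delta_in_fin_funs[OF K])
  have "fam_sum (fun_vs K A) c (delta K) (insert d D) =
      c d \<odot>\<^bsub>fun_vs K A\<^esub> delta K d \<oplus>\<^bsub>fun_vs K A\<^esub> fam_sum (fun_vs K A) c (delta K) D"
    using insert.hyps insert.prems d by (intro fam_sum_insert[OF vectorspace_fun_vs[OF K]]) auto
  also have "fam_sum (fun_vs K A) c (delta K) D = (\<lambda>e. if e \<in> D then c e else \<zero>\<^bsub>K\<^esub>)"
    using insert by auto
  finally show ?case
    using insert.hyps insert.prems by (auto simp: delta_def)
qed

lemma dim_fun_vs:
  assumes K: "field K" and A: "finite A"
  shows "vectorspace.fin_dim K (fun_vs K A)" "vectorspace.dim K (fun_vs K A) = card A"
proof -
  note V = vectorspace_fun_vs[OF K, of A]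
  have sp: "\<exists>c. (\<forall>e\<in>A. c e \<in> carrier K) \<and> x = fam_sum (fun_vs K A) c (delta K) A"
    if "x \<in> carrier (fun_vs K A)" for x
    using that fam_sum_delta[OF K A, of A x]
    by (intro exI[of _ x]) (auto simp: fin_funs_def fun_eq_iff)
  show fd: "vectorspace.fin_dim K (fun_vs K A)"
    by (rule spanning_family_dim_le(1)[OF V A _ sp]) (auto simp: delta_in_fin_funs[OF K])
  have "vectorspace.dim K (fun_vs K A) \<le> card A"
    by (rule spanning_family_dim_le(2)[OF V A _ sp]) (auto simp: delta_in_fin_funs[OF K])
  moreover have "card A \<le> vectorspace.dim K (fun_vs K A)"
  proof (rule independent_family_card_le_dim[OF V fd A, of "delta K"])
    fix c e assume c: "\<And>e. e \<in> A \<Longrightarrow> c e \<in> carrier K"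
      "fam_sum (fun_vs K A) c (delta K) A = \<zero>\<^bsub>fun_vs K A\<^esub>" "e \<in> A"
    have "(\<lambda>e. if e \<in> A then c e else \<zero>\<^bsub>K\<^esub>) = (\<lambda>_. \<zero>\<^bsub>K\<^esub>)"
      using c fam_sum_delta[OF K A, of A c] by auto
    then show "c e = \<zero>\<^bsub>K\<^esub>" using c(3) by (metis (full_types))
  qed (auto simp: delta_in_fin_funs[OF K])
  ultimately show "vectorspace.dim K (fun_vs K A) = card A" by simp
qed

text \<open>The family \<open>delta K\<close> is independent over every finite part of
  \<open>A\<close>, so finite dimension bounds the size of all finite subsets.\<close>

lemma fin_dim_fun_vs_iff:
  assumes K: "field K"
  shows "vectorspace.fin_dim K (fun_vs K A) \<longleftrightarrow> finite A"
proof
  assume fd: "vectorspace.fin_dim K (fun_vs K A)"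
  note V = vectorspace_fun_vs[OF K, of A]
  have "card D \<le> vectorspace.dim K (fun_vs K A)" if D: "finite D" "D \<subseteq> A" for D
  proof (rule independent_family_card_le_dim[OF V fd D(1), of "delta K"])
    fix c e assume c: "\<And>e. e \<in> D \<Longrightarrow> c e \<in> carrier K"
      "fam_sum (fun_vs K A) c (delta K) D = \<zero>\<^bsub>fun_vs K A\<^esub>" "e \<in> D"
    have "(\<lambda>e. if e \<in> D then c e else \<zero>\<^bsub>K\<^esub>) = (\<lambda>_. \<zero>\<^bsub>K\<^esub>)"
      using c fam_sum_delta[OF K D, of c] by auto
    then show "c e = \<zero>\<^bsub>K\<^esub>" using c(3) by (metis (full_types))
  qed (use D in \<open>auto simp: delta_in_fin_funs[OF K]\<close>)
  then show "finite A" by (metis finite_if_finite_subsets_card_bdd)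
qed (use dim_fun_vs[OF K] in auto)

lemma bij_fin_dim:
  fixes V :: "('k, 'v) module" and W :: "('k, 'w) module"
  assumes T: "linear_map K V W T" and b: "bij_betw T (carrier V) (carrier W)"
  shows "vectorspace.fin_dim K V \<longleftrightarrow> vectorspace.fin_dim K W"
    and "vectorspace.fin_dim K V \<Longrightarrow> vectorspace.dim K V = vectorspace.dim K W"
proof -
  show *: "vectorspace.fin_dim K V \<longleftrightarrow> vectorspace.fin_dim K W"
    using injective_fin_dim[OF T] surjective_fin_dim[OF T] b by (auto simp: bij_betw_def)
  assume "vectorspace.fin_dim K V"
  then show "vectorspace.dim K V = vectorspace.dim K W"
    using injective_dim_le[OF T] injective_dim_le[OF linear_map_inv[OF T b]] * b bij_betw_inv_into[OF b]
    by (auto simp: bij_betw_def intro!: antisym)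
qed

lemma bij_fun_vs_dim:
  fixes V :: "('k, 'v) module"
  assumes T: "linear_map K V (fun_vs K A) T" and b: "bij_betw T (carrier V) (fin_funs K A)"
  shows "vectorspace.fin_dim K V \<longleftrightarrow> finite A"
    and "finite A \<Longrightarrow> vectorspace.dim K V = card A"
proof -
  have K: "field K" using linear_map_dom[OF T] by (simp add: vectorspace_def)
  show *: "vectorspace.fin_dim K V \<longleftrightarrow> finite A"
    using bij_fin_dim(1)[OF T] b by (simp add: fin_dim_fun_vs_iff[OF K])
  show "finite A \<Longrightarrow> vectorspace.dim K V = card A"
    using bij_fin_dim(2)[OF T] b * by (simp add: dim_fun_vs[OF K])
qed

text \<open>An isomorphism with a direct sum of interval modules, rewritten with all values in one
  function space. Convexity of the sets \<open>J e\<close> enters on the way back to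
  \<open>pmod_iso\<close>, where the direct sum must itself be a module.\<close>

definition coords ::
  "('k, 'm) ring_scheme \<Rightarrow> ('i::order, 'k, 'v) pmod \<Rightarrow> 'e set \<Rightarrow> ('e \<Rightarrow> 'i set) \<Rightarrow>
    ('i \<Rightarrow> 'v \<Rightarrow> 'e \<Rightarrow> 'k) \<Rightarrow> bool" where
  "coords K P E J g \<longleftrightarrow> pmodule K P \<and>
    (\<forall>a. linear_map K (Sp P a) (fun_vs K {e\<in>E. a \<in> J e}) (g a) \<and>
         bij_betw (g a) (carrier (Sp P a)) (fin_funs K {e\<in>E. a \<in> J e})) \<and>
    (\<forall>a b x. a \<le> b \<longrightarrow> x \<in> carrier (Sp P a) \<longrightarrow>
      g b (Tr P a b x) = (\<lambda>e. if a \<in> J e \<and> b \<in> J e then g a x e else \<zero>\<^bsub>K\<^esub>))"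

lemma pmodule_field: "pmodule K P \<Longrightarrow> field K"
  using pmodule.space vectorspace_def by blast

lemma pmodule_Tr:
  assumes "pmodule K P" "a \<le> b"
  shows pmodule_Tr_closed: "x \<in> carrier (Sp P a) \<Longrightarrow> Tr P a b x \<in> carrier (Sp P b)"
    and pmodule_Tr_add: "x \<in> carrier (Sp P a) \<Longrightarrow> y \<in> carrier (Sp P a) \<Longrightarrow>
      Tr P a b (x \<oplus>\<^bsub>Sp P a\<^esub> y) = Tr P a b x \<oplus>\<^bsub>Sp P b\<^esub> Tr P a b y"
    and pmodule_Tr_smult: "c \<in> carrier K \<Longrightarrow> x \<in> carrier (Sp P a) \<Longrightarrow>
      Tr P a b (c \<odot>\<^bsub>Sp P a\<^esub> x) = c \<odot>\<^bsub>Sp P b\<^esub> Tr P a b x"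
    and pmodule_Tr_zero: "Tr P a b \<zero>\<^bsub>Sp P a\<^esub> = \<zero>\<^bsub>Sp P b\<^esub>"
  using linear_mapD[OF pmodule.transition[OF assms]] by blast+

section \<open>Translation between direct sums and coordinates\<close>

lemma dsum_simps [simp]:
  "carrier (Sp (dsum E P) a) = {x \<in> (\<Pi>\<^sub>E e\<in>E. carrier (Sp (P e) a)). finite {e \<in> E. x e \<noteq> \<zero>\<^bsub>Sp (P e) a\<^esub>}}"
  "\<zero>\<^bsub>Sp (dsum E P) a\<^esub> = (\<lambda>e\<in>E. \<zero>\<^bsub>Sp (P e) a\<^esub>)"
  "x \<oplus>\<^bsub>Sp (dsum E P) a\<^esub> y = (\<lambda>e\<in>E. x e \<oplus>\<^bsub>Sp (P e) a\<^esub> y e)"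
  "c \<odot>\<^bsub>Sp (dsum E P) a\<^esub> x = (\<lambda>e\<in>E. c \<odot>\<^bsub>Sp (P e) a\<^esub> x e)"
  "Tr (dsum E P) a b x = (\<lambda>e\<in>E. Tr (P e) a b (x e))"
  by (simp_all add: dsum_def)

lemma interval_mod_simps [simp]:
  "carrier (Sp (interval_mod K J) a) = (if a \<in> J then carrier K else {\<zero>\<^bsub>K\<^esub>})"
  "\<zero>\<^bsub>Sp (interval_mod K J) a\<^esub> = \<zero>\<^bsub>K\<^esub>"
  "x \<oplus>\<^bsub>Sp (interval_mod K J) a\<^esub> y = x \<oplus>\<^bsub>K\<^esub> y"
  "c \<odot>\<^bsub>Sp (interval_mod K J) a\<^esub> y = c \<otimes>\<^bsub>K\<^esub> y"
  "Tr (interval_mod K J) a b x = (if a \<in> J \<and> b \<in> J then x else \<zero>\<^bsub>K\<^esub>)"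
  by (simp_all add: interval_mod_def)

abbreviation interval_sum ::
  "('k, 'm) ring_scheme \<Rightarrow> 'e set \<Rightarrow> ('e \<Rightarrow> 'i set) \<Rightarrow> ('i, 'k, 'e \<Rightarrow> 'k) pmod" where
  "interval_sum K E J \<equiv> dsum E (\<lambda>e. interval_mod K (J e))"

definition extend0 :: "('k, 'm) ring_scheme \<Rightarrow> 'e set \<Rightarrow> ('e \<Rightarrow> 'k) \<Rightarrow> 'e \<Rightarrow> 'k" where
  "extend0 K E x = (\<lambda>e. if e \<in> E then x e else \<zero>\<^bsub>K\<^esub>)"

abbreviation alive :: "'e set \<Rightarrow> ('e \<Rightarrow> 'i set) \<Rightarrow> 'i \<Rightarrow> 'e set" where
  "alive E J a \<equiv> {e \<in> E. a \<in> J e}"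

lemma carrier_dsum_interval:
  assumes "field K"
  shows "carrier (Sp (interval_sum K E J) a) =
    {x \<in> extensional E. extend0 K E x \<in> fin_funs K (alive E J a)}"
proof -
  interpret field K by fact
  have fs: "{e. extend0 K E x e \<noteq> \<zero>\<^bsub>K\<^esub>} = {e \<in> E. x e \<noteq> \<zero>\<^bsub>K\<^esub>}" for x
    by (auto simp: extend0_def)
  have "x \<in> carrier (Sp (interval_sum K E J) a) \<longleftrightarrow>
      x \<in> extensional E \<and> extend0 K E x \<in> fin_funs K (alive E J a)" for x
    unfolding fin_funs_def mem_Collect_eq fs
    by (simp add: PiE_def Pi_def extend0_def) (use zero_closed in \<open>auto split: if_splits\<close>)
  then show ?thesis by blast
qed

lemma extend0_restrict: "x \<in> fin_funs K (alive E J a) \<Longrightarrow> extend0 K E (restrict x E) = x"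
  by (auto simp: extend0_def fin_funs_def fun_eq_iff)

lemma restrict_extend0: "x \<in> extensional E \<Longrightarrow> restrict (extend0 K E x) E = x"
  by (auto simp: extend0_def fun_eq_iff extensional_def)

lemma extend0_bij:
  assumes K: "field K"
  shows "bij_betw (extend0 K E) (carrier (Sp (interval_sum K E J) a)) (fin_funs K (alive E J a))"
    and "bij_betw (\<lambda>x. restrict x E) (fin_funs K (alive E J a)) (carrier (Sp (interval_sum K E J) a))"
  unfolding carrier_dsum_interval[OF K]
  by (rule bij_betw_byWitness[where f' = "\<lambda>x. restrict x E"] bij_betw_byWitness[where f' = "extend0 K E"];
      auto simp: extend0_restrict restrict_extend0)+

lemma vectorspace_dsum_interval:
  assumes K: "field K"
  shows "vectorspace K (Sp (interval_sum K E J) a)"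
  using bij_betw_imp_surj_on[OF extend0_bij(2)[where E = E and J = J and a = a, OF K]]
  by (intro vectorspace_image[OF vectorspace_fun_vs[OF K, of "(alive E J a)"],
        where h = "\<lambda>x. restrict x E"]) (auto simp: fun_eq_iff)

lemma pmodule_dsum_interval:
  assumes K: "field K"
    and convex: "\<And>e a b c. e \<in> E \<Longrightarrow> a \<in> J e \<Longrightarrow> c \<in> J e \<Longrightarrow> a \<le> b \<Longrightarrow> b \<le> c \<Longrightarrow> b \<in> J e"
  shows "pmodule K (interval_sum K E J)" (is "pmodule K ?D")
proof -
  interpret field K by fact
  have cl: "Tr ?D a b x \<in> carrier (Sp ?D b)" if "x \<in> carrier (Sp ?D a)" for a b x
  proof -
    have "extend0 K E (Tr ?D a b x) = (\<lambda>e. if e \<in> {e. a \<in> J e \<and> b \<in> J e} then extend0 K E x e else \<zero>\<^bsub>K\<^esub>)"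
      by (auto simp: extend0_def)
    also have "\<dots> \<in> fin_funs K ((alive E J a) \<inter> {e. a \<in> J e \<and> b \<in> J e})"
      using that unfolding carrier_dsum_interval[OF K] by (intro fin_funs_restrict[OF K]) auto
    finally have "extend0 K E (Tr ?D a b x) \<in> fin_funs K (alive E J b)"
      by (rule fin_funs_mono) auto
    then show ?thesis unfolding carrier_dsum_interval[OF K] by simp
  qed
  show ?thesis
  proof (rule pmodule.intro)
    show "vectorspace K (Sp ?D a)" for a by (rule vectorspace_dsum_interval[OF K])
    show "linear_map K (Sp ?D a) (Sp ?D b) (Tr ?D a b)" for a b
    proof (rule linear_mapI[OF vectorspace_dsum_interval[OF K] vectorspace_dsum_interval[OF K]])
      show "Tr ?D a b x \<in> carrier (Sp ?D b)" if "x \<in> carrier (Sp ?D a)" for x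
        using that by (rule cl)
      show "Tr ?D a b (x \<oplus>\<^bsub>Sp ?D a\<^esub> y) = Tr ?D a b x \<oplus>\<^bsub>Sp ?D b\<^esub> Tr ?D a b y" for x y
        by (auto simp: fun_eq_iff)
      show "Tr ?D a b (c \<odot>\<^bsub>Sp ?D a\<^esub> x) = c \<odot>\<^bsub>Sp ?D b\<^esub> Tr ?D a b x" if "c \<in> carrier K" for c x
        using that by (auto simp: fun_eq_iff)
    qed
    show "Tr ?D a a x = x" if "x \<in> carrier (Sp ?D a)" for a x
    proof
      fix e
      show "Tr ?D a a x e = x e"
        using that unfolding dsum_simps(1) by (cases "e \<in> E") (auto simp: PiE_iff extensional_def)
    qed
    show "Tr ?D b c (Tr ?D a b x) = Tr ?D a c x" if "a \<le> b" "b \<le> c" "x \<in> carrier (Sp ?D a)" for a b c x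
    proof
      fix e
      \<comment> \<open>Convexity keeps a summand alive at the intermediate degree; otherwise the
        composite through \<open>b\<close> could vanish where the direct transition does
        not.\<close>
      have "b \<in> J e" if "e \<in> E" "a \<in> J e" "c \<in> J e"
        using convex[OF that \<open>a \<le> b\<close> \<open>b \<le> c\<close>] .
      then show "Tr ?D b c (Tr ?D a b x) e = Tr ?D a c x e" by (cases "e \<in> E") auto
    qed
  qed
qed

lemma iso_dsum_imp_coords:
  assumes "pmod_iso K P (interval_sum K E J)" (is "pmod_iso K P ?D")
  shows "\<exists>g. coords K P E J g"
proof -
  obtain g where g: "pmod_hom K P ?D g"
    and b: "\<And>a. bij_betw (g a) (carrier (Sp P a)) (carrier (Sp ?D a))"
    using assms by (auto simp: pmod_iso_def)
  have P: "pmodule K P" using g by (simp add: pmod_hom_def)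
  note K = pmodule_field[OF P]
  interpret field K by fact
  have lin: "linear_map K (Sp ?D a) (fun_vs K (alive E J a)) (extend0 K E)" for a
    by (rule linear_mapI[OF vectorspace_dsum_interval[OF K] vectorspace_fun_vs[OF K]])
      (unfold carrier_dsum_interval[OF K], auto simp: extend0_def fun_eq_iff)
  have "coords K P E J (\<lambda>a x. extend0 K E (g a x))"
    unfolding coords_def
  proof (intro conjI allI impI)
    show "pmodule K P" by fact
    show "linear_map K (Sp P a) (fun_vs K (alive E J a)) (\<lambda>x. extend0 K E (g a x))" for a
      by (rule linear_map_compose[OF pmod_hom.component[OF g] lin])
    show "bij_betw (\<lambda>x. extend0 K E (g a x)) (carrier (Sp P a)) (fin_funs K (alive E J a))" for a
      using bij_betw_trans[OF b extend0_bij(1)[OF K]] by (simp add: o_def)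
    show "extend0 K E (g b (Tr P a b x)) = (\<lambda>e. if a \<in> J e \<and> b \<in> J e then extend0 K E (g a x) e else \<zero>\<^bsub>K\<^esub>)"
      if "a \<le> b" "x \<in> carrier (Sp P a)" for a b x
      using pmod_hom.natural[OF g that] by (auto simp: extend0_def fun_eq_iff)
  qed
  then show ?thesis by blast
qed

lemma coords_imp_iso_dsum:
  assumes g: "coords K P E J g"
    and convex: "\<And>e a b c. e \<in> E \<Longrightarrow> a \<in> J e \<Longrightarrow> c \<in> J e \<Longrightarrow> a \<le> b \<Longrightarrow> b \<le> c \<Longrightarrow> b \<in> J e"
  shows "pmod_iso K P (interval_sum K E J)" (is "pmod_iso K P ?D")
proof -
  have P: "pmodule K P" using g by (simp add: coords_def)
  note K = pmodule_field[OF P]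
  interpret field K by fact
  have lin: "linear_map K (Sp P a) (fun_vs K (alive E J a)) (g a)"
    and bij: "bij_betw (g a) (carrier (Sp P a)) (fin_funs K (alive E J a))" for a
    using g by (auto simp: coords_def)
  have lin': "linear_map K (fun_vs K (alive E J a)) (Sp ?D a) (\<lambda>x. restrict x E)" for a
  proof (rule linear_mapI[OF vectorspace_fun_vs[OF K] vectorspace_dsum_interval[OF K]])
    show "restrict x E \<in> carrier (Sp ?D a)" if "x \<in> carrier (fun_vs K (alive E J a))" for x
      using that bij_betwE[OF extend0_bij(2)[where E = E and J = J and a = a, OF K]] unfolding fun_vs_simps by blast
  qed (auto simp: fun_eq_iff)
  have "pmod_hom K P ?D (\<lambda>a x. restrict (g a x) E)"
    unfolding pmod_hom_def pmod_hom_axioms_def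
  proof (intro conjI allI impI)
    show "linear_map K (Sp P a) (Sp ?D a) (\<lambda>x. restrict (g a x) E)" for a
      by (rule linear_map_compose[OF lin lin'])
    show "restrict (g b (Tr P a b x)) E = Tr ?D a b (restrict (g a x) E)"
      if "a \<le> b" "x \<in> carrier (Sp P a)" for a b x
      using g that by (auto simp: coords_def fun_eq_iff)
  qed (use P pmodule_dsum_interval[OF K convex] in auto)
  moreover have "bij_betw (\<lambda>x. restrict (g a x) E) (carrier (Sp P a)) (carrier (Sp ?D a))" for a
    using bij_betw_trans[OF bij extend0_bij(2)[OF K]] by (simp add: o_def)
  ultimately show ?thesis unfolding pmod_iso_def by blast
qed

section \<open>Free modules and their barcodes\<close>

lemma coordsD:
  assumes "coords K P E J g"
  shows coords_pmodule: "pmodule K P"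
    and coords_linear: "linear_map K (Sp P a) (fun_vs K (alive E J a)) (g a)"
    and coords_bij: "bij_betw (g a) (carrier (Sp P a)) (fin_funs K (alive E J a))"
    and coords_Tr: "a \<le> b \<Longrightarrow> x \<in> carrier (Sp P a) \<Longrightarrow>
      g b (Tr P a b x) = (\<lambda>e. if a \<in> J e \<and> b \<in> J e then g a x e else \<zero>\<^bsub>K\<^esub>)"
  using assms by (auto simp: coords_def)

lemma coords_mem:
  assumes "coords K P E J g" "x \<in> carrier (Sp P a)"
  shows "g a x \<in> fin_funs K (alive E J a)"
  using bij_betwE[OF coords_bij[OF assms(1), of a]] assms(2) by blast

lemma coords_inj:
  assumes "coords K P E J g" "x \<in> carrier (Sp P a)" "y \<in> carrier (Sp P a)" "g a x = g a y"
  shows "x = y"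
  using inj_onD[OF bij_betw_imp_inj_on[OF coords_bij[OF assms(1), of a]] assms(4,2,3)] .

lemma coords_surj:
  assumes "coords K P E J g" "c \<in> fin_funs K (alive E J a)"
  obtains x where "x \<in> carrier (Sp P a)" "g a x = c"
proof -
  have "c \<in> g a ` carrier (Sp P a)"
    unfolding bij_betw_imp_surj_on[OF coords_bij[OF assms(1)]] by (rule assms(2))
  then show thesis using that by (elim imageE) simp
qed

lemma coords_zero:
  assumes "coords K P E J g"
  shows "g a \<zero>\<^bsub>Sp P a\<^esub> = (\<lambda>_. \<zero>\<^bsub>K\<^esub>)"
  using linear_map_zero[OF coords_linear[OF assms, of a]] by simp

text \<open>Coordinates at labels outside \<open>E\<close> are zero, so only the sets attached to
  labels in \<open>E\<close> are seen.\<close>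

lemma coords_cong:
  assumes g: "coords K P E J g" and J: "\<And>e. e \<in> E \<Longrightarrow> J e = J' e"
  shows "coords K P E J' g"
proof -
  have s: "(alive E J' a) = (alive E J a)" for a using J by auto
  show ?thesis
    unfolding coords_def s
  proof (intro conjI allI impI)
    show "g b (Tr P a b x) = (\<lambda>e. if a \<in> J' e \<and> b \<in> J' e then g a x e else \<zero>\<^bsub>K\<^esub>)"
      if "a \<le> b" "x \<in> carrier (Sp P a)" for a b x
    proof
      fix e
      show "g b (Tr P a b x) e = (if a \<in> J' e \<and> b \<in> J' e then g a x e else \<zero>\<^bsub>K\<^esub>)"
        using coords_Tr[OF g that] J[of e] fin_funsD(3)[OF coords_mem[OF g that(2)], of e]
        by (cases "e \<in> E") auto
    qed
  qed (use coordsD[OF g] in auto)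
qed

text \<open>Needed to trade the labels of a basis for the numbered copies in \<open>rep\<close>,
  over which interval decompositions are indexed.\<close>

lemma coords_reindex:
  assumes g: "coords K P E J g" and \<beta>: "bij_betw \<beta> E' E" and J: "\<And>e. e \<in> E' \<Longrightarrow> J' e = J (\<beta> e)"
  shows "coords K P E' J' (\<lambda>a x e. if e \<in> E' then g a x (\<beta> e) else \<zero>\<^bsub>K\<^esub>)"
proof -
  note P = coords_pmodule[OF g]
  note K = pmodule_field[OF P]
  interpret field K by fact
  define pull where "pull = (\<lambda>c e. if e \<in> E' then c (\<beta> e) else \<zero>\<^bsub>K\<^esub>)"
  define push where "push = (\<lambda>c e. if e \<in> E then c (inv_into E' \<beta> e) else \<zero>\<^bsub>K\<^esub>)"
  have inv: "inv_into E' \<beta> e \<in> E'" "\<beta> (inv_into E' \<beta> e) = e" if "e \<in> E" for e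
    using \<beta> that by (auto simp: bij_betw_def inv_into_into f_inv_into_f)
  have inv': "inv_into E' \<beta> (\<beta> e) = e" "\<beta> e \<in> E" if "e \<in> E'" for e
    using \<beta> that by (auto simp: bij_betw_def)
  have pull: "pull c \<in> fin_funs K (alive E' J' a)" if "c \<in> fin_funs K (alive E J a)" for c a
  proof -
    have "{e. pull c e \<noteq> \<zero>\<^bsub>K\<^esub>} \<subseteq> inv_into E' \<beta> ` {e. c e \<noteq> \<zero>\<^bsub>K\<^esub>}"
      using inv' by (force simp: pull_def split: if_splits)
    then have "finite {e. pull c e \<noteq> \<zero>\<^bsub>K\<^esub>}"
      using fin_funsD(2)[OF that] finite_surj by blast
    then show ?thesis using that J inv' by (auto simp: fin_funs_def pull_def)
  qed
  have push: "push c \<in> fin_funs K (alive E J a)" if "c \<in> fin_funs K (alive E' J' a)" for c a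
  proof -
    have "{e. push c e \<noteq> \<zero>\<^bsub>K\<^esub>} \<subseteq> \<beta> ` {e. c e \<noteq> \<zero>\<^bsub>K\<^esub>}"
      using inv by (force simp: push_def split: if_splits)
    then have "finite {e. push c e \<noteq> \<zero>\<^bsub>K\<^esub>}"
      using fin_funsD(2)[OF that] finite_surj by blast
    moreover have "push c e = \<zero>\<^bsub>K\<^esub>" if "e \<notin> (alive E J a)" for e
      using that fin_funsD(3)[OF \<open>c \<in> _\<close>, of "inv_into E' \<beta> e"] J inv
      by (cases "e \<in> E") (auto simp: push_def)
    ultimately show ?thesis using fin_funsD(1)[OF that] by (auto simp: fin_funs_def push_def)
  qed
  have pull_bij: "bij_betw pull (fin_funs K (alive E J a)) (fin_funs K (alive E' J' a))" for a
  proof (rule bij_betw_byWitness[where f' = push])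
    show "\<forall>c\<in>fin_funs K (alive E J a). push (pull c) = c"
      using inv by (auto simp: fun_eq_iff push_def pull_def fin_funs_def)
    show "\<forall>c\<in>fin_funs K (alive E' J' a). pull (push c) = c"
      using inv' by (auto simp: fun_eq_iff push_def pull_def fin_funs_def)
  qed (use pull push in auto)
  have pull_lin: "linear_map K (fun_vs K (alive E J a)) (fun_vs K (alive E' J' a)) pull" for a
    by (rule linear_mapI[OF vectorspace_fun_vs[OF K] vectorspace_fun_vs[OF K]])
      (use pull in \<open>auto simp: pull_def\<close>)
  have "coords K P E' J' (\<lambda>a x. pull (g a x))"
    unfolding coords_def
  proof (intro conjI allI impI P)
    show "linear_map K (Sp P a) (fun_vs K (alive E' J' a)) (\<lambda>x. pull (g a x))" for a
      by (rule linear_map_compose[OF coords_linear[OF g] pull_lin])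
    show "bij_betw (\<lambda>x. pull (g a x)) (carrier (Sp P a)) (fin_funs K (alive E' J' a))" for a
      using bij_betw_trans[OF coords_bij[OF g] pull_bij] by (simp add: o_def)
    show "pull (g b (Tr P a b x)) = (\<lambda>e. if a \<in> J' e \<and> b \<in> J' e then pull (g a x) e else \<zero>\<^bsub>K\<^esub>)"
      if "a \<le> b" "x \<in> carrier (Sp P a)" for a b x
      using coords_Tr[OF g that] J by (auto simp: pull_def)
  qed
  then show ?thesis by (simp add: pull_def)
qed

lemma coords_pfd_iff:
  assumes g: "coords K P E J g"
  shows "pfd K P \<longleftrightarrow> (\<forall>a. finite (alive E J a))"
  using bij_fun_vs_dim(1)[OF coords_linear[OF g] coords_bij[OF g]] by (simp add: pfd_def)

lemma coords_dim:
  assumes g: "coords K P E J g" and "finite (alive E J a)"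
  shows "vectorspace.dim K (Sp P a) = card (alive E J a)"
  using bij_fun_vs_dim(2)[OF coords_linear[OF g, of a] coords_bij[OF g, of a] assms(2)] .

abbreviation free_coords where
  "free_coords K P E deg \<equiv> coords K P E (\<lambda>e. {deg e..})"

text \<open>A nonzero coordinate at \<open>a\<close> belongs to a generator below \<open>a\<close>,
  hence also below \<open>b\<close>, so the case distinction in \<open>coords\<close> never cuts
  anything off. Most later arguments rest on this invariance.\<close>

lemma free_coords_Tr:
  assumes g: "free_coords K P E deg g" and "a \<le> b" "x \<in> carrier (Sp P a)"
  shows "g b (Tr P a b x) = g a x"
proof
  fix e
  show "g b (Tr P a b x) e = g a x e"
    using coords_Tr[OF assms] fin_funsD(3)[OF coords_mem[OF g assms(3)], of e]
      order_trans[OF _ assms(2), of "deg e"]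
    by (cases "e \<in> E \<and> deg e \<le> a") auto
qed

section \<open>Tame modules over a lattice\<close>

text \<open>Finitely many degrees that feed everything at or below \<open>a\<close>. The alternative
  of a zero space covers degrees above no generator.\<close>

abbreviation critical_set :: "('i::lattice, 'k, 'v) pmod \<Rightarrow> 'i \<Rightarrow> 'i set \<Rightarrow> bool" where
  "critical_set P a F \<equiv> finite F \<and> (\<forall>b\<le>a. carrier (Sp P b) = {\<zero>\<^bsub>Sp P b\<^esub>} \<or>
    (\<exists>d\<in>F. d \<le> b \<and> carrier (Sp P b) \<subseteq> Tr P d b ` carrier (Sp P d)))"

text \<open>The second clause says that images from \<open>a\<close> and \<open>b\<close> meet in
  the image from the meet. All clauses speak of spaces and transition maps alone and make sense over
  any lattice, so that one notion serves both for the plane and for the real line.\<close>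

definition tame :: "('i::lattice, 'k, 'v) pmod \<Rightarrow> bool" where
  "tame P \<longleftrightarrow>
    (\<forall>a b. a \<le> b \<longrightarrow> inj_on (Tr P a b) (carrier (Sp P a))) \<and>
    (\<forall>a b c. a \<le> c \<longrightarrow> b \<le> c \<longrightarrow> (\<forall>x\<in>carrier (Sp P a). \<forall>y\<in>carrier (Sp P b).
      Tr P a c x = Tr P b c y \<longrightarrow> x \<in> Tr P (inf a b) a ` carrier (Sp P (inf a b)))) \<and>
    (\<forall>a. \<exists>F. critical_set P a F)"

lemma tame_inj:
  "tame P \<Longrightarrow> a \<le> b \<Longrightarrow> x \<in> carrier (Sp P a) \<Longrightarrow> y \<in> carrier (Sp P a) \<Longrightarrow> Tr P a b x = Tr P a b y \<Longrightarrow> x = y"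
  unfolding tame_def inj_on_def by blast

lemma tame_inf:
  assumes "tame P" "a \<le> c" "b \<le> c" "x \<in> carrier (Sp P a)" "y \<in> carrier (Sp P b)" "Tr P a c x = Tr P b c y"
  obtains z where "z \<in> carrier (Sp P (inf a b))" "Tr P (inf a b) a z = x"
  using assms unfolding tame_def by (metis imageE)

lemma tame_critical:
  assumes "tame P"
  shows "\<exists>F. critical_set P a F"
  using assms unfolding tame_def by blast

text \<open>With \<open>S\<close> the points of \<Gamma> below \<open>b\<close>, the supremum of
  \<open>S\<close> lies below \<open>b\<close> and has the same points of \<Gamma> below it. The
  suprema of the nonempty subsets of \<Gamma> therefore form a critical set.\<close>

lemma critical_from_points:
  fixes P :: "('i::lattice, 'k, 'v) pmod"
  assumes \<Gamma>: "finite \<Gamma>"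
    and triv: "\<And>b. b \<le> a \<Longrightarrow> {c \<in> \<Gamma>. c \<le> b} = {} \<Longrightarrow> carrier (Sp P b) = {\<zero>\<^bsub>Sp P b\<^esub>}"
    and onto: "\<And>d b. d \<le> b \<Longrightarrow> b \<le> a \<Longrightarrow> (\<And>c. c \<in> \<Gamma> \<Longrightarrow> c \<le> b \<Longrightarrow> c \<le> d) \<Longrightarrow>
      carrier (Sp P b) \<subseteq> Tr P d b ` carrier (Sp P d)"
  shows "\<exists>F. critical_set P a F"
proof (intro exI conjI allI impI)
  show "finite (Sup_fin ` (Pow \<Gamma> - {{}}))" using \<Gamma> by simp
  fix b assume b: "b \<le> a"
  define S where "S = {c \<in> \<Gamma>. c \<le> b}"
  have fS: "finite S" using \<Gamma> by (simp add: S_def)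
  show "carrier (Sp P b) = {\<zero>\<^bsub>Sp P b\<^esub>} \<or> (\<exists>d\<in>Sup_fin ` (Pow \<Gamma> - {{}}). d \<le> b \<and>
      carrier (Sp P b) \<subseteq> Tr P d b ` carrier (Sp P d))"
  proof (cases "S = {}")
    case True
    then show ?thesis using triv[OF b] by (simp add: S_def)
  next
    case False
    have "c \<le> b" if "c \<in> S" for c using that by (simp add: S_def)
    then have "Sup_fin S \<le> b" by (rule Sup_fin.boundedI[OF fS False])
    moreover have "carrier (Sp P b) \<subseteq> Tr P (Sup_fin S) b ` carrier (Sp P (Sup_fin S))"
    proof (rule onto[OF \<open>Sup_fin S \<le> b\<close> b])
      fix c assume "c \<in> \<Gamma>" "c \<le> b"
      then have "c \<in> S" by (simp add: S_def)
      then show "c \<le> Sup_fin S" by (rule Sup_fin.coboundedI[OF fS])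
    qed
    moreover have "Sup_fin S \<in> Sup_fin ` (Pow \<Gamma> - {{}})" using False by (auto simp: S_def)
    ultimately show ?thesis by blast
  qed
qed

lemma fin_funs_empty: "c \<in> fin_funs K {} \<Longrightarrow> c = (\<lambda>_. \<zero>\<^bsub>K\<^esub>)"
  by (rule ext) (simp add: fin_funs_def)

lemma free_coords_trivial:
  assumes g: "free_coords K P E deg g" and e: "{e \<in> E. deg e \<le> b} = {}"
  shows "carrier (Sp P b) = {\<zero>\<^bsub>Sp P b\<^esub>}"
proof -
  interpret vectorspace K "Sp P b" using pmodule.space[OF coords_pmodule[OF g]] .
  have "x = \<zero>\<^bsub>Sp P b\<^esub>" if "x \<in> carrier (Sp P b)" for x
  proof (rule coords_inj[OF g that M.zero_closed])
    have "g b x \<in> fin_funs K {}" using coords_mem[OF g that] e by simp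
    then show "g b x = g b \<zero>\<^bsub>Sp P b\<^esub>" by (simp add: fin_funs_empty coords_zero[OF g])
  qed
  then show ?thesis by auto
qed

text \<open>When their support lies below \<open>d\<close>, the coordinates of \<open>x\<close> are
  admissible already at \<open>d\<close>. Surjectivity there gives an element, and invariance under
  transitions together with injectivity of coordinates identifies its image with
  \<open>x\<close>.\<close>

lemma free_coords_lift:
  assumes g: "free_coords K P E deg g" and d: "d \<le> b" and x: "x \<in> carrier (Sp P b)"
    and supp: "\<And>e. e \<in> E \<Longrightarrow> deg e \<le> b \<Longrightarrow> g b x e \<noteq> \<zero>\<^bsub>K\<^esub> \<Longrightarrow> deg e \<le> d"
  obtains y where "y \<in> carrier (Sp P d)" "Tr P d b y = x" "g d y = g b x"
proof -
  have "g b x \<in> fin_funs K {e \<in> E. d \<in> {deg e..}}"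
    by (rule fin_funs_mono[OF coords_mem[OF g x]]) (use supp in auto)
  then obtain y where y: "y \<in> carrier (Sp P d)" "g d y = g b x"
    by (rule coords_surj[OF g])
  moreover have "Tr P d b y = x"
    using free_coords_Tr[OF g d y(1)] y(2) x coords_inj[OF g _ x]
      pmodule_Tr_closed[OF coords_pmodule[OF g] d y(1)] by simp
  ultimately show thesis using that by blast
qed

text \<open>For the second clause, elements with a common image have the same coordinates, whose
  support lies below both degrees and thus below the meet. For the third, the points are the
  finitely many generator degrees below \<open>a\<close>.\<close>

lemma free_coords_tame:
  assumes g: "free_coords K P E deg g" and fin: "pfd K P"
  shows "tame P"
  unfolding tame_def
proof (intro conjI allI impI ballI)
  show "inj_on (Tr P a b) (carrier (Sp P a))" if "a \<le> b" for a b
    using free_coords_Tr[OF g that] coords_inj[OF g] by (metis inj_onI)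
next
  fix a b c x y
  assume h: "a \<le> c" "b \<le> c" "x \<in> carrier (Sp P a)" "y \<in> carrier (Sp P b)" "Tr P a c x = Tr P b c y"
  have eq: "g a x = g b y"
    using free_coords_Tr[OF g h(1,3)] free_coords_Tr[OF g h(2,4)] h(5) by simp
  have "deg e \<le> inf a b" if "e \<in> E" "deg e \<le> a" "g a x e \<noteq> \<zero>\<^bsub>K\<^esub>" for e
    using that fin_funsD(3)[OF coords_mem[OF g h(4)], of e] eq by auto
  then obtain z where "z \<in> carrier (Sp P (inf a b))" "Tr P (inf a b) a z = x"
    using free_coords_lift[OF g _ h(3), of "inf a b"] by auto
  then show "x \<in> Tr P (inf a b) a ` carrier (Sp P (inf a b))" by blast
next
  fix a
  have f: "finite {e \<in> E. deg e \<le> a}" using coords_pfd_iff[OF g] fin by simp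
  show "\<exists>F. critical_set P a F"
  proof (rule critical_from_points)
    show "finite (deg ` {e \<in> E. deg e \<le> a})" using f by simp
    show "carrier (Sp P b) = {\<zero>\<^bsub>Sp P b\<^esub>}"
      if "b \<le> a" "{c \<in> deg ` {e \<in> E. deg e \<le> a}. c \<le> b} = {}" for b
      using that by (intro free_coords_trivial[OF g]) (auto intro: order_trans)
    show "carrier (Sp P b) \<subseteq> Tr P d b ` carrier (Sp P d)"
      if "d \<le> b" "b \<le> a" and db: "\<And>c. c \<in> deg ` {e \<in> E. deg e \<le> a} \<Longrightarrow> c \<le> b \<Longrightarrow> c \<le> d" for d b
    proof
      fix x assume x: "x \<in> carrier (Sp P b)"
      have "deg e \<le> d" if "e \<in> E" "deg e \<le> b" for e
        using that order_trans[OF that(2) \<open>b \<le> a\<close>] by (intro db) auto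
      then show "x \<in> Tr P d b ` carrier (Sp P d)"
        using free_coords_lift[OF g \<open>d \<le> b\<close> x] by (metis imageI)
    qed
  qed
qed

lemma delta_nonzero: "field K \<Longrightarrow> delta K e \<noteq> (\<lambda>_. \<zero>\<^bsub>K\<^esub>)"
proof
  assume "field K" and *: "delta K e = (\<lambda>_. \<zero>\<^bsub>K\<^esub>)"
  interpret field K by fact
  show False using fun_cong[OF *, of e] by (simp add: delta_def)
qed

text \<open>The argument follows the unit vector of \<open>e\<close>. Injective transitions make
  \<open>J e\<close> closed upwards, common lifts make it closed under meets, and every member of
  \<open>J e\<close> lies above one of finitely many critical members; the meet of these is the
  least element.\<close>

lemma tame_coords_principal:
  fixes P :: "('i::lattice, 'k, 'v) pmod"
  assumes tame: "tame P" and g: "coords K P E J g" and e: "e \<in> E" "J e \<noteq> {}"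
  shows "\<exists>m. J e = {m..}"
proof -
  note P = coords_pmodule[OF g]
  note K = pmodule_field[OF P]
  interpret field K by fact
  have unit: "\<exists>x\<in>carrier (Sp P a). g a x = delta K e" if "a \<in> J e" for a
    using coords_surj[OF g, of "delta K e" a] delta_in_fin_funs[OF K, of e "(alive E J a)"] e that
    by blast
  have up: "b \<in> J e" if "a \<in> J e" "a \<le> b" for a b
  proof (rule ccontr)
    assume b: "b \<notin> J e"
    interpret vectorspace K "Sp P a" using pmodule.space[OF P] .
    obtain x where x: "x \<in> carrier (Sp P a)" "g a x = delta K e" using unit \<open>a \<in> J e\<close> by blast
    have "g b (Tr P a b x) = (\<lambda>_. \<zero>\<^bsub>K\<^esub>)"
      using coords_Tr[OF g \<open>a \<le> b\<close> x(1)] b x(2) by (auto simp: delta_def fun_eq_iff)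
    also have "\<dots> = g b (Tr P a b \<zero>\<^bsub>Sp P a\<^esub>)"
      using pmodule_Tr_zero[OF P \<open>a \<le> b\<close>] coords_zero[OF g] by simp
    finally have "Tr P a b x = Tr P a b \<zero>\<^bsub>Sp P a\<^esub>"
      by (rule coords_inj[OF g, rotated 2]) (use pmodule_Tr_closed[OF P \<open>a \<le> b\<close>] x(1) in auto)
    then have "x = \<zero>\<^bsub>Sp P a\<^esub>" using tame_inj[OF tame \<open>a \<le> b\<close> x(1)] by simp
    then show False using x(2) coords_zero[OF g, of a] delta_nonzero[OF K, of e] by simp
  qed
  \<comment> \<open>A preimage of a unit vector can exist only at a degree where \<open>e\<close> is
    alive, since transitions set the coordinates of labels dead at the source to zero.\<close>
  have down: "a \<in> J e" if "a \<le> b" "x \<in> carrier (Sp P a)" "g b (Tr P a b x) = delta K e" for a b x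
  proof (rule ccontr)
    assume "a \<notin> J e"
    then have "delta K e = (\<lambda>_. \<zero>\<^bsub>K\<^esub>)"
      using coords_Tr[OF g that(1,2)] that(3) by (auto simp: delta_def fun_eq_iff split: if_splits)
    then show False using delta_nonzero[OF K, of e] by simp
  qed
  have meet: "inf a b \<in> J e" if ab: "a \<in> J e" "b \<in> J e" for a b
  proof -
    obtain x y where x: "x \<in> carrier (Sp P a)" "g a x = delta K e"
      and y: "y \<in> carrier (Sp P b)" "g b y = delta K e" using unit ab by meson
    have "sup a b \<in> J e" by (rule up[OF ab(1)]) simp
    have "g (sup a b) (Tr P a (sup a b) x) = delta K e" "g (sup a b) (Tr P b (sup a b) y) = delta K e"
      using coords_Tr[OF g _ x(1), of "sup a b"] coords_Tr[OF g _ y(1), of "sup a b"] x y ab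
        \<open>sup a b \<in> J e\<close> by (auto simp: delta_def fun_eq_iff)
    then have "Tr P a (sup a b) x = Tr P b (sup a b) y"
      using coords_inj[OF g pmodule_Tr_closed[OF P _ x(1), of "sup a b"]
        pmodule_Tr_closed[OF P _ y(1), of "sup a b"]] by simp
    then obtain z where "z \<in> carrier (Sp P (inf a b))" "Tr P (inf a b) a z = x"
      using tame_inf[OF tame _ _ x(1) y(1), of "sup a b"] by auto
    then show ?thesis by (intro down[of "inf a b" a z]) (simp_all add: x)
  qed
  obtain a where a: "a \<in> J e" using e by blast
  obtain F where F: "critical_set P a F" using tame_critical[OF tame] by blast
  have crit: "\<exists>d\<in>F \<inter> J e. d \<le> b" if b: "b \<in> J e" for b
  proof -
    \<comment> \<open>The critical set controls only degrees at or below \<open>a\<close>, so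
      \<open>b\<close> is first replaced by its meet with \<open>a\<close>.\<close>
    have ba: "inf b a \<in> J e" by (rule meet[OF b a])
    then obtain x where x: "x \<in> carrier (Sp P (inf b a))" "g (inf b a) x = delta K e" using unit by blast
    have "x \<noteq> \<zero>\<^bsub>Sp P (inf b a)\<^esub>"
    proof
      assume "x = \<zero>\<^bsub>Sp P (inf b a)\<^esub>"
      then show False using x(2) coords_zero[OF g, of "inf b a"] delta_nonzero[OF K, of e] by simp
    qed
    then obtain d where d: "d \<in> F" "d \<le> inf b a"
      "carrier (Sp P (inf b a)) \<subseteq> Tr P d (inf b a) ` carrier (Sp P d)"
      using F x(1) by (auto dest!: spec[of _ "inf b a"])
    then obtain z where "z \<in> carrier (Sp P d)" "Tr P d (inf b a) z = x" using x(1) by blast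
    then have "d \<in> J e" by (intro down[OF d(2), of z]) (simp_all add: x)
    then show ?thesis using d by auto
  qed
  have fin: "finite (F \<inter> J e)" and ne: "F \<inter> J e \<noteq> {}" using F crit[OF a] by auto
  have "Inf_fin A \<in> J e" if "finite A" "A \<noteq> {}" "A \<subseteq> J e" for A
    using that by (induction A rule: finite_ne_induct) (auto simp: meet)
  then have m: "Inf_fin (F \<inter> J e) \<in> J e" using fin ne by blast
  have "J e = {Inf_fin (F \<inter> J e)..}"
  proof
    show "J e \<subseteq> {Inf_fin (F \<inter> J e)..}"
    proof
      fix b assume "b \<in> J e"
      then obtain d where d: "d \<in> F \<inter> J e" "d \<le> b" using crit by blast
      have "Inf_fin (F \<inter> J e) \<le> d" using fin d(1) by (rule Inf_fin.coboundedI)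
      then show "b \<in> {Inf_fin (F \<inter> J e)..}" using d(2) by simp
    qed
    show "{Inf_fin (F \<inter> J e)..} \<subseteq> J e" using up[OF m] by auto
  qed
  then show ?thesis by blast
qed

section \<open>Uniqueness of multiplicities and the barcode of a free module\<close>

text \<open>The order need not be well-founded, so the induction is on the number of generators up
  to \<open>d\<close>. Removing the multiplicities at all strictly smaller degrees, which agree by
  induction, from the count up to \<open>d\<close> leaves the multiplicity at
  \<open>d\<close>.\<close>

lemma multiplicity_unique:
  fixes deg :: "'e \<Rightarrow> 'i::order" and deg' :: "'f \<Rightarrow> 'i"
  assumes fin: "\<And>a. finite {e \<in> E. deg e \<le> a}" and fin': "\<And>a. finite {e \<in> E'. deg' e \<le> a}"
    and eq: "\<And>a. card {e \<in> E. deg e \<le> a} = card {e \<in> E'. deg' e \<le> a}"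
  shows "card {e \<in> E. deg e = d} = card {e \<in> E'. deg' e = d}"
proof (induction "card {e \<in> E. deg e \<le> d}" arbitrary: d rule: less_induct)
  case less
  show ?case
  proof (cases "d \<in> deg ` E \<union> deg' ` E'")
    case False
    then have "{e \<in> E. deg e = d} = {}" "{e \<in> E'. deg' e = d} = {}" by auto
    then show ?thesis by (simp only: card.empty)
  next
    case True
    \<comment> \<open>Since \<open>d\<close> occurs in one of the two families, that family has
      strictly fewer members up to \<open>c\<close> than up to \<open>d\<close>; by equality of the
      counts the same holds for \<open>E\<close>.\<close>
    have smaller: "card {e \<in> E. deg e \<le> c} < card {e \<in> E. deg e \<le> d}" if "c < d" for c
    proof -
      have c: "c \<le> d" "\<not> d \<le> c" using that by (auto simp: less_le_not_le)
      then have sub: "{e \<in> E. deg e \<le> c} \<subseteq> {e \<in> E. deg e \<le> d}" "{e \<in> E'. deg' e \<le> c} \<subseteq> {e \<in> E'. deg' e \<le> d}"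
        using order_trans[OF _ c(1)] by auto
      have "{e \<in> E. deg e \<le> d} \<noteq> {e \<in> E. deg e \<le> c} \<or> {e \<in> E'. deg' e \<le> d} \<noteq> {e \<in> E'. deg' e \<le> c}"
        using True c(2) by blast
      then have "{e \<in> E. deg e \<le> c} \<subset> {e \<in> E. deg e \<le> d} \<or> {e \<in> E'. deg' e \<le> c} \<subset> {e \<in> E'. deg' e \<le> d}"
        using sub by blast
      then show ?thesis
      proof
        assume "{e \<in> E. deg e \<le> c} \<subset> {e \<in> E. deg e \<le> d}"
        then show ?thesis by (rule psubset_card_mono[OF fin])
      next
        assume "{e \<in> E'. deg' e \<le> c} \<subset> {e \<in> E'. deg' e \<le> d}"
        then show ?thesis unfolding eq by (rule psubset_card_mono[OF fin'])
      qed
    qed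
    \<comment> \<open>Only finitely many degrees strictly below \<open>d\<close> occur, and both
      families are counted over this common set.\<close>
    define C where "C = (deg ` {e \<in> E. deg e \<le> d} \<union> deg' ` {e \<in> E'. deg' e \<le> d}) - {d}"
    have C: "finite C" "\<And>c. c \<in> C \<Longrightarrow> c < d"
      unfolding C_def by (intro finite_Diff finite_UnI finite_imageI fin fin') (auto simp: less_le)
    have mem: "deg e \<in> C \<longleftrightarrow> deg e < d" if "e \<in> E" for e
      using that by (auto simp: C_def less_le)
    have mem': "deg' e \<in> C \<longleftrightarrow> deg' e < d" if "e \<in> E'" for e
      using that by (auto simp: C_def less_le)
    have "card {e \<in> E. deg e < d} = card (\<Union>c\<in>C. {e \<in> E. deg e = c})"
      by (rule arg_cong[where f = card]) (auto simp: mem)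
    also have "\<dots> = (\<Sum>c\<in>C. card {e \<in> E. deg e = c})"
      by (rule card_UN_disjoint[OF C(1)]) (auto intro: finite_subset[OF _ fin])
    also have "\<dots> = (\<Sum>c\<in>C. card {e \<in> E'. deg' e = c})"
      using less[OF smaller[OF C(2)]] by (intro sum.cong) auto
    also have "\<dots> = card (\<Union>c\<in>C. {e \<in> E'. deg' e = c})"
      by (rule card_UN_disjoint[OF C(1), symmetric]) (auto intro: finite_subset[OF _ fin'])
    also have "\<dots> = card {e \<in> E'. deg' e < d}"
      by (rule arg_cong[where f = card]) (auto simp: mem')
    finally have lt: "card {e \<in> E. deg e < d} = card {e \<in> E'. deg' e < d}" .
    have "card {e \<in> E. deg e \<le> d} = card ({e \<in> E. deg e < d} \<union> {e \<in> E. deg e = d})"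
      by (rule arg_cong[where f = card]) (auto simp: less_le)
    also have "\<dots> = card {e \<in> E. deg e < d} + card {e \<in> E. deg e = d}"
      by (rule card_Un_disjoint) (auto intro: finite_subset[OF _ fin[of d]])
    finally have 1: "card {e \<in> E. deg e \<le> d} = card {e \<in> E. deg e < d} + card {e \<in> E. deg e = d}" .
    have "card {e \<in> E'. deg' e \<le> d} = card ({e \<in> E'. deg' e < d} \<union> {e \<in> E'. deg' e = d})"
      by (rule arg_cong[where f = card]) (auto simp: less_le)
    also have "\<dots> = card {e \<in> E'. deg' e < d} + card {e \<in> E'. deg' e = d}"
      by (rule card_Un_disjoint) (auto intro: finite_subset[OF _ fin'[of d]])
    finally show ?thesis using 1 lt eq[of d] by simp
  qed
qed

text \<open>Copies of a value are numbered by enumerating its fibre, so a labelled family and its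
  multiplicity function can index the same direct sum.\<close>

lemma rep_bij:
  fixes \<phi> :: "'e \<Rightarrow> 'a"
  assumes "\<And>J. finite {e \<in> E. \<phi> e = J}"
  shows "\<exists>\<beta>. bij_betw \<beta> (rep (\<lambda>J. card {e \<in> E. \<phi> e = J})) E \<and>
    (\<forall>p\<in>rep (\<lambda>J. card {e \<in> E. \<phi> e = J}). \<phi> (\<beta> p) = fst p)"
proof -
  obtain h where h: "\<And>J. bij_betw (h J) {0..<card {e \<in> E. \<phi> e = J}} {e \<in> E. \<phi> e = J}"
    using ex_bij_betw_nat_finite[OF assms] by metis
  define \<beta> where "\<beta> = (\<lambda>p. h (fst p) (snd p))"
  have mem: "\<beta> p \<in> E \<and> \<phi> (\<beta> p) = fst p" if "p \<in> rep (\<lambda>J. card {e \<in> E. \<phi> e = J})" for p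
  proof -
    have "snd p \<in> {0..<card {e \<in> E. \<phi> e = fst p}}" using that by (auto simp: rep_def)
    then have "h (fst p) (snd p) \<in> {e \<in> E. \<phi> e = fst p}" using bij_betwE[OF h] by blast
    then show ?thesis by (simp add: \<beta>_def)
  qed
  have "inj_on \<beta> (rep (\<lambda>J. card {e \<in> E. \<phi> e = J}))"
  proof (rule inj_onI)
    fix p q assume p: "p \<in> rep (\<lambda>J. card {e \<in> E. \<phi> e = J})" and q: "q \<in> rep (\<lambda>J. card {e \<in> E. \<phi> e = J})"
      and eq: "\<beta> p = \<beta> q"
    have f: "fst p = fst q" using mem[OF p] mem[OF q] unfolding eq by simp
    moreover have "snd p = snd q"
    proof (rule inj_onD[OF bij_betw_imp_inj_on[OF h[of "fst p"]]])
      show "h (fst p) (snd p) = h (fst p) (snd q)" using eq f by (simp add: \<beta>_def)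
    qed (use p q f in \<open>auto simp: rep_def\<close>)
    ultimately show "p = q" by (rule prod_eqI)
  qed
  moreover have "e \<in> \<beta> ` rep (\<lambda>J. card {e \<in> E. \<phi> e = J})" if "e \<in> E" for e
  proof -
    have "e \<in> h (\<phi> e) ` {0..<card {e' \<in> E. \<phi> e' = \<phi> e}}"
      using bij_betw_imp_surj_on[OF h[of "\<phi> e"]] that by simp
    then obtain j where "j < card {e' \<in> E. \<phi> e' = \<phi> e}" "e = h (\<phi> e) j" by auto
    then show ?thesis by (intro image_eqI[of _ _ "(\<phi> e, j)"]) (auto simp: \<beta>_def rep_def)
  qed
  ultimately have "bij_betw \<beta> (rep (\<lambda>J. card {e \<in> E. \<phi> e = J})) E"
    using mem by (auto simp: bij_betw_def)
  then show ?thesis using mem by blast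
qed

lemma poset_interval_atLeast: "poset_interval {m..}"
  unfolding poset_interval_def
proof (intro conjI ballI allI impI)
  fix a b assume ab: "a \<in> {m..}" "b \<in> {m..}"
  let ?R = "{(x, y). x \<in> {m..} \<and> y \<in> {m..} \<and> (x \<le> y \<or> y \<le> x)}"
  have "(a, m) \<in> ?R" "(m, b) \<in> ?R" using ab by auto
  then show "(a, b) \<in> ?R\<^sup>*" by (meson r_into_rtrancl rtrancl_trans)
qed (auto intro: order_trans)

lemma card_rep: "card {p \<in> rep B. fst p = J} = B J"
proof -
  have "{p \<in> rep B. fst p = J} = Pair J ` {..<B J}" by (auto simp: rep_def)
  then show ?thesis by (simp add: card_image inj_on_def)
qed

text \<open>The definite description asks for two things. The generators themselves, grouped by
  quadrant, give a decomposition; for any other one, tameness makes its intervals quadrants, and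
  both generator counts up to \<open>a\<close> equal the dimension at \<open>a\<close>.\<close>

lemma barcode_free:
  fixes P :: "('i::lattice, 'k, 'v) pmod"
  assumes g: "free_coords K P E deg g" and pfd: "pfd K P"
  shows "barcode K P = (\<lambda>J. card {e \<in> E. {deg e..} = J})"
  unfolding barcode_def
proof (rule the_equality)
  have fin: "finite {e \<in> E. deg e \<le> a}" for a using coords_pfd_iff[OF g] pfd by simp
  have finJ: "finite {e \<in> E. {deg e..} = J}" for J
  proof (cases "{e \<in> E. {deg e..} = J} = {}")
    case False
    then obtain d where "J = {d..}" by auto
    then show ?thesis by (intro finite_subset[OF _ fin[of d]]) auto
  next
    case True then show ?thesis by (simp only: finite.emptyI)
  qed
  have split: "(\<lambda>(J, j). interval_mod K J) = (\<lambda>p. interval_mod K (fst p))" by auto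
  let ?B = "\<lambda>J. card {e \<in> E. {deg e..} = J}"
  show "interval_decomposition K P ?B"
    unfolding interval_decomposition_def split
  proof (intro conjI allI impI)
    fix J assume "0 < ?B J"
    then have "{e \<in> E. {deg e..} = J} \<noteq> {}" by (metis card.empty less_numeral_extra(3))
    then obtain d where "J = {d..}" by auto
    then show "poset_interval J" by (simp add: poset_interval_atLeast)
  next
    obtain \<beta> where \<beta>: "bij_betw \<beta> (rep ?B) E" "\<And>p. p \<in> rep ?B \<Longrightarrow> {deg (\<beta> p)..} = fst p"
      using rep_bij[where \<phi> = "\<lambda>e. {deg e..}" and E = E, OF finJ] by blast
    show "pmod_iso K P (dsum (rep ?B) (\<lambda>p. interval_mod K (fst p)))"
    proof (rule coords_imp_iso_dsum[OF coords_reindex[OF g \<beta>(1)]])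
      show "fst p = {deg (\<beta> p)..}" if "p \<in> rep ?B" for p using \<beta>(2)[OF that] by simp
      show "b \<in> fst p" if "p \<in> rep ?B" "a \<in> fst p" "c \<in> fst p" "a \<le> b" "b \<le> c" for p a b c
        using that \<beta>(2)[OF that(1), symmetric] order_trans by auto
    qed
  qed
  fix B assume "interval_decomposition K P B"
  then have int: "\<And>J. B J > 0 \<Longrightarrow> poset_interval J"
    and "pmod_iso K P (dsum (rep B) (\<lambda>p. interval_mod K (fst p)))"
    by (auto simp: interval_decomposition_def split)
  then obtain h where h: "coords K P (rep B) fst h" using iso_dsum_imp_coords by blast
  have "\<exists>m. fst p = {m..}" if "p \<in> rep B" for p
  proof (rule tame_coords_principal[OF free_coords_tame[OF g pfd] h that])
    show "fst p \<noteq> {}" using that int[of "fst p"] by (auto simp: rep_def poset_interval_def)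
  qed
  then obtain deg' where deg': "\<And>p. p \<in> rep B \<Longrightarrow> fst p = {deg' p..}" by metis
  have h': "free_coords K P (rep B) deg' h" by (rule coords_cong[OF h deg'])
  have fin': "finite {p \<in> rep B. deg' p \<le> a}" for a using coords_pfd_iff[OF h'] pfd by simp
  have "card {e \<in> E. deg e \<le> a} = card {p \<in> rep B. deg' p \<le> a}" for a
    using coords_dim[OF g, of a] coords_dim[OF h', of a] fin fin' by simp
  then have mult: "card {e \<in> E. deg e = d} = card {p \<in> rep B. deg' p = d}" for d
    by (rule multiplicity_unique[OF fin fin'])
  show "B = ?B"
  proof
    fix J
    show "B J = ?B J"
    proof (cases "\<exists>d. J = {d..}")
      case True
      then obtain d where J: "J = {d..}" by blast
      have "{p \<in> rep B. fst p = J} = {p \<in> rep B. deg' p = d}"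
      proof -
        have "fst p = J \<longleftrightarrow> deg' p = d" if "p \<in> rep B" for p using deg'[OF that] J by simp
        then show ?thesis by blast
      qed
      then have "B J = card {p \<in> rep B. deg' p = d}" using card_rep[of B J] by simp
      also have "\<dots> = card {e \<in> E. deg e = d}" using mult by simp
      finally show ?thesis by (simp add: J)
    next
      case False
      then have "{e \<in> E. {deg e..} = J} = {}" by auto
      moreover have "B J = 0"
        using deg'[of "(J, 0)"] False by (auto simp: rep_def)
      ultimately show ?thesis by (simp only: card.empty)
    qed
  qed
qed

section \<open>A freeness criterion for two-parameter modules\<close>

lemma fam_sum_reindex:
  assumes V: "vectorspace K V" and f: "inj_on f D"
    and c: "\<And>e. e \<in> D \<Longrightarrow> c (f e) \<in> carrier K" and u: "\<And>e. e \<in> D \<Longrightarrow> u (f e) \<in> carrier V"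
  shows "fam_sum V c u (f ` D) = fam_sum V (\<lambda>e. c (f e)) (\<lambda>e. u (f e)) D"
proof -
  interpret vectorspace K V by fact
  show ?thesis
    unfolding fam_sum_def by (rule M.finsum_reindex) (use f c u in auto)
qed

definition fam_span :: "('k, 'm) ring_scheme \<Rightarrow> ('k, 'v) module \<Rightarrow> ('e \<Rightarrow> 'v) \<Rightarrow> 'e set \<Rightarrow> 'v set" where
  "fam_span K V u D = {fam_sum V c u D | c. \<forall>e\<in>D. c e \<in> carrier K}"

lemma fam_span_submodule:
  assumes V: "vectorspace K V" and D: "finite D" and u: "\<And>e. e \<in> D \<Longrightarrow> u e \<in> carrier V"
  shows "submodule K (fam_span K V u D) V"
proof (rule vs_submoduleI[OF V])
  interpret vectorspace K V by fact
  show "fam_span K V u D \<subseteq> carrier V"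
    by (auto simp: fam_span_def intro!: fam_sum_closed[OF V _ u])
  have "fam_sum V (\<lambda>_. \<zero>\<^bsub>K\<^esub>) u D = \<zero>\<^bsub>V\<^esub>" using u by (intro fam_sum_zero[OF V]) auto
  then show "\<zero>\<^bsub>V\<^esub> \<in> fam_span K V u D"
    unfolding fam_span_def by (intro CollectI exI[of _ "\<lambda>_. \<zero>\<^bsub>K\<^esub>"]) auto
next
  interpret vectorspace K V by fact
  fix x y assume "x \<in> fam_span K V u D" "y \<in> fam_span K V u D"
  then obtain c c' where c: "\<forall>e\<in>D. c e \<in> carrier K" "x = fam_sum V c u D"
    and c': "\<forall>e\<in>D. c' e \<in> carrier K" "y = fam_sum V c' u D" by (auto simp: fam_span_def)
  have "x \<oplus>\<^bsub>V\<^esub> y = fam_sum V (\<lambda>e. c e \<oplus>\<^bsub>K\<^esub> c' e) u D"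
    unfolding c(2) c'(2) using c c' u by (intro fam_sum_add[OF V D, symmetric]) auto
  then show "x \<oplus>\<^bsub>V\<^esub> y \<in> fam_span K V u D"
    unfolding fam_span_def using c(1) c'(1) by (intro CollectI exI[of _ "\<lambda>e. c e \<oplus>\<^bsub>K\<^esub> c' e"]) auto
next
  interpret vectorspace K V by fact
  fix a x assume a: "a \<in> carrier K" and "x \<in> fam_span K V u D"
  then obtain c where c: "\<forall>e\<in>D. c e \<in> carrier K" "x = fam_sum V c u D" by (auto simp: fam_span_def)
  have "a \<odot>\<^bsub>V\<^esub> x = fam_sum V (\<lambda>e. a \<otimes>\<^bsub>K\<^esub> c e) u D"
    unfolding c(2) using c u a by (intro fam_sum_smult[OF V D, symmetric]) auto
  then show "a \<odot>\<^bsub>V\<^esub> x \<in> fam_span K V u D"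
    unfolding fam_span_def using c(1) a by (intro CollectI exI[of _ "\<lambda>e. a \<otimes>\<^bsub>K\<^esub> c e"]) auto
qed

lemma fam_span_superset:
  assumes V: "vectorspace K V" and D: "finite D" and u: "\<And>e. e \<in> D \<Longrightarrow> u e \<in> carrier V" and d: "d \<in> D"
  shows "u d \<in> fam_span K V u D"
proof -
  interpret vectorspace K V by fact
  let ?c = "\<lambda>e. if e = d then \<one>\<^bsub>K\<^esub> else \<zero>\<^bsub>K\<^esub>"
  have "fam_sum V ?c u D = fam_sum V ?c u {d}"
    using D u d by (intro fam_sum_superset[OF V]) auto
  also have "\<dots> = u d"
    using u[OF d] fam_sum_insert[OF V, of "{}" d ?c u] by (simp add: fam_sum_empty[OF V])
  finally show ?thesis
    unfolding fam_span_def by (intro CollectI exI[of _ ?c]) auto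
qed

text \<open>Lifts of a basis of the quotient of \<open>V\<close> by \<open>W\<close>, described
  without forming the quotient.\<close>

abbreviation complement_basis :: "('k, 'm) ring_scheme \<Rightarrow> ('k, 'v) module \<Rightarrow> 'v set \<Rightarrow> 'v set \<Rightarrow> bool" where
  "complement_basis K V W G \<equiv> finite G \<and> G \<subseteq> carrier V \<and>
    (\<forall>x\<in>carrier V. \<exists>w\<in>W. \<exists>y\<in>fam_span K V (\<lambda>v. v) G. x = w \<oplus>\<^bsub>V\<^esub> y) \<and>
    (\<forall>c. (\<forall>v\<in>G. c v \<in> carrier K) \<longrightarrow> fam_sum V c (\<lambda>v. v) G \<in> W \<longrightarrow> (\<forall>v\<in>G. c v = \<zero>\<^bsub>K\<^esub>))"

text \<open>A set independent modulo \<open>W\<close> is independent, so its size is bounded by the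
  dimension, and one of greatest size exists. A vector outside the sum of \<open>W\<close> and its
  span could be added to it.\<close>

lemma complement_exists:
  fixes V :: "('k, 'v) module"
  assumes V: "vectorspace K V" and fd: "vectorspace.fin_dim K V" and W: "submodule K W V"
  shows "\<exists>G. complement_basis K V W G"
proof -
  interpret vectorspace K V by fact
  define ind where "ind = (\<lambda>G. finite G \<and> G \<subseteq> carrier V \<and>
    (\<forall>c. (\<forall>v\<in>G. c v \<in> carrier K) \<longrightarrow> fam_sum V c (\<lambda>v. v) G \<in> W \<longrightarrow> (\<forall>v\<in>G. c v = \<zero>\<^bsub>K\<^esub>)))"
  have "card G < Suc dim" if "ind G" for G
  proof -
    have "card G \<le> dim"
    proof (rule independent_family_card_le_dim[OF V fd, of G "\<lambda>v. v"])
      show "finite G" "\<And>e. e \<in> G \<Longrightarrow> e \<in> carrier V" using that by (auto simp: ind_def)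
      show "c e = \<zero>\<^bsub>K\<^esub>" if "\<And>e. e \<in> G \<Longrightarrow> c e \<in> carrier K" "fam_sum V c (\<lambda>v. v) G = \<zero>\<^bsub>V\<^esub>" "e \<in> G" for c e
        using \<open>ind G\<close> that submodule.zero_closed[OF W] unfolding ind_def by auto
    qed
    then show ?thesis by simp
  qed
  moreover have "ind {}" by (simp add: ind_def)
  ultimately obtain G where G: "ind G" and max: "\<And>G'. ind G' \<Longrightarrow> card G' \<le> card G"
    using ex_has_greatest_nat[of ind "{}" card "Suc dim"] by blast
  have fG: "finite G" and GV: "\<And>v. v \<in> G \<Longrightarrow> v \<in> carrier V" using G by (auto simp: ind_def)
  have WV: "\<And>w. w \<in> W \<Longrightarrow> w \<in> carrier V" using submodule.subset[OF W] by blast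
  have span: "submodule K (fam_span K V (\<lambda>v. v) G) V"
    by (rule fam_span_submodule[OF V fG]) (rule GV)
  have "\<exists>w\<in>W. \<exists>y\<in>fam_span K V (\<lambda>v. v) G. x = w \<oplus>\<^bsub>V\<^esub> y" if x: "x \<in> carrier V" for x
  proof (rule ccontr)
    assume no: "\<not> (\<exists>w\<in>W. \<exists>y\<in>fam_span K V (\<lambda>v. v) G. x = w \<oplus>\<^bsub>V\<^esub> y)"
    have "x \<notin> G"
    proof
      assume "x \<in> G"
      have "x \<in> fam_span K V (\<lambda>v. v) G"
        by (rule fam_span_superset[where u = "\<lambda>v. v", OF V fG]) (use GV \<open>x \<in> G\<close> in auto)
      moreover have "x = \<zero>\<^bsub>V\<^esub> \<oplus>\<^bsub>V\<^esub> x" using x by simp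
      ultimately show False using no submodule.zero_closed[OF W] by blast
    qed
    have "ind (insert x G)"
      unfolding ind_def
    proof (intro conjI allI impI)
      show "finite (insert x G)" "insert x G \<subseteq> carrier V" using fG GV x by auto
      fix c assume c: "\<forall>v\<in>insert x G. c v \<in> carrier K" and sum: "fam_sum V c (\<lambda>v. v) (insert x G) \<in> W"
      define s where "s = fam_sum V c (\<lambda>v. v) G"
      have s: "s \<in> carrier V" unfolding s_def using c GV by (intro fam_sum_closed[OF V]) auto
      have eq: "fam_sum V c (\<lambda>v. v) (insert x G) = c x \<odot>\<^bsub>V\<^esub> x \<oplus>\<^bsub>V\<^esub> s"
        unfolding s_def using c GV x fG \<open>x \<notin> G\<close> by (intro fam_sum_insert[OF V]) auto
      have cx: "c x \<in> carrier K" using c by simp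
      \<comment> \<open>With a nonzero coefficient at \<open>x\<close> the relation could be solved
        for \<open>x\<close>, which would put \<open>x\<close> into the sum of \<open>W\<close> and
        the span.\<close>
      have "c x = \<zero>\<^bsub>K\<^esub>"
      proof (rule ccontr)
        assume "c x \<noteq> \<zero>\<^bsub>K\<^esub>"
        then have inv: "inv\<^bsub>K\<^esub> c x \<in> carrier K" "inv\<^bsub>K\<^esub> c x \<otimes>\<^bsub>K\<^esub> c x = \<one>\<^bsub>K\<^esub>"
          using cx field_Units by auto
        define w where "w = inv\<^bsub>K\<^esub> c x \<odot>\<^bsub>V\<^esub> (c x \<odot>\<^bsub>V\<^esub> x \<oplus>\<^bsub>V\<^esub> s)"
        have wW: "w \<in> W" unfolding w_def using sum inv(1) unfolding eq by (intro submodule.smult_closed[OF W])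
        have "w = x \<oplus>\<^bsub>V\<^esub> inv\<^bsub>K\<^esub> c x \<odot>\<^bsub>V\<^esub> s"
          unfolding w_def using x s cx inv
          by (simp add: smult_r_distr smult_assoc1[symmetric])
        then have "x = w \<oplus>\<^bsub>V\<^esub> \<ominus>\<^bsub>V\<^esub> (inv\<^bsub>K\<^esub> c x \<odot>\<^bsub>V\<^esub> s)"
          using x s inv(1) by (simp add: M.a_assoc M.r_neg)
        moreover have "\<ominus>\<^bsub>V\<^esub> (inv\<^bsub>K\<^esub> c x \<odot>\<^bsub>V\<^esub> s) = (\<ominus>\<^bsub>K\<^esub> (inv\<^bsub>K\<^esub> c x)) \<odot>\<^bsub>V\<^esub> s"
          using inv(1) s by (simp add: smult_l_minus)
        moreover have "s \<in> fam_span K V (\<lambda>v. v) G" unfolding fam_span_def s_def using c by blast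
        then have "(\<ominus>\<^bsub>K\<^esub> (inv\<^bsub>K\<^esub> c x)) \<odot>\<^bsub>V\<^esub> s \<in> fam_span K V (\<lambda>v. v) G"
          using inv(1) by (intro submodule.smult_closed[OF span]) auto
        ultimately show False using no wW by metis
      qed
      moreover have "fam_sum V c (\<lambda>v. v) G \<in> W"
        using sum s x unfolding eq \<open>c x = \<zero>\<^bsub>K\<^esub>\<close> s_def[symmetric] by simp
      then have "\<forall>v\<in>G. c v = \<zero>\<^bsub>K\<^esub>" using G c unfolding ind_def by blast
      ultimately show "\<forall>v\<in>insert x G. c v = \<zero>\<^bsub>K\<^esub>" by simp
    qed
    then show False using max[of "insert x G"] fG \<open>x \<notin> G\<close> by simp
  qed
  then show ?thesis using G unfolding ind_def by blast
qed

section \<open>Elements coming from the left or from below\<close>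

text \<open>Two uses share this definition. With \<open>h\<close> equal to \<open>b $ k\<close> it
  collects what enters degree \<open>b\<close> from one side, which decides about generators at
  \<open>b\<close>; with \<open>k\<close> the direction across a line and \<open>h\<close> the
  position of the line it is the submodule divided out on that line.\<close>

definition side :: "(real^2, 'k, 'v) pmod \<Rightarrow> 2 \<Rightarrow> real \<Rightarrow> real^2 \<Rightarrow> 'v set" where
  "side Q k h b = {Tr Q c b u | c u. c \<le> b \<and> c $ k < h \<and> u \<in> carrier (Sp Q c)}"

lemma sideI: "c \<le> b \<Longrightarrow> c $ k < h \<Longrightarrow> u \<in> carrier (Sp Q c) \<Longrightarrow> Tr Q c b u \<in> side Q k h b"
  by (auto simp: side_def)

lemma sideE:
  assumes "x \<in> side Q k h b"
  obtains c u where "c \<le> b" "c $ k < h" "u \<in> carrier (Sp Q c)" "x = Tr Q c b u"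
  using assms by (auto simp: side_def)

text \<open>Summands from different sources are first moved to the supremum of these sources, which
  still lies below \<open>b\<close> and still has \<open>k\<close>-th coordinate less than
  \<open>h\<close>.\<close>

lemma side_submodule:
  assumes Q: "pmodule K Q"
  shows "submodule K (side Q k h b) (Sp Q b)"
proof (rule vs_submoduleI[OF pmodule.space[OF Q]])
  show "side Q k h b \<subseteq> carrier (Sp Q b)"
    using pmodule_Tr_closed[OF Q] by (auto elim!: sideE)
next
  \<comment> \<open>Some degree must supply zero: this one lowers the \<open>k\<close>-th coordinate
    of \<open>b\<close> below \<open>h\<close> if necessary.\<close>
  let ?c = "\<chi> j. if j = k then min (b $ k) (h - 1) else b $ j"
  interpret vectorspace K "Sp Q ?c" by (rule pmodule.space[OF Q])
  have c: "?c \<le> b" "?c $ k < h" by (auto simp: less_eq_vec_def)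
  then have "Tr Q ?c b \<zero>\<^bsub>Sp Q ?c\<^esub> \<in> side Q k h b" by (rule sideI) (rule M.zero_closed)
  then show "\<zero>\<^bsub>Sp Q b\<^esub> \<in> side Q k h b" unfolding pmodule_Tr_zero[OF Q c(1)] .
next
  fix x y assume "x \<in> side Q k h b" "y \<in> side Q k h b"
  then obtain c d u v where c: "c \<le> b" "c $ k < h" "u \<in> carrier (Sp Q c)" "x = Tr Q c b u"
    and d: "d \<le> b" "d $ k < h" "v \<in> carrier (Sp Q d)" "y = Tr Q d b v"
    by (elim sideE)
  let ?s = "sup c d"
  interpret vectorspace K "Sp Q ?s" by (rule pmodule.space[OF Q])
  have s: "?s \<le> b" "?s $ k < h" using c d by (simp, simp add: sup_vec_def sup_max)
  have m: "Tr Q c ?s u \<in> carrier (Sp Q ?s)" "Tr Q d ?s v \<in> carrier (Sp Q ?s)"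
    using c(3) d(3) by (auto intro: pmodule_Tr_closed[OF Q])
  have "x \<oplus>\<^bsub>Sp Q b\<^esub> y = Tr Q ?s b (Tr Q c ?s u \<oplus>\<^bsub>Sp Q ?s\<^esub> Tr Q d ?s v)"
    unfolding pmodule_Tr_add[OF Q s(1) m] c(4) d(4)
    using pmodule.transition_comp[OF Q _ s(1) c(3)] pmodule.transition_comp[OF Q _ s(1) d(3)] by simp
  also have "\<dots> \<in> side Q k h b" using m by (intro sideI[OF s]) auto
  finally show "x \<oplus>\<^bsub>Sp Q b\<^esub> y \<in> side Q k h b" .
next
  fix a x assume a: "a \<in> carrier K" and "x \<in> side Q k h b"
  then obtain c u where c: "c \<le> b" "c $ k < h" "u \<in> carrier (Sp Q c)" "x = Tr Q c b u"
    by (elim sideE)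
  interpret vectorspace K "Sp Q c" by (rule pmodule.space[OF Q])
  have "a \<odot>\<^bsub>Sp Q b\<^esub> x = Tr Q c b (a \<odot>\<^bsub>Sp Q c\<^esub> u)"
    unfolding pmodule_Tr_smult[OF Q c(1) a c(3)] c(4) ..
  also have "\<dots> \<in> side Q k h b" using a c(3) by (intro sideI[OF c(1,2)]) auto
  finally show "a \<odot>\<^bsub>Sp Q b\<^esub> x \<in> side Q k h b" .
qed

text \<open>The degree \<open>d\<close> part of the graded radical. Two summands suffice because a
  degree strictly below \<open>d\<close> is smaller in one of the two coordinates.\<close>

definition corner :: "(real^2, 'k, 'v) pmod \<Rightarrow> real^2 \<Rightarrow> 'v set" where
  "corner P d = {x \<oplus>\<^bsub>Sp P d\<^esub> y | x y. x \<in> side P 1 (d $ 1) d \<and> y \<in> side P 2 (d $ 2) d}"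

lemma cornerI: "x \<in> side P 1 (d $ 1) d \<Longrightarrow> y \<in> side P 2 (d $ 2) d \<Longrightarrow> x \<oplus>\<^bsub>Sp P d\<^esub> y \<in> corner P d"
  by (auto simp: corner_def)

lemma corner_submodule:
  assumes P: "pmodule K P"
  shows "submodule K (corner P d) (Sp P d)"
proof -
  interpret vectorspace K "Sp P d" by (rule pmodule.space[OF P])
  note s1 = side_submodule[OF P, of 1 "d $ 1" d] and s2 = side_submodule[OF P, of 2 "d $ 2" d]
  have c1: "\<And>x. x \<in> side P 1 (d $ 1) d \<Longrightarrow> x \<in> carrier (Sp P d)" using submodule.subset[OF s1] by blast
  have c2: "\<And>x. x \<in> side P 2 (d $ 2) d \<Longrightarrow> x \<in> carrier (Sp P d)" using submodule.subset[OF s2] by blast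
  show ?thesis
  proof (rule vs_submoduleI[OF pmodule.space[OF P]])
    show "corner P d \<subseteq> carrier (Sp P d)" using c1 c2 by (auto simp: corner_def)
    have "\<zero>\<^bsub>Sp P d\<^esub> \<oplus>\<^bsub>Sp P d\<^esub> \<zero>\<^bsub>Sp P d\<^esub> \<in> corner P d"
      by (rule cornerI[OF submodule.zero_closed[OF s1] submodule.zero_closed[OF s2]])
    then show "\<zero>\<^bsub>Sp P d\<^esub> \<in> corner P d" by simp
  next
    fix x y assume "x \<in> corner P d" "y \<in> corner P d"
    then obtain x1 x2 y1 y2 where x: "x1 \<in> side P 1 (d $ 1) d" "x2 \<in> side P 2 (d $ 2) d" "x = x1 \<oplus>\<^bsub>Sp P d\<^esub> x2"
      and y: "y1 \<in> side P 1 (d $ 1) d" "y2 \<in> side P 2 (d $ 2) d" "y = y1 \<oplus>\<^bsub>Sp P d\<^esub> y2"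
      by (auto simp: corner_def)
    have "x \<oplus>\<^bsub>Sp P d\<^esub> y = (x1 \<oplus>\<^bsub>Sp P d\<^esub> y1) \<oplus>\<^bsub>Sp P d\<^esub> (x2 \<oplus>\<^bsub>Sp P d\<^esub> y2)"
      using x y c1 c2 by (simp add: M.a_ac)
    also have "\<dots> \<in> corner P d"
      using x y by (intro cornerI submodule.m_closed[OF s1] submodule.m_closed[OF s2])
    finally show "x \<oplus>\<^bsub>Sp P d\<^esub> y \<in> corner P d" .
  next
    fix a x assume a: "a \<in> carrier K" and "x \<in> corner P d"
    then obtain x1 x2 where x: "x1 \<in> side P 1 (d $ 1) d" "x2 \<in> side P 2 (d $ 2) d" "x = x1 \<oplus>\<^bsub>Sp P d\<^esub> x2"
      by (auto simp: corner_def)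
    have "a \<odot>\<^bsub>Sp P d\<^esub> x = a \<odot>\<^bsub>Sp P d\<^esub> x1 \<oplus>\<^bsub>Sp P d\<^esub> a \<odot>\<^bsub>Sp P d\<^esub> x2"
      using x a c1 c2 by (simp add: smult_r_distr)
    also have "\<dots> \<in> corner P d"
      using x a by (intro cornerI submodule.smult_closed[OF s1] submodule.smult_closed[OF s2])
    finally show "a \<odot>\<^bsub>Sp P d\<^esub> x \<in> corner P d" .
  qed
qed

lemma side_subset_corner:
  assumes P: "pmodule K P"
  shows "side P k (d $ k) d \<subseteq> corner P d"
proof
  interpret vectorspace K "Sp P d" by (rule pmodule.space[OF P])
  fix x assume x: "x \<in> side P k (d $ k) d"
  then have xc: "x \<in> carrier (Sp P d)" using submodule.subset[OF side_submodule[OF P]] by blast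
  show "x \<in> corner P d"
  proof (cases "k = 1")
    case True
    then have "x \<oplus>\<^bsub>Sp P d\<^esub> \<zero>\<^bsub>Sp P d\<^esub> \<in> corner P d"
      using x by (intro cornerI submodule.zero_closed[OF side_submodule[OF P]]) auto
    then show ?thesis using xc by simp
  next
    case False
    then have "k = 2" using exhaust_2 by blast
    then have "\<zero>\<^bsub>Sp P d\<^esub> \<oplus>\<^bsub>Sp P d\<^esub> x \<in> corner P d"
      using x by (intro cornerI submodule.zero_closed[OF side_submodule[OF P]]) auto
    then show ?thesis using xc by simp
  qed
qed

lemma image_subset_corner:
  assumes P: "pmodule K P" and c: "c \<le> d" "c \<noteq> d"
  shows "Tr P c d ` carrier (Sp P c) \<subseteq> corner P d"
proof -
  obtain k where "c $ k \<noteq> d $ k" using c(2) by (auto simp: vec_eq_iff)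
  then have "c $ k < d $ k" using c(1) by (auto simp: less_eq_vec_def order_less_le)
  then have "Tr P c d ` carrier (Sp P c) \<subseteq> side P k (d $ k) d" using c(1) by (auto intro: sideI)
  then show ?thesis using side_subset_corner[OF P] by blast
qed

text \<open>A graded form of Nakayama's lemma supplies the spanning part, and the meet condition the
  independence. The labels are pairs of a degree and a vector in that degree, which have the index
  type that \<open>free_mod\<close> prescribes.\<close>

lemma tame_free:
  fixes P :: "(real^2, 'k, 'v) pmod"
  assumes P: "pmodule K P" and pfd: "pfd K P" and tame: "tame P"
  shows "\<exists>(E :: ((real^2) \<times> 'v) set) g. free_coords K P E fst g"
proof -
  note K = pmodule_field[OF P] and V = pmodule.space[OF P] and cl = pmodule_Tr_closed[OF P]
  interpret field K by fact
  have zero: "\<zero>\<^bsub>Sp P a\<^esub> \<in> carrier (Sp P a)" for a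
  proof -
    interpret vectorspace K "Sp P a" by (rule V)
    show ?thesis by simp
  qed
  have "\<forall>d. \<exists>G. complement_basis K (Sp P d) (corner P d) G"
    using pfd by (intro allI complement_exists[OF V _ corner_submodule[OF P]]) (simp add: pfd_def)
  from choice[OF this] obtain G where Gprop: "\<forall>d. complement_basis K (Sp P d) (corner P d) (G d)" ..
  have G: "\<And>d. finite (G d)" "\<And>d. G d \<subseteq> carrier (Sp P d)"
    and span: "\<And>d. \<forall>x\<in>carrier (Sp P d). \<exists>w\<in>corner P d. \<exists>y\<in>fam_span K (Sp P d) (\<lambda>v. v) (G d).
      x = w \<oplus>\<^bsub>Sp P d\<^esub> y"
    using Gprop by auto
  have ind: "c v = \<zero>\<^bsub>K\<^esub>" if "\<And>v. v \<in> G d \<Longrightarrow> c v \<in> carrier K"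
      "fam_sum (Sp P d) c (\<lambda>v. v) (G d) \<in> corner P d" "v \<in> G d" for d c v
    using that conjunct2[OF conjunct2[OF conjunct2[OF spec[OF Gprop, of d]]]] by simp
  define E where "E = Sigma UNIV G"
  define Ea where "Ea = (\<lambda>a. {e \<in> E. fst e \<le> a})"
  define U where "U = (\<lambda>a e. Tr P (fst e) a (snd e))"
  have Ua: "U a e \<in> carrier (Sp P a)" if "e \<in> Ea a" for a e
    using that G(2)[of "fst e"] unfolding U_def by (intro cl) (auto simp: Ea_def E_def)
  have Ub: "Tr P a b (U a e) = U b e" if "a \<le> b" "e \<in> Ea a" for a b e
    using that G(2)[of "fst e"] unfolding U_def
    by (intro pmodule.transition_comp[OF P]) (auto simp: Ea_def E_def)
  have Ea_mono: "e \<in> Ea b" if "a \<le> b" "e \<in> Ea a" for a b e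
    using that order_trans by (auto simp: Ea_def)
  have not_corner: "v \<notin> corner P d" if "v \<in> G d" for d v
  proof
    assume v: "v \<in> corner P d"
    let ?c = "\<lambda>v'. if v' = v then \<one>\<^bsub>K\<^esub> else \<zero>\<^bsub>K\<^esub>"
    interpret vectorspace K "Sp P d" by (rule V)
    have vV: "v \<in> carrier (Sp P d)" using that G(2) by blast
    have "fam_sum (Sp P d) ?c (\<lambda>v. v) (G d) = fam_sum (Sp P d) ?c (\<lambda>v. v) {v}"
      using that G by (intro fam_sum_superset[OF V]) auto
    also have "\<dots> = v"
      using vV fam_sum_insert[OF V, of "{}" v ?c "\<lambda>v. v" d] by (simp add: fam_sum_empty[OF V])
    finally have "fam_sum (Sp P d) ?c (\<lambda>v. v) (G d) \<in> corner P d" using v by simp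
    then have "?c v = \<zero>\<^bsub>K\<^esub>" by (rule ind[rotated]) (use that in auto)
    then show False by simp
  qed
  \<comment> \<open>At a degree outside \<open>F\<close> a nonzero space comes from a strictly
    smaller critical degree and so lies in the corner, which leaves no room for a generator.
    Finiteness of \<open>Ea a\<close> follows.\<close>
  have crit: "d \<in> F" if F: "critical_set P a F" and d: "d \<le> a" "v \<in> G d" for F a d v
  proof (rule ccontr)
    assume "d \<notin> F"
    have vV: "v \<in> carrier (Sp P d)" using d G(2) by blast
    have "v \<noteq> \<zero>\<^bsub>Sp P d\<^esub>"
      using not_corner[OF d(2)] submodule.zero_closed[OF corner_submodule[OF P]] by metis
    then obtain d' where d': "d' \<in> F" "d' \<le> d" "carrier (Sp P d) \<subseteq> Tr P d' d ` carrier (Sp P d')"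
      using F d(1) vV by blast
    then have "v \<in> corner P d"
      using image_subset_corner[OF P d'(2)] vV \<open>d \<notin> F\<close> by blast
    then show False using not_corner[OF d(2)] by simp
  qed
  have finE: "finite (Ea a)" for a
  proof -
    obtain F where F: "critical_set P a F" using tame_critical[OF tame] by blast
    have "Ea a \<subseteq> Sigma F G" using crit[OF F] by (auto simp: Ea_def E_def)
    moreover have "finite (Sigma F G)" using F G(1) by (intro finite_SigmaI) auto
    ultimately show ?thesis by (rule finite_subset)
  qed
  define T where "T = (\<lambda>a. fam_span K (Sp P a) (U a) (Ea a))"
  have subT: "submodule K (T a) (Sp P a)" for a
    unfolding T_def by (rule fam_span_submodule[OF V finE Ua])
  have UT: "U a e \<in> T a" if "e \<in> Ea a" for a e
    unfolding T_def by (rule fam_span_superset[OF V finE Ua that])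
  have TT: "Tr P b a x \<in> T a" if ba: "b \<le> a" and xT: "x \<in> T b" for a b x
  proof -
    obtain c where c: "\<forall>e\<in>Ea b. c e \<in> carrier K" "x = fam_sum (Sp P b) c (U b) (Ea b)"
      using xT by (auto simp: T_def fam_span_def)
    have "Tr P b a x = fam_sum (Sp P a) c (\<lambda>e. Tr P b a (U b e)) (Ea b)"
      unfolding c(2) using c(1) Ua
      by (intro fam_sum_linear[OF V pmodule.transition[OF P ba] finE]) auto
    also have "\<dots> \<in> T a"
      using c(1) UT Ea_mono[OF ba] Ub[OF ba]
      by (intro fam_sum_in_submodule[OF V subT finE]) auto
    finally show ?thesis .
  qed
  have spanning: "carrier (Sp P a) \<subseteq> T a" for a
  proof -
    obtain F where F: "critical_set P a F" using tame_critical[OF tame] by blast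
    have "carrier (Sp P b) \<subseteq> T b" if "b \<le> a" for b
      using that
    \<comment> \<open>The induction counts critical degrees below \<open>b\<close>. After passing to
      the critical degree \<open>d\<close>, the sources that feed the corner at \<open>d\<close> no
      longer have \<open>d\<close> below them, so their count is smaller.\<close>
    proof (induction "card {f \<in> F. f \<le> b}" arbitrary: b rule: less_induct)
      case less
      show ?case
      proof (cases "carrier (Sp P b) = {\<zero>\<^bsub>Sp P b\<^esub>}")
        case True
        then show ?thesis using submodule.zero_closed[OF subT] by simp
      next
        case False
        then obtain d where d: "d \<in> F" "d \<le> b" "carrier (Sp P b) \<subseteq> Tr P d b ` carrier (Sp P d)"
          using F less.prems by blast
        have IH: "carrier (Sp P c) \<subseteq> T c" if c: "c \<le> d" "c $ k < d $ k" for c k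
        proof (rule less.hyps)
          have "\<not> d \<le> c" using c(2) by (auto simp: less_eq_vec_def not_le)
          then have "{f \<in> F. f \<le> c} \<subset> {f \<in> F. f \<le> b}"
            using c(1) d(1,2) order_trans by blast
          then show "card {f \<in> F. f \<le> c} < card {f \<in> F. f \<le> b}"
            using F by (intro psubset_card_mono) auto
          show "c \<le> a" using c(1) d(2) less.prems by (meson order_trans)
        qed
        have sideT: "x \<in> T d" if "x \<in> side P k (d $ k) d" for x k
          using that IH TT by (elim sideE) blast
        have "x \<in> T d" if x: "x \<in> carrier (Sp P d)" for x
        proof -
          obtain w y where w: "w \<in> corner P d" and y: "y \<in> fam_span K (Sp P d) (\<lambda>v. v) (G d)"
            and eq: "x = w \<oplus>\<^bsub>Sp P d\<^esub> y"
            using bspec[OF span x] by blast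
          have "w \<in> T d"
            using w sideT by (auto simp: corner_def intro!: submodule.m_closed[OF subT])
          moreover have "v \<in> T d" if "v \<in> G d" for v
          proof -
            have "v \<in> carrier (Sp P d)" using that G(2) by blast
            then have "U d (d, v) = v" by (simp add: U_def pmodule.transition_id[OF P])
            then show ?thesis using UT[of "(d, v)" d] that by (simp add: Ea_def E_def)
          qed
          then have "y \<in> T d"
            using y G(1) by (auto simp: fam_span_def intro!: fam_sum_in_submodule[OF V subT])
          ultimately show ?thesis unfolding eq by (rule submodule.m_closed[OF subT])
        qed
        then show ?thesis using d(3) TT[OF d(2)] by blast
      qed
    qed
    then show ?thesis by simp
  qed
  have independent: "c e = \<zero>\<^bsub>K\<^esub>"
    if c: "\<And>e. e \<in> Ea a \<Longrightarrow> c e \<in> carrier K" and sum: "fam_sum (Sp P a) c (U a) (Ea a) = \<zero>\<^bsub>Sp P a\<^esub>"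
      and e: "e \<in> Ea a" for c a e
  proof (rule ccontr)
    assume ce: "c e \<noteq> \<zero>\<^bsub>K\<^esub>"
    interpret Va: vectorspace K "Sp P a" by (rule V)
    define D where "D = {e \<in> Ea a. c e \<noteq> \<zero>\<^bsub>K\<^esub>}"
    have "e \<in> D" using e ce by (simp add: D_def)
    then have Dne: "D \<noteq> {}" by blast
    have Dfin: "finite D" using finE[of a] by (simp add: D_def)
    \<comment> \<open>Height is maximised before the first coordinate; in this order the remaining
      generators at the same height have degrees below the chosen \<open>d\<close>.\<close>
    define y where "y = Max ((\<lambda>e. fst e $ 2) ` D)"
    have y: "y \<in> (\<lambda>e. fst e $ 2) ` D" "\<And>e. e \<in> D \<Longrightarrow> fst e $ 2 \<le> y"
      unfolding y_def using Max_in[of "(\<lambda>e. fst e $ 2) ` D"] Dfin Dne by simp_all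
    define Dy where "Dy = {e \<in> D. fst e $ 2 = y}"
    have Dy_fin: "finite Dy" using Dfin by (simp add: Dy_def)
    have Dy_ne: "Dy \<noteq> {}" using y(1) by (auto simp: Dy_def)
    define x where "x = Max ((\<lambda>e. fst e $ 1) ` Dy)"
    have x: "x \<in> (\<lambda>e. fst e $ 1) ` Dy" "\<And>e. e \<in> Dy \<Longrightarrow> fst e $ 1 \<le> x"
      unfolding x_def using Max_in[of "(\<lambda>e. fst e $ 1) ` Dy"] Dy_fin Dy_ne by simp_all
    then obtain e0 where e0: "e0 \<in> D" "fst e0 $ 1 = x" "fst e0 $ 2 = y" by (auto simp: Dy_def)
    define d where "d = fst e0"
    have da: "d \<le> a" and d12: "d $ 1 = x" "d $ 2 = y" using e0 by (auto simp: d_def D_def Ea_def)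
    have eqd: "b = d" if "b $ 1 = x" "b $ 2 = y" for b
      using that d12 by (simp add: vec_eq_iff forall_2)
    define D0 where "D0 = {e \<in> E. fst e = d}"
    define D1 where "D1 = {e \<in> D. fst e $ 2 = y \<and> fst e $ 1 < x}"
    define D2 where "D2 = {e \<in> D. fst e $ 2 < y}"
    have sub: "D0 \<subseteq> Ea a" "D1 \<subseteq> Ea a" "D2 \<subseteq> Ea a"
      using da by (auto simp: D0_def D1_def D2_def D_def Ea_def)
    have fin: "finite D0" "finite D1" "finite D2" using sub finE finite_subset by blast+
    have cover: "D \<subseteq> D0 \<union> D1 \<union> D2"
    proof
      fix e assume eD: "e \<in> D"
      then have eE: "e \<in> E" by (simp add: D_def Ea_def)
      consider "fst e $ 2 < y" | "fst e $ 2 = y" using y(2)[OF eD] by linarith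
      then show "e \<in> D0 \<union> D1 \<union> D2"
      proof cases
        case 2
        then have "fst e $ 1 \<le> x" using x(2) eD by (simp add: Dy_def)
        then show ?thesis using 2 eD eE eqd[of "fst e"] by (fastforce simp: D0_def D1_def)
      qed (use eD in \<open>simp add: D2_def\<close>)
    qed
    have disj: "D0 \<inter> D1 = {}" "(D0 \<union> D1) \<inter> D2 = {}" using d12 by (auto simp: D0_def D1_def D2_def)
    \<comment> \<open>The value \<open>x - 1\<close> is a default for the case that
      \<open>D1\<close> is empty; the bound stays strictly below \<open>x\<close> either way. The
      same device is used for \<open>y1\<close>.\<close>
    define x1 where "x1 = Max (insert (x - 1) ((\<lambda>e. fst e $ 1) ` D1))"
    have x1: "x1 < x" "\<And>e. e \<in> D1 \<Longrightarrow> fst e $ 1 \<le> x1"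
      unfolding x1_def using fin(2) by (auto simp: D1_def)
    define y1 where "y1 = Max (insert (y - 1) ((\<lambda>e. fst e $ 2) ` D2))"
    have y1: "y1 < y" "\<And>e. e \<in> D2 \<Longrightarrow> fst e $ 2 \<le> y1"
      unfolding y1_def using fin(3) by (auto simp: D2_def)
    \<comment> \<open>The part at the height of \<open>d\<close> is defined at \<open>p1\<close>,
      which lies below \<open>d\<close>. The lower part may extend to the right of \<open>d\<close>,
      hence the first coordinate \<open>a $ 1\<close> of \<open>p2\<close>; it is this part that
      needs a meet.\<close>
    define p1 :: "real^2" where "p1 = (\<chi> k. if k = 1 then x1 else y)"
    define p2 :: "real^2" where "p2 = (\<chi> k. if k = 1 then a $ 1 else y1)"
    have p: "p1 $ 1 = x1" "p1 $ 2 = y" "p2 $ 1 = a $ 1" "p2 $ 2 = y1" by (simp_all add: p1_def p2_def)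
    have le: "b \<le> b' \<longleftrightarrow> b $ 1 \<le> b' $ 1 \<and> b $ 2 \<le> b' $ 2" for b b' :: "real^2"
      by (simp add: less_eq_vec_def forall_2)
    have pd: "p1 \<le> d" "p2 \<le> a" using x1(1) y1(1) d12 da by (auto simp: le p)
    have sub': "D0 \<subseteq> Ea d" "D1 \<subseteq> Ea p1" "D2 \<subseteq> Ea p2"
      using x1(2) y1(2) sub(3) by (auto simp: D0_def D1_def D2_def D_def Ea_def le p)
    have cD: "c e \<in> carrier K" if "e \<in> D0 \<union> D1 \<union> D2" for e using c sub that by blast
    have UD: "U a e \<in> carrier (Sp P a)" if "e \<in> D0 \<union> D1 \<union> D2" for e using Ua sub that by blast
    define w where "w = fam_sum (Sp P d) c (U d) D0"
    define u where "u = fam_sum (Sp P p1) c (U p1) D1"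
    define v where "v = fam_sum (Sp P p2) c (U p2) D2"
    have w: "w \<in> carrier (Sp P d)"
      unfolding w_def using cD sub' Ua by (intro fam_sum_closed[OF V]) blast+
    have u: "u \<in> carrier (Sp P p1)"
      unfolding u_def using cD sub' Ua by (intro fam_sum_closed[OF V]) blast+
    have v: "v \<in> carrier (Sp P p2)"
      unfolding v_def using cD sub' Ua by (intro fam_sum_closed[OF V]) blast+
    have push: "Tr P b a (fam_sum (Sp P b) c (U b) C) = fam_sum (Sp P a) c (U a) C"
      if "b \<le> a" "finite C" "C \<subseteq> Ea b" "C \<subseteq> D0 \<union> D1 \<union> D2" for b C
    proof -
      have "Tr P b a (fam_sum (Sp P b) c (U b) C) = fam_sum (Sp P a) c (\<lambda>e. Tr P b a (U b e)) C"
        using that cD Ua by (intro fam_sum_linear[OF V pmodule.transition[OF P that(1)] that(2)]) blast+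
      also have "\<dots> = fam_sum (Sp P a) c (U a) C"
        using that cD Ub[OF that(1)] UD by (intro fam_sum_cong[OF V]) (auto simp: subset_iff)
      finally show ?thesis .
    qed
    have "\<zero>\<^bsub>Sp P a\<^esub> = fam_sum (Sp P a) c (U a) (D0 \<union> D1 \<union> D2)"
      unfolding sum[symmetric]
    proof (rule fam_sum_superset[OF V finE])
      show "D0 \<union> D1 \<union> D2 \<subseteq> Ea a" using sub by blast
      show "c e = \<zero>\<^bsub>K\<^esub>" if "e \<in> Ea a - (D0 \<union> D1 \<union> D2)" for e
        using that cover by (auto simp: D_def)
    qed (use cD Ua in auto)
    also have "\<dots> = fam_sum (Sp P a) c (U a) (D0 \<union> D1) \<oplus>\<^bsub>Sp P a\<^esub> fam_sum (Sp P a) c (U a) D2"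
      using cD UD fin disj by (intro fam_sum_Un[OF V]) auto
    also have "fam_sum (Sp P a) c (U a) (D0 \<union> D1) = fam_sum (Sp P a) c (U a) D0 \<oplus>\<^bsub>Sp P a\<^esub> fam_sum (Sp P a) c (U a) D1"
      using cD UD fin disj by (intro fam_sum_Un[OF V]) auto
    also have "fam_sum (Sp P a) c (U a) D0 = Tr P d a w"
      unfolding w_def by (rule push[OF da fin(1) sub'(1), symmetric]) auto
    also have "fam_sum (Sp P a) c (U a) D1 = Tr P p1 a u"
      unfolding u_def by (rule push[OF _ fin(2) sub'(2), symmetric]) (use pd da order_trans in auto)
    also have "fam_sum (Sp P a) c (U a) D2 = Tr P p2 a v"
      unfolding v_def by (rule push[OF pd(2) fin(3) sub'(3), symmetric]) auto
    finally have rel: "Tr P d a w \<oplus>\<^bsub>Sp P a\<^esub> Tr P p1 a u \<oplus>\<^bsub>Sp P a\<^esub> Tr P p2 a v = \<zero>\<^bsub>Sp P a\<^esub>" ..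
    interpret Vd: vectorspace K "Sp P d" by (rule V)
    interpret V1: vectorspace K "Sp P p1" by (rule V)
    interpret V2: vectorspace K "Sp P p2" by (rule V)
    \<comment> \<open>By the relation the image of \<open>w'\<close> in degree \<open>a\<close> is
      also the image of an element at \<open>p2\<close>. The meet of \<open>d\<close> with
      \<open>p2\<close> is strictly lower than \<open>d\<close>, so \<open>w'\<close> enters from
      below; subtracting the part that enters from the left places \<open>w\<close> itself in the
      corner.\<close>
    define w' where "w' = w \<oplus>\<^bsub>Sp P d\<^esub> Tr P p1 d u"
    have u': "Tr P p1 d u \<in> carrier (Sp P d)" using u by (rule cl[OF pd(1)])
    have w': "w' \<in> carrier (Sp P d)" unfolding w'_def using w u' by simp
    have "Tr P d a w' = Tr P d a w \<oplus>\<^bsub>Sp P a\<^esub> Tr P p1 a u"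
      unfolding w'_def pmodule_Tr_add[OF P da w u'] pmodule.transition_comp[OF P pd(1) da u] ..
    then have "Tr P d a w' = \<ominus>\<^bsub>Sp P a\<^esub> Tr P p2 a v"
      using rel cl[OF da w'] cl[OF pd(2) v] Va.M.minus_equality by metis
    also have "\<dots> = Tr P p2 a (\<ominus>\<^bsub>Sp P p2\<^esub> v)"
      using linear_map_minus[OF pmodule.transition[OF P pd(2)] v] by simp
    finally obtain z where z: "z \<in> carrier (Sp P (inf d p2))" "Tr P (inf d p2) d z = w'"
      using tame_inf[OF tame da pd(2) w', of "\<ominus>\<^bsub>Sp P p2\<^esub> v"] v by auto
    have inf2: "inf d p2 $ 2 < d $ 2" using y1(1) d12 by (simp add: inf_vec_def p inf_min)
    have "w' \<in> side P 2 (d $ 2) d"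
      unfolding z(2)[symmetric] by (rule sideI[OF _ inf2 z(1)]) simp
    moreover have "Tr P p1 d (\<ominus>\<^bsub>Sp P p1\<^esub> u) \<in> side P 1 (d $ 1) d"
      using u x1(1) d12 by (intro sideI[OF pd(1)]) (auto simp: p)
    ultimately have "Tr P p1 d (\<ominus>\<^bsub>Sp P p1\<^esub> u) \<oplus>\<^bsub>Sp P d\<^esub> w' \<in> corner P d"
      by (rule cornerI[rotated])
    also have "Tr P p1 d (\<ominus>\<^bsub>Sp P p1\<^esub> u) = \<ominus>\<^bsub>Sp P d\<^esub> Tr P p1 d u"
      using linear_map_minus[OF pmodule.transition[OF P pd(1)] u] .
    also have "\<ominus>\<^bsub>Sp P d\<^esub> Tr P p1 d u \<oplus>\<^bsub>Sp P d\<^esub> w' = w"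
      unfolding w'_def using w u' by (simp add: Vd.M.a_lcomm[of w] Vd.M.r_neg1 Vd.M.a_comm[of w])
    finally have "w \<in> corner P d" .
    also have "w = fam_sum (Sp P d) c (U d) (Pair d ` G d)"
      unfolding w_def by (rule arg_cong[where f = "fam_sum (Sp P d) c (U d)"]) (auto simp: D0_def E_def)
    also have "\<dots> = fam_sum (Sp P d) (\<lambda>v. c (d, v)) (\<lambda>v. U d (d, v)) (G d)"
    proof (rule fam_sum_reindex[OF V])
      show "c (d, v) \<in> carrier K" if "v \<in> G d" for v using cD[of "(d, v)"] that by (simp add: D0_def E_def)
      show "U d (d, v) \<in> carrier (Sp P d)" if "v \<in> G d" for v
        using Ua[of "(d, v)" d] that by (simp add: Ea_def E_def)
    qed (simp add: inj_on_def)
    also have "\<dots> = fam_sum (Sp P d) (\<lambda>v. c (d, v)) (\<lambda>v. v) (G d)"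
    proof (rule fam_sum_cong[OF V])
      show "c (d, v) \<in> carrier K" if "v \<in> G d" for v using cD[of "(d, v)"] that by (simp add: D0_def E_def)
      show "U d (d, v) \<in> carrier (Sp P d)" if "v \<in> G d" for v
        using Ua[of "(d, v)" d] that by (simp add: Ea_def E_def)
      show "U d (d, v) = v" if "v \<in> G d" for v
        using G(2)[of d] that by (auto simp: U_def pmodule.transition_id[OF P])
    qed simp
    finally have "c (d, v) = \<zero>\<^bsub>K\<^esub>" if "v \<in> G d" for v
      by (rule ind[rotated]) (use that cD in \<open>auto simp: D0_def E_def\<close>)
    moreover have "e0 = (d, snd e0)" "snd e0 \<in> G d" using e0(1) by (auto simp: d_def D_def Ea_def E_def)
    ultimately have "c e0 = \<zero>\<^bsub>K\<^esub>" by metis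
    then show False using e0(1) by (simp add: D_def)
  qed
  \<comment> \<open>\<open>S a\<close> turns coordinates into combinations of generators; the
    coordinate maps required by \<open>coords\<close> are its inverses.\<close>
  define S where "S = (\<lambda>a c. fam_sum (Sp P a) c (U a) (Ea a))"
  have lin: "linear_map K (fun_vs K (Ea a)) (Sp P a) (S a)" for a
  proof (rule linear_mapI[OF vectorspace_fun_vs[OF K] V])
    show "S a c \<in> carrier (Sp P a)" if "c \<in> carrier (fun_vs K (Ea a))" for c
      unfolding S_def using that Ua by (intro fam_sum_closed[OF V]) (auto simp: fin_funs_def)
    show "S a (c \<oplus>\<^bsub>fun_vs K (Ea a)\<^esub> c') = S a c \<oplus>\<^bsub>Sp P a\<^esub> S a c'"
      if "c \<in> carrier (fun_vs K (Ea a))" "c' \<in> carrier (fun_vs K (Ea a))" for c c'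
      unfolding S_def fun_vs_simps using that Ua by (intro fam_sum_add[OF V finE]) (auto simp: fin_funs_def)
    show "S a (k \<odot>\<^bsub>fun_vs K (Ea a)\<^esub> c) = k \<odot>\<^bsub>Sp P a\<^esub> S a c"
      if "k \<in> carrier K" "c \<in> carrier (fun_vs K (Ea a))" for k c
      unfolding S_def fun_vs_simps using that Ua by (intro fam_sum_smult[OF V finE]) (auto simp: fin_funs_def)
  qed
  have bij: "bij_betw (S a) (fin_funs K (Ea a)) (carrier (Sp P a))" for a
    unfolding bij_betw_def
  proof
    have "inj_on (S a) (carrier (fun_vs K (Ea a)))"
    proof (rule linear_map_inj_onI[OF lin])
      fix c assume "c \<in> carrier (fun_vs K (Ea a))" and sum: "S a c = \<zero>\<^bsub>Sp P a\<^esub>"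
      then have c: "c \<in> fin_funs K (Ea a)" by simp
      have "c e = \<zero>\<^bsub>K\<^esub>" for e
      proof (cases "e \<in> Ea a")
        case True
        show ?thesis by (rule independent[OF fin_funsD(1)[OF c] sum[unfolded S_def] True])
      qed (use fin_funsD(3)[OF c] in simp)
      then show "c = \<zero>\<^bsub>fun_vs K (Ea a)\<^esub>" by auto
    qed
    then show "inj_on (S a) (fin_funs K (Ea a))" by simp
    show "S a ` fin_funs K (Ea a) = carrier (Sp P a)"
    proof
      show "S a ` fin_funs K (Ea a) \<subseteq> carrier (Sp P a)" using linear_map_closed[OF lin, of _ a] by auto
      show "carrier (Sp P a) \<subseteq> S a ` fin_funs K (Ea a)"
      proof
        fix x assume "x \<in> carrier (Sp P a)"
        then have "x \<in> T a" using spanning by blast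
        then obtain c where c: "\<forall>e\<in>Ea a. c e \<in> carrier K" "x = S a c"
          by (auto simp: T_def fam_span_def S_def)
        define c' where "c' = (\<lambda>e. if e \<in> Ea a then c e else \<zero>\<^bsub>K\<^esub>)"
        have "finite {e. c' e \<noteq> \<zero>\<^bsub>K\<^esub>}"
          by (rule finite_subset[OF _ finE[of a]]) (auto simp: c'_def)
        then have "c' \<in> fin_funs K (Ea a)" using c(1) by (auto simp: fin_funs_def c'_def)
        moreover have "x = S a c'"
          unfolding c(2) S_def using c(1) Ua by (intro fam_sum_cong[OF V]) (auto simp: c'_def)
        ultimately show "x \<in> S a ` fin_funs K (Ea a)" by blast
      qed
    qed
  qed
  define g where "g = (\<lambda>a. inv_into (fin_funs K (Ea a)) (S a))"
  have Ea_eq: "{e \<in> E. a \<in> {fst e..}} = Ea a" for a by (simp add: Ea_def)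
  have "free_coords K P E fst g"
    unfolding coords_def Ea_eq
  proof (intro conjI allI impI P)
    show "linear_map K (Sp P a) (fun_vs K (Ea a)) (g a)" for a
      using linear_map_inv[OF lin, of a] bij[of a] by (simp add: g_def)
    show gb: "bij_betw (g a) (carrier (Sp P a)) (fin_funs K (Ea a))" for a
      unfolding g_def by (rule bij_betw_inv_into[OF bij])
    fix a b x assume ab: "a \<le> b" and x: "x \<in> carrier (Sp P a)"
    have c: "g a x \<in> fin_funs K (Ea a)" using bij_betwE[OF gb] x by blast
    have Sg: "S a (g a x) = x"
      unfolding g_def by (rule f_inv_into_f[of x "S a" "fin_funs K (Ea a)"]) (simp add: bij_betw_imp_surj_on[OF bij] x)
    have cb: "g a x \<in> fin_funs K (Ea b)" by (rule fin_funs_mono[OF c Ea_mono[OF ab]])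
    have "Tr P a b (S a (g a x)) = fam_sum (Sp P b) (g a x) (\<lambda>e. Tr P a b (U a e)) (Ea a)"
      unfolding S_def using fin_funsD(1)[OF c] Ua
      by (intro fam_sum_linear[OF V pmodule.transition[OF P ab] finE]) auto
    also have "\<dots> = fam_sum (Sp P b) (g a x) (U b) (Ea a)"
      using fin_funsD(1)[OF c] Ub[OF ab] Ua Ea_mono[OF ab] by (intro fam_sum_cong[OF V]) auto
    also have "\<dots> = S b (g a x)"
      unfolding S_def using fin_funsD(1,3)[OF c] Ua Ea_mono[OF ab]
      by (intro fam_sum_superset[OF V finE, symmetric]) auto
    finally have "g b (Tr P a b x) = g a x"
      unfolding Sg using inv_into_f_f[OF bij_betw_imp_inj_on[OF bij] cb] by (simp add: g_def)
    moreover have "g a x e = (if a \<in> {fst e..} \<and> b \<in> {fst e..} then g a x e else \<zero>\<^bsub>K\<^esub>)" for e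
      using fin_funsD(3)[OF c, of e] order_trans[OF _ ab, of "fst e"] by (auto simp: Ea_def)
    ultimately show "g b (Tr P a b x) = (\<lambda>e. if a \<in> {fst e..} \<and> b \<in> {fst e..} then g a x e else \<zero>\<^bsub>K\<^esub>)"
      by presburger
  qed
  then show ?thesis by blast
qed

section \<open>Submodules, images and the intermediate module\<close>

lemma sub_mod_simps [simp]:
  "carrier (Sp (sub_mod N S) a) = S a"
  "\<zero>\<^bsub>Sp (sub_mod N S) a\<^esub> = \<zero>\<^bsub>Sp N a\<^esub>"
  "x \<oplus>\<^bsub>Sp (sub_mod N S) a\<^esub> y = x \<oplus>\<^bsub>Sp N a\<^esub> y"
  "c \<odot>\<^bsub>Sp (sub_mod N S) a\<^esub> x = c \<odot>\<^bsub>Sp N a\<^esub> x"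
  "Tr (sub_mod N S) = Tr N"
  by (simp_all add: sub_mod_def)

lemma Sp_sub_mod: "Sp (sub_mod N S) a = (Sp N a)\<lparr>carrier := S a\<rparr>"
  by (simp add: sub_mod_def)

lemma pmodule_sub_mod:
  assumes N: "pmodule K N" and S: "\<And>a. submodule K (S a) (Sp N a)"
    and Tr: "\<And>a b x. a \<le> b \<Longrightarrow> x \<in> S a \<Longrightarrow> Tr N a b x \<in> S b"
  shows "pmodule K (sub_mod N S)"
proof (rule pmodule.intro)
  have sub: "x \<in> S a \<Longrightarrow> x \<in> carrier (Sp N a)" for x a using submodule.subset[OF S] by blast
  show V: "vectorspace K (Sp (sub_mod N S) a)" for a
    unfolding Sp_sub_mod by (rule submodule_vectorspace[OF pmodule.space[OF N] S])
  show "linear_map K (Sp (sub_mod N S) a) (Sp (sub_mod N S) b) (Tr (sub_mod N S) a b)" if "a \<le> b" for a b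
    by (rule linear_mapI[OF V V])
      (simp_all add: Tr[OF that] pmodule_Tr_add[OF N that] pmodule_Tr_smult[OF N that] sub)
  show "Tr (sub_mod N S) a a x = x" if "x \<in> carrier (Sp (sub_mod N S) a)" for a x
    using that pmodule.transition_id[OF N sub] by simp
  show "Tr (sub_mod N S) b c (Tr (sub_mod N S) a b x) = Tr (sub_mod N S) a c x"
    if "a \<le> b" "b \<le> c" "x \<in> carrier (Sp (sub_mod N S) a)" for a b c x
    using that pmodule.transition_comp[OF N that(1,2) sub] by simp
qed

lemma sub_mod_inclusion:
  assumes "pmodule K N" "pmodule K (sub_mod N S)" "pmodule K (sub_mod N S')"
    and "\<And>a. S a \<subseteq> S' a" "\<And>a. S' a \<subseteq> carrier (Sp N a)"
  shows "pmod_hom K (sub_mod N S) (sub_mod N S') (\<lambda>a x. x)" "pmod_hom K (sub_mod N S') N (\<lambda>a x. x)"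
proof -
  have "linear_map K (Sp (sub_mod N S) a) (Sp (sub_mod N S') a) (\<lambda>x. x)" for a
    by (rule linear_mapI[OF assms(2,3)[THEN pmodule.space]]) (use assms(4) in auto)
  moreover have "linear_map K (Sp (sub_mod N S') a) (Sp N a) (\<lambda>x. x)" for a
    by (rule linear_mapI[OF assms(3,1)[THEN pmodule.space]]) (use assms(5) in auto)
  ultimately show "pmod_hom K (sub_mod N S) (sub_mod N S') (\<lambda>a x. x)" "pmod_hom K (sub_mod N S') N (\<lambda>a x. x)"
    using assms by (simp_all add: pmod_hom_def pmod_hom_axioms_def)
qed

lemma pfd_sub_mod:
  fixes N :: "('i::order, 'k, 'w) pmod"
  assumes N: "pmodule K N" and P: "pmodule K (sub_mod N S)" and sub: "\<And>a. S a \<subseteq> carrier (Sp N a)"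
    and pfd: "pfd K N"
  shows "pfd K (sub_mod N S)"
  unfolding pfd_def
proof
  fix a
  have "linear_map K (Sp (sub_mod N S) a) (Sp N a) (\<lambda>x. x)"
    by (rule linear_mapI[OF P[THEN pmodule.space] N[THEN pmodule.space]]) (use sub in auto)
  then show "vectorspace.fin_dim K (Sp (sub_mod N S) a)"
    by (rule injective_fin_dim) (use pfd in \<open>auto simp: pfd_def\<close>)
qed

lemma pmod_homD:
  assumes "pmod_hom K M N f"
  shows pmod_hom_source: "pmodule K M" and pmod_hom_target: "pmodule K N"
    and pmod_hom_linear: "linear_map K (Sp M a) (Sp N a) (f a)"
    and pmod_hom_natural: "a \<le> b \<Longrightarrow> x \<in> carrier (Sp M a) \<Longrightarrow> f b (Tr M a b x) = Tr N a b (f a x)"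
  using assms by (simp_all add: pmod_hom_def pmod_hom_axioms_def)

lemma im_set_submodule:
  assumes f: "pmod_hom K M N f"
  shows "submodule K (im_set M f a) (Sp N a)"
proof -
  interpret linear_map K "Sp M a" "Sp N a" "f a" by (rule pmod_hom_linear[OF f])
  show ?thesis using im_is_submodule by (simp add: im_set_def im_def)
qed

lemma im_set_Tr:
  assumes f: "pmod_hom K M N f" and "a \<le> b" "x \<in> im_set M f a"
  shows "Tr N a b x \<in> im_set M f b"
proof -
  obtain y where y: "y \<in> carrier (Sp M a)" "x = f a y" using assms(3) by (auto simp: im_set_def)
  have "Tr N a b x = f b (Tr M a b y)" using pmod_hom_natural[OF f assms(2) y(1)] y(2) by simp
  then show ?thesis
    using pmodule_Tr_closed[OF pmod_hom_source[OF f] assms(2) y(1)] by (simp add: im_set_def)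
qed

lemma pmodule_im_mod: "pmod_hom K M N f \<Longrightarrow> pmodule K (im_mod M N f)"
  unfolding im_mod_def
  by (rule pmodule_sub_mod) (auto intro: im_set_submodule im_set_Tr pmod_hom_target)

text \<open>Coordinates are transported along the inverse of \<open>f a\<close>. Besides
  \<open>im f\<close> in the plane this covers the images of the maps induced on lines, which is why
  the index order is left general.\<close>

lemma coords_im_mod:
  assumes g: "coords K M E J g" and f: "pmod_hom K M N f"
    and inj: "\<And>a. inj_on (f a) (carrier (Sp M a))"
  shows "coords K (im_mod M N f) E J (\<lambda>a y. g a (inv_into (carrier (Sp M a)) (f a) y))"
proof -
  note I = pmodule_im_mod[OF f]
  have lin: "linear_map K (Sp M a) (Sp (im_mod M N f) a) (f a)" for a
    using pmodule.space[OF I, of a] unfolding im_mod_def Sp_sub_mod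
    by (rule linear_map_restrict_codomain[OF pmod_hom_linear[OF f]]) (simp add: im_set_def)
  have bij: "bij_betw (f a) (carrier (Sp M a)) (carrier (Sp (im_mod M N f) a))" for a
    using inj by (simp add: bij_betw_def im_mod_def im_set_def)
  show ?thesis
    unfolding coords_def
  proof (intro conjI allI impI I)
    show "linear_map K (Sp (im_mod M N f) a) (fun_vs K (alive E J a))
        (\<lambda>y. g a (inv_into (carrier (Sp M a)) (f a) y))" for a
      by (rule linear_map_compose[OF linear_map_inv[OF lin bij] coords_linear[OF g]])
    show "bij_betw (\<lambda>y. g a (inv_into (carrier (Sp M a)) (f a) y)) (carrier (Sp (im_mod M N f) a))
        (fin_funs K (alive E J a))" for a
      using bij_betw_trans[OF bij_betw_inv_into[OF bij] coords_bij[OF g]] by (simp add: o_def)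
    fix a b y assume ab: "a \<le> b" and "y \<in> carrier (Sp (im_mod M N f) a)"
    then obtain x where x: "x \<in> carrier (Sp M a)" "y = f a x" by (auto simp: im_mod_def im_set_def)
    have 1: "inv_into (carrier (Sp M a)) (f a) y = x"
      unfolding x(2) by (rule inv_into_f_f[OF inj x(1)])
    have "Tr (im_mod M N f) a b y = f b (Tr M a b x)"
      using pmod_hom_natural[OF f ab x(1)] x(2) by (simp add: im_mod_def)
    then have 2: "inv_into (carrier (Sp M b)) (f b) (Tr (im_mod M N f) a b y) = Tr M a b x"
      using inv_into_f_f[OF inj pmodule_Tr_closed[OF pmod_hom_source[OF f] ab x(1)]] by simp
    show "g b (inv_into (carrier (Sp M b)) (f b) (Tr (im_mod M N f) a b y)) =
        (\<lambda>e. if a \<in> J e \<and> b \<in> J e then g a (inv_into (carrier (Sp M a)) (f a) y) e else \<zero>\<^bsub>K\<^esub>)"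
      unfolding 1 2 by (rule coords_Tr[OF g ab x(1)])
  qed
qed

lemma free_modD:
  assumes "free_mod K M"
  shows "\<exists>(E :: ((real^2) \<times> 'v) set) deg g. free_coords K (M :: (real^2, 'k, 'v) pmod) E deg g"
proof -
  obtain E :: "((real^2) \<times> 'v) set" and deg where
    "pmod_iso K M (dsum E (\<lambda>e. interval_mod K {deg e..}))"
    using assms unfolding free_mod_def by blast
  then have "\<exists>g. free_coords K M E deg g" by (rule iso_dsum_imp_coords)
  then show ?thesis by blast
qed

lemma free_modI:
  fixes M :: "(real^2, 'k, 'v) pmod" and E :: "((real^2) \<times> 'v) set"
  assumes "free_coords K M E deg g"
  shows "free_mod K M"
proof -
  have "pmod_iso K M (dsum E (\<lambda>e. interval_mod K {deg e..}))"
    by (rule coords_imp_iso_dsum[OF assms]) (auto intro: order_trans)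
  then show ?thesis unfolding free_mod_def by blast
qed

section \<open>The submodule pulled back along a shift\<close>

text \<open>\<open>L_mod\<close> is the case where \<open>h\<close> is \<epsilon> times the first
  basis vector. What matters about the shift is that it moves degrees upwards and that translation
  respects the order and meets, so it is kept as one nonnegative vector.\<close>

locale pullback_module =
  fixes K :: "('k, 'm) ring_scheme" and M :: "(real^2, 'k, 'v) pmod" and N :: "(real^2, 'k, 'w) pmod"
    and f :: "real^2 \<Rightarrow> 'v \<Rightarrow> 'w" and h :: "real^2"
  assumes f: "pmod_hom K M N f" and h: "0 \<le> h"
begin

definition pull :: "real^2 \<Rightarrow> 'w set" where
  "pull a = {n \<in> carrier (Sp N a). Tr N a (a + h) n \<in> im_set M f (a + h)}"

abbreviation L :: "(real^2, 'k, 'w) pmod" where "L \<equiv> sub_mod N pull"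

lemma le_shift: "a \<le> a + h"
  using h by simp

lemma N: "pmodule K N"
  by (rule pmod_hom_target[OF f])

lemma pull_carrier: "pull a \<subseteq> carrier (Sp N a)"
  by (auto simp: pull_def)

lemma Tr_shift:
  assumes "a \<le> b" "x \<in> carrier (Sp N a)"
  shows "Tr N (a + h) (b + h) (Tr N a (a + h) x) = Tr N b (b + h) (Tr N a b x)"
proof -
  have "a + h \<le> b + h" using assms(1) by simp
  then show ?thesis
    using pmodule.transition_comp[OF N le_shift _ assms(2), of "b + h"]
      pmodule.transition_comp[OF N assms(1) le_shift assms(2)] by simp
qed

lemma pull_submodule: "submodule K (pull a) (Sp N a)"
proof (rule vs_submoduleI[OF pmodule.space[OF N] pull_carrier])
  interpret vectorspace K "Sp N a" by (rule pmodule.space[OF N])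
  note im = im_set_submodule[OF f, of "a + h"]
  show "\<zero>\<^bsub>Sp N a\<^esub> \<in> pull a"
    using submodule.zero_closed[OF im] pmodule_Tr_zero[OF N le_shift] by (simp add: pull_def)
  show "x \<oplus>\<^bsub>Sp N a\<^esub> y \<in> pull a" if "x \<in> pull a" "y \<in> pull a" for x y
    using that submodule.m_closed[OF im] pmodule_Tr_add[OF N le_shift] by (simp add: pull_def)
  show "c \<odot>\<^bsub>Sp N a\<^esub> x \<in> pull a" if "c \<in> carrier K" "x \<in> pull a" for c x
    using that submodule.smult_closed[OF im] pmodule_Tr_smult[OF N le_shift] by (simp add: pull_def)
qed

lemma pull_Tr:
  assumes "a \<le> b" "x \<in> pull a"
  shows "Tr N a b x \<in> pull b"
proof -
  have x: "x \<in> carrier (Sp N a)" "Tr N a (a + h) x \<in> im_set M f (a + h)"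
    using assms(2) by (auto simp: pull_def)
  have "a + h \<le> b + h" using assms(1) by simp
  from im_set_Tr[OF f this x(2)] have "Tr N b (b + h) (Tr N a b x) \<in> im_set M f (b + h)"
    unfolding Tr_shift[OF assms(1) x(1)] .
  then show ?thesis using pmodule_Tr_closed[OF N assms(1) x(1)] by (simp add: pull_def)
qed

lemma pmodule_pull: "pmodule K L"
  by (rule pmodule_sub_mod[OF N pull_submodule pull_Tr])

lemma im_set_subset_pull: "im_set M f a \<subseteq> pull a"
  using im_set_Tr[OF f le_shift] submodule.subset[OF im_set_submodule[OF f]] by (auto simp: pull_def)

text \<open>Membership in the pulled back submodule is membership in \<open>im f\<close> after a
  shift by \<open>h\<close>. Lifts are therefore constructed twice, in \<open>N\<close> and, shifted
  by \<open>h\<close>, in \<open>im f\<close>; injective transitions of \<open>N\<close> make the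
  two agree, so the lift in \<open>N\<close> belongs to the submodule.\<close>

lemma tame_pull:
  assumes gM: "free_coords K M E deg g" and gN: "free_coords K N E' deg' g'"
    and pfdM: "pfd K M" and pfdN: "pfd K N" and inj: "\<And>a. inj_on (f a) (carrier (Sp M a))"
  shows "tame L"
proof -
  let ?I = "im_mod M N f"
  note I = pmodule_im_mod[OF f]
  obtain gI where gI: "free_coords K ?I E deg gI" using coords_im_mod[OF gM f inj] by blast
  have pfdI: "pfd K ?I" using coords_pfd_iff[OF gI] coords_pfd_iff[OF gM] pfdM by simp
  note tN = free_coords_tame[OF gN pfdN] and tI = free_coords_tame[OF gI pfdI]
  have I_simps: "carrier (Sp ?I a) = im_set M f a" "Tr ?I = Tr N" for a by (simp_all add: im_mod_def)
  have imN: "x \<in> im_set M f a \<Longrightarrow> x \<in> carrier (Sp N a)" for x a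
    using submodule.subset[OF im_set_submodule[OF f]] by blast
  have pullN: "x \<in> pull a \<Longrightarrow> x \<in> carrier (Sp N a)" for x a using pull_carrier by blast
  show ?thesis
    unfolding tame_def
  proof (intro conjI allI impI ballI)
    show "inj_on (Tr L a b) (carrier (Sp L a))" if "a \<le> b" for a b
      using tame_inj[OF tN that] pullN by (auto intro!: inj_onI)
  next
    fix a b c x y
    assume ac: "a \<le> c" and bc: "b \<le> c" and "x \<in> carrier (Sp L a)"
      "y \<in> carrier (Sp L b)" "Tr L a c x = Tr L b c y"
    then have x: "x \<in> pull a" and y: "y \<in> pull b" and eq: "Tr N a c x = Tr N b c y" by simp_all
    obtain z where z: "z \<in> carrier (Sp N (inf a b))" "Tr N (inf a b) a z = x"
      using tame_inf[OF tN ac bc pullN[OF x] pullN[OF y] eq] .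
    \<comment> \<open>Translation commutes with meets, so the lift in the image is found exactly at
      the shift of the degree of \<open>z\<close>.\<close>
    have inf: "inf (a + h) (b + h) = inf a b + h"
      by (simp add: vec_eq_iff inf_vec_def inf_min min_add_distrib_left)
    have sh: "inf a b + h \<le> a + h" "a + h \<le> c + h" "b + h \<le> c + h" using ac bc by simp_all
    have "Tr N (a + h) (c + h) (Tr N a (a + h) x) = Tr N (b + h) (c + h) (Tr N b (b + h) y)"
      using Tr_shift[OF ac pullN[OF x]] Tr_shift[OF bc pullN[OF y]] eq by simp
    moreover have "Tr N a (a + h) x \<in> im_set M f (a + h)" "Tr N b (b + h) y \<in> im_set M f (b + h)"
      using x y by (simp_all add: pull_def)
    ultimately obtain z' where z': "z' \<in> im_set M f (inf a b + h)"
        "Tr N (inf a b + h) (a + h) z' = Tr N a (a + h) x"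
      using tame_inf[OF tI sh(2,3), of "Tr N a (a + h) x" "Tr N b (b + h) y"] unfolding I_simps inf by blast
    have "Tr N (inf a b + h) (a + h) (Tr N (inf a b) (inf a b + h) z) = Tr N a (a + h) x"
      using Tr_shift[of "inf a b" a z] z by simp
    then have "Tr N (inf a b) (inf a b + h) z = z'"
      using tame_inj[OF tN sh(1) pmodule_Tr_closed[OF N le_shift z(1)] imN[OF z'(1)]] z'(2) by simp
    then have "z \<in> pull (inf a b)" using z(1) z'(1) by (simp add: pull_def)
    then show "x \<in> Tr L (inf a b) a ` carrier (Sp L (inf a b))"
      using z(2) by auto
  next
    fix a
    \<comment> \<open>A generator of \<open>im f\<close> influences the submodule at degree
      \<open>b\<close> when it is alive at \<open>b + h\<close>; hence the generator degrees of
      \<open>im f\<close> are moved back by \<open>h\<close>.\<close>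
    define \<Gamma> where "\<Gamma> = deg' ` {e \<in> E'. deg' e \<le> a} \<union> (\<lambda>e. deg e - h) ` {e \<in> E. deg e \<le> a + h}"
    show "\<exists>F. critical_set L a F"
    proof (rule critical_from_points[of \<Gamma>])
      show "finite \<Gamma>"
        using coords_pfd_iff[OF gM] pfdM coords_pfd_iff[OF gN] pfdN by (simp add: \<Gamma>_def)
    next
      fix b assume b: "b \<le> a" and e: "{c \<in> \<Gamma>. c \<le> b} = {}"
      have "{e \<in> E'. deg' e \<le> b} = {}"
        using e order_trans[OF _ b] by (auto simp: \<Gamma>_def)
      then have "carrier (Sp N b) = {\<zero>\<^bsub>Sp N b\<^esub>}" by (rule free_coords_trivial[OF gN])
      then show "carrier (Sp L b) = {\<zero>\<^bsub>Sp L b\<^esub>}"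
        using pull_carrier[of b] submodule.zero_closed[OF pull_submodule[of b]] by auto
    next
      fix d b assume db: "d \<le> b" and ba: "b \<le> a" and \<Gamma>: "\<And>c. c \<in> \<Gamma> \<Longrightarrow> c \<le> b \<Longrightarrow> c \<le> d"
      have dbh: "d + h \<le> b + h" using db by simp
      have "x \<in> Tr N d b ` pull d" if x: "x \<in> pull b" for x
      proof -
        have "deg' e \<le> d" if "e \<in> E'" "deg' e \<le> b" for e
          using that order_trans[OF that(2) ba] by (intro \<Gamma>) (auto simp: \<Gamma>_def)
        then obtain y where y: "y \<in> carrier (Sp N d)" "Tr N d b y = x"
          using free_coords_lift[OF gN db pullN[OF x]] by blast
        have x': "Tr N b (b + h) x \<in> im_set M f (b + h)" using x by (simp add: pull_def)
        have "deg e \<le> d + h" if "e \<in> E" "deg e \<le> b + h" for e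
        proof -
          have "b + h \<le> a + h" using ba by simp
          then have "deg e \<le> a + h" by (rule order_trans[OF that(2)])
          then have "deg e - h \<in> \<Gamma>" using that(1) by (simp add: \<Gamma>_def)
          then have "deg e - h \<le> d" using that(2) by (intro \<Gamma>) (simp_all add: diff_le_eq)
          then show ?thesis by (simp add: diff_le_eq)
        qed
        then obtain y' where y': "y' \<in> im_set M f (d + h)" "Tr N (d + h) (b + h) y' = Tr N b (b + h) x"
          using free_coords_lift[OF gI dbh, of "Tr N b (b + h) x"] x' unfolding I_simps by blast
        have "Tr N (d + h) (b + h) (Tr N d (d + h) y) = Tr N b (b + h) x"
          using Tr_shift[OF db y(1)] y(2) by simp
        then have "Tr N d (d + h) y = y'"
          using tame_inj[OF tN dbh pmodule_Tr_closed[OF N le_shift y(1)] imN[OF y'(1)]] y'(2) by simp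
        then have "y \<in> pull d" using y(1) y'(1) by (simp add: pull_def)
        then show ?thesis using y(2) by blast
      qed
      then show "carrier (Sp L b) \<subseteq> Tr L d b ` carrier (Sp L d)"
        by auto
    qed
  qed
qed

end

section \<open>Restriction to lines\<close>

lemma quot_vs_simps [simp]:
  "carrier (quot_vs V W) = a_rcosets\<^bsub>V\<^esub> W"
  "\<zero>\<^bsub>quot_vs V W\<^esub> = W"
  "X \<oplus>\<^bsub>quot_vs V W\<^esub> Y = X <+>\<^bsub>V\<^esub> Y"
  "c \<odot>\<^bsub>quot_vs V W\<^esub> X = quot_map V W (\<lambda>x. c \<odot>\<^bsub>V\<^esub> x) X"
  by (simp_all add: quot_vs_def)

lemma carrier_quot_vs: "a_rcosets\<^bsub>V\<^esub> W = (\<lambda>x. W +>\<^bsub>V\<^esub> x) ` carrier V"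
  by (auto simp: A_RCOSETS_def RCOSETS_def a_r_coset_def)

lemma coset_def': "W +>\<^bsub>V\<^esub> x = {w \<oplus>\<^bsub>V\<^esub> x | w. w \<in> W}"
  by (auto simp: a_r_coset_def r_coset_def)

lemma submodule_abelian_subgroup:
  assumes V: "vectorspace K V" and W: "submodule K W V"
  shows "abelian_subgroup W V"
proof -
  interpret vectorspace K V by fact
  show ?thesis
  proof (rule abelian_subgroupI3)
    show "abelian_group V" by (rule M.abelian_group_axioms)
    show "additive_subgroup W V"
    proof (rule additive_subgroup.intro, rule group.subgroupI)
      show "Group.group (add_monoid V)" by (rule M.a_group)
      show "W \<subseteq> carrier (add_monoid V)" using submodule.subset[OF W] by simp
      show "W \<noteq> {}" using submodule.zero_closed[OF W] by blast
      show "inv\<^bsub>add_monoid V\<^esub> x \<in> W" if "x \<in> W" for x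
      proof -
        have x: "x \<in> carrier V" using that submodule.subset[OF W] by blast
        have "(\<ominus>\<^bsub>K\<^esub> \<one>\<^bsub>K\<^esub>) \<odot>\<^bsub>V\<^esub> x \<in> W" using that by (intro submodule.smult_closed[OF W]) auto
        then have "\<ominus>\<^bsub>V\<^esub> x \<in> W" using x by (simp add: smult_minus_1)
        then show ?thesis by (simp add: a_inv_def)
      qed
      show "x \<otimes>\<^bsub>add_monoid V\<^esub> y \<in> W" if "x \<in> W" "y \<in> W" for x y
        using that submodule.m_closed[OF W] by simp
    qed
  qed
qed

context
  fixes K :: "('k, 'm) ring_scheme" and V :: "('k, 'v) module" and W :: "'v set"
  assumes V: "vectorspace K V" and W: "submodule K W V"
begin

interpretation vectorspace K V by (rule V)
interpretation W: abelian_subgroup W V by (rule submodule_abelian_subgroup[OF V W])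

lemma coset_memE:
  assumes "y \<in> W +>\<^bsub>V\<^esub> x"
  obtains w where "w \<in> W" "y = w \<oplus>\<^bsub>V\<^esub> x"
  using assms by (auto simp: coset_def')

lemma coset_self: "x \<in> carrier V \<Longrightarrow> x \<in> W +>\<^bsub>V\<^esub> x"
  by (rule W.a_rcos_self)

lemma coset_absorb:
  assumes "w \<in> W" "x \<in> carrier V"
  shows "W +>\<^bsub>V\<^esub> (w \<oplus>\<^bsub>V\<^esub> x) = W +>\<^bsub>V\<^esub> x"
proof (rule W.a_repr_independence'[symmetric])
  show "w \<oplus>\<^bsub>V\<^esub> x \<in> W +>\<^bsub>V\<^esub> x" using assms(1) by (auto simp: coset_def')
qed (use assms in simp)

lemma coset_zero: "W +>\<^bsub>V\<^esub> \<zero>\<^bsub>V\<^esub> = W"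
proof -
  have "w \<oplus>\<^bsub>V\<^esub> \<zero>\<^bsub>V\<^esub> = w" if "w \<in> W" for w using that submodule.subset[OF W] by auto
  then show ?thesis by (force simp: coset_def')
qed

lemma coset_eq_self_iff:
  assumes "x \<in> carrier V"
  shows "W +>\<^bsub>V\<^esub> x = W \<longleftrightarrow> x \<in> W"
proof
  show "W +>\<^bsub>V\<^esub> x = W \<Longrightarrow> x \<in> W" using coset_self[OF assms] by simp
  show "x \<in> W \<Longrightarrow> W +>\<^bsub>V\<^esub> x = W"
    using coset_absorb[of x "\<zero>\<^bsub>V\<^esub>"] coset_zero assms by simp
qed

lemma quot_map_coset:
  assumes "x \<in> carrier V" and "\<And>y. y \<in> W +>\<^bsub>V\<^esub> x \<Longrightarrow> X +>\<^bsub>U\<^esub> h y = X +>\<^bsub>U\<^esub> h x"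
  shows "quot_map U X h (W +>\<^bsub>V\<^esub> x) = X +>\<^bsub>U\<^esub> h x"
  unfolding quot_map_def using assms(2) coset_self[OF assms(1)] by blast

lemma smult_coset:
  assumes "c \<in> carrier K" "x \<in> carrier V"
  shows "quot_map V W (\<lambda>x. c \<odot>\<^bsub>V\<^esub> x) (W +>\<^bsub>V\<^esub> x) = W +>\<^bsub>V\<^esub> (c \<odot>\<^bsub>V\<^esub> x)"
proof (rule quot_map_coset[OF assms(2)])
  fix y assume "y \<in> W +>\<^bsub>V\<^esub> x"
  then obtain w where w: "w \<in> W" "y = w \<oplus>\<^bsub>V\<^esub> x" by (rule coset_memE)
  have wV: "w \<in> carrier V" using w(1) submodule.subset[OF W] by blast
  have "c \<odot>\<^bsub>V\<^esub> y = c \<odot>\<^bsub>V\<^esub> w \<oplus>\<^bsub>V\<^esub> c \<odot>\<^bsub>V\<^esub> x"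
    using w(2) wV assms by (simp add: smult_r_distr)
  then show "W +>\<^bsub>V\<^esub> (c \<odot>\<^bsub>V\<^esub> y) = W +>\<^bsub>V\<^esub> (c \<odot>\<^bsub>V\<^esub> x)"
    using coset_absorb[OF submodule.smult_closed[OF W assms(1) w(1)]] assms by simp
qed

lemma vectorspace_quot_vs: "vectorspace K (quot_vs V W)"
proof (rule vectorspace_image[OF V, where h = "\<lambda>x. W +>\<^bsub>V\<^esub> x"])
  show "(\<lambda>x. W +>\<^bsub>V\<^esub> x) ` carrier V = carrier (quot_vs V W)" by (simp add: carrier_quot_vs)
qed (simp_all add: W.a_rcos_sum smult_coset coset_zero)

text \<open>Besides induced maps between quotients this handles coordinates on a quotient, where the
  target is not a space of cosets.\<close>

lemma quot_vs_linear_map: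
  assumes X: "vectorspace K X" and h: "linear_map K V X h"
    and H: "\<And>x. x \<in> carrier V \<Longrightarrow> H (W +>\<^bsub>V\<^esub> x) = h x"
  shows "linear_map K (quot_vs V W) X H"
proof (rule linear_mapI[OF vectorspace_quot_vs X])
  show "H A \<in> carrier X" if "A \<in> carrier (quot_vs V W)" for A
    using that H linear_map_closed[OF h] by (auto simp: carrier_quot_vs)
  show "H (A \<oplus>\<^bsub>quot_vs V W\<^esub> B) = H A \<oplus>\<^bsub>X\<^esub> H B"
    if A: "A \<in> carrier (quot_vs V W)" and B: "B \<in> carrier (quot_vs V W)" for A B
  proof -
    obtain x y where "x \<in> carrier V" "A = W +>\<^bsub>V\<^esub> x" "y \<in> carrier V" "B = W +>\<^bsub>V\<^esub> y"
      using A B by (auto simp: carrier_quot_vs)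
    then show ?thesis by (simp add: W.a_rcos_sum H linear_map_add[OF h])
  qed
  show "H (c \<odot>\<^bsub>quot_vs V W\<^esub> A) = c \<odot>\<^bsub>X\<^esub> H A"
    if c: "c \<in> carrier K" and A: "A \<in> carrier (quot_vs V W)" for c A
  proof -
    obtain x where "x \<in> carrier V" "A = W +>\<^bsub>V\<^esub> x" using A by (auto simp: carrier_quot_vs)
    then show ?thesis using c by (simp add: smult_coset H linear_map_smult[OF h])
  qed
qed

end

lemma coset_linear:
  fixes V :: "('k, 'v) module"
  assumes "vectorspace K V" "submodule K W V"
  shows "linear_map K V (quot_vs V W) (\<lambda>x. W +>\<^bsub>V\<^esub> x)"
proof -
  interpret W: abelian_subgroup W V by (rule submodule_abelian_subgroup[OF assms])
  show ?thesis
    by (rule linear_mapI[OF assms(1) vectorspace_quot_vs[OF assms]])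
      (auto simp: carrier_quot_vs W.a_rcos_sum smult_coset[OF assms])
qed

text \<open>Two representatives differ by an element of \<open>U0\<close>, which \<open>h\<close>
  carries into \<open>W\<close>, so they lead to the same coset.\<close>

lemma induced_coset:
  fixes U :: "('k, 'u) module" and V :: "('k, 'v) module"
  assumes h: "linear_map K U V h" and U0: "submodule K U0 U" and W: "submodule K W V"
    and sub: "\<And>x. x \<in> U0 \<Longrightarrow> h x \<in> W" and x: "x \<in> carrier U"
  shows "quot_map V W h (U0 +>\<^bsub>U\<^esub> x) = W +>\<^bsub>V\<^esub> h x"
proof (rule quot_map_coset[OF linear_map_dom[OF h] U0 x])
  fix y assume "y \<in> U0 +>\<^bsub>U\<^esub> x"
  then obtain w where w: "w \<in> U0" "y = w \<oplus>\<^bsub>U\<^esub> x" by (rule coset_memE[OF linear_map_dom[OF h] U0])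
  have "w \<in> carrier U" using w(1) submodule.subset[OF U0] by blast
  then have "h y = h w \<oplus>\<^bsub>V\<^esub> h x" using w(2) x linear_map_add[OF h] by simp
  then show "W +>\<^bsub>V\<^esub> h y = W +>\<^bsub>V\<^esub> h x"
    using coset_absorb[OF linear_map_cod[OF h] W sub[OF w(1)] linear_map_closed[OF h x]] by simp
qed

lemma induced_linear:
  fixes U :: "('k, 'u) module" and V :: "('k, 'v) module"
  assumes h: "linear_map K U V h" and U0: "submodule K U0 U" and W: "submodule K W V"
    and sub: "\<And>x. x \<in> U0 \<Longrightarrow> h x \<in> W"
  shows "linear_map K (quot_vs U U0) (quot_vs V W) (quot_map V W h)"
  by (rule quot_vs_linear_map[OF linear_map_dom[OF h] U0 vectorspace_quot_vs[OF linear_map_cod[OF h] W]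
        linear_map_compose[OF h coset_linear[OF linear_map_cod[OF h] W]]])
    (rule induced_coset[OF assms])

section \<open>Lines and the quotient modules on them\<close>

definition other :: "2 \<Rightarrow> 2" where "other i = (if i = 1 then 2 else 1)"

lemma other_cases: "k = i \<or> k = other i"
  using exhaust_2[of k] exhaust_2[of i] by (auto simp: other_def)

lemma other_neq: "other i \<noteq> i" "i \<noteq> other i"
  using exhaust_2[of i] by (auto simp: other_def)

lemma forall_other: "(\<forall>k. Q k) \<longleftrightarrow> Q i \<and> Q (other i)"
  using other_cases[of _ i] by metis

lemma on_line_simps [simp]:
  "on_line i a t $ i = a $ i + t" "on_line i a t $ other i = a $ other i"
  by (simp_all add: on_line_def axis_def other_neq)

text \<open>The projection \<open>c'\<close> is forced to be \<open>c\<close> with its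
  \<open>i\<close>-th coordinate removed. It agrees with \<open>a\<close> in that coordinate, so
  strictness of the product order is decided by the other one.\<close>

lemma below_line_iff:
  assumes "a $ i = 0"
  shows "below_line i a c \<longleftrightarrow> c $ other i < a $ other i"
proof -
  have "c = c' + (c $ i) *\<^sub>R axis i 1 \<longleftrightarrow> c' = c - (c $ i) *\<^sub>R axis i 1" for c'
    using eq_diff_eq[of c' c "(c $ i) *\<^sub>R axis i 1"] by auto
  then have "below_line i a c \<longleftrightarrow> (c - (c $ i) *\<^sub>R axis i 1) $ i = 0 \<and> c - (c $ i) *\<^sub>R axis i 1 < a"
    unfolding below_line_def by metis
  also have "\<dots> \<longleftrightarrow> c $ other i < a $ other i"
    using assms unfolding less_le_not_le less_eq_vec_def forall_other[of _ i]
    by (auto simp: axis_def other_neq)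
  finally show ?thesis .
qed

lemma below_set_side:
  assumes "pmodule K Q" "a $ i = 0"
  shows "below_set i a Q b = side Q (other i) (a $ other i) b"
  unfolding below_set_def side_def below_line_iff[OF assms(2)]
  using pmodule_Tr_closed[OF assms(1)] by auto

abbreviation line_side :: "2 \<Rightarrow> real^2 \<Rightarrow> (real^2, 'k, 'v) pmod \<Rightarrow> real \<Rightarrow> 'v set" where
  "line_side i a P t \<equiv> side P (other i) (a $ other i) (on_line i a t)"

abbreviation line_coset :: "2 \<Rightarrow> real^2 \<Rightarrow> (real^2, 'k, 'v) pmod \<Rightarrow> real \<Rightarrow> 'v \<Rightarrow> 'v set" where
  "line_coset i a P t x \<equiv> line_side i a P t +>\<^bsub>Sp P (on_line i a t)\<^esub> x"

lemma line_mod_simps: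
  assumes "pmodule K Q" "a $ i = 0"
  shows "Sp (line_mod i a Q) t = quot_vs (Sp Q (on_line i a t)) (line_side i a Q t)"
    and "Tr (line_mod i a Q) s t =
      quot_map (Sp Q (on_line i a t)) (line_side i a Q t) (Tr Q (on_line i a s) (on_line i a t))"
    and "line_map i a Q g t =
      quot_map (Sp Q (on_line i a t)) (line_side i a Q t) (g (on_line i a t))"
  using below_set_side[OF assms] by (simp_all add: line_mod_def line_map_def quot_mod_def Let_def)

lemma side_Tr:
  assumes Q: "pmodule K Q" and "b \<le> b'" "x \<in> side Q k h b"
  shows "Tr Q b b' x \<in> side Q k h b'"
proof -
  obtain c u where c: "c \<le> b" "c $ k < h" "u \<in> carrier (Sp Q c)" "x = Tr Q c b u" using assms(3) by (rule sideE)
  have "Tr Q b b' x = Tr Q c b' u" using pmodule.transition_comp[OF Q c(1) assms(2) c(3)] c(4) by simp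
  also have "\<dots> \<in> side Q k h b'" using c assms(2) by (intro sideI) auto
  finally show ?thesis .
qed

lemma on_line_mono: "s \<le> t \<Longrightarrow> on_line i a s \<le> on_line i a t"
  unfolding less_eq_vec_def forall_other[of _ i] by simp

lemma pmodule_line_mod:
  assumes Q: "pmodule K Q" and a: "a $ i = 0"
  shows "pmodule K (line_mod i a Q)"
proof -
  note simps = line_mod_simps[OF Q a]
  let ?S = "\<lambda>t. line_side i a Q t"
  let ?p = "on_line i a"
  note V = pmodule.space[OF Q] and S = side_submodule[OF Q]
  have co: "Tr (line_mod i a Q) s t (?S s +>\<^bsub>Sp Q (?p s)\<^esub> x) = ?S t +>\<^bsub>Sp Q (?p t)\<^esub> Tr Q (?p s) (?p t) x"
    if "s \<le> t" "x \<in> carrier (Sp Q (?p s))" for s t x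
    unfolding simps
    by (rule induced_coset[OF pmodule.transition[OF Q on_line_mono[OF that(1)]] S S
          side_Tr[OF Q on_line_mono[OF that(1)]] that(2)])
  show ?thesis
  proof (rule pmodule.intro)
    show "vectorspace K (Sp (line_mod i a Q) t)" for t
      unfolding simps by (rule vectorspace_quot_vs[OF V S])
    show "linear_map K (Sp (line_mod i a Q) s) (Sp (line_mod i a Q) t) (Tr (line_mod i a Q) s t)" if "s \<le> t" for s t
      unfolding simps
      by (rule induced_linear[OF pmodule.transition[OF Q on_line_mono[OF that]] S S side_Tr[OF Q on_line_mono[OF that]]])
  next
    fix t X assume "X \<in> carrier (Sp (line_mod i a Q) t)"
    then obtain x where "x \<in> carrier (Sp Q (?p t))" "X = ?S t +>\<^bsub>Sp Q (?p t)\<^esub> x"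
      unfolding simps by (auto simp: carrier_quot_vs)
    then show "Tr (line_mod i a Q) t t X = X" by (simp add: co pmodule.transition_id[OF Q])
  next
    fix r s t X assume rst: "r \<le> s" "s \<le> t" and "X \<in> carrier (Sp (line_mod i a Q) r)"
    then obtain x where x: "x \<in> carrier (Sp Q (?p r))" "X = ?S r +>\<^bsub>Sp Q (?p r)\<^esub> x"
      unfolding simps by (auto simp: carrier_quot_vs)
    show "Tr (line_mod i a Q) s t (Tr (line_mod i a Q) r s X) = Tr (line_mod i a Q) r t X"
      unfolding x(2) co[OF rst(1) x(1)] co[OF order_trans[OF rst] x(1)]
        co[OF rst(2) pmodule_Tr_closed[OF Q on_line_mono[OF rst(1)] x(1)]]
        pmodule.transition_comp[OF Q on_line_mono[OF rst(1)] on_line_mono[OF rst(2)] x(1)] ..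
  qed
qed

lemma line_map_coset:
  assumes h: "pmod_hom K P Q h" and a: "a $ i = 0" and x: "x \<in> carrier (Sp P (on_line i a t))"
  shows "line_map i a Q h t (line_coset i a P t x) =
    line_coset i a Q t (h (on_line i a t) x)"
    and "linear_map K (Sp (line_mod i a P) t) (Sp (line_mod i a Q) t) (line_map i a Q h t)"
proof -
  note P = pmod_hom_source[OF h] and Q = pmod_hom_target[OF h]
  have sub: "h b y \<in> side Q k r b" if y: "y \<in> side P k r b" for b k r y
  proof -
    obtain c u where c: "c \<le> b" "c $ k < r" "u \<in> carrier (Sp P c)" "y = Tr P c b u" using y by (rule sideE)
    have "h b y = Tr Q c b (h c u)" using pmod_hom_natural[OF h c(1,3)] c(4) by simp
    also have "\<dots> \<in> side Q k r b" using c linear_map_closed[OF pmod_hom_linear[OF h]] by (intro sideI)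
    finally show ?thesis .
  qed
  show "line_map i a Q h t (line_coset i a P t x) =
    line_coset i a Q t (h (on_line i a t) x)"
    unfolding line_mod_simps[OF Q a]
    by (rule induced_coset[OF pmod_hom_linear[OF h] side_submodule[OF P] side_submodule[OF Q] sub x])
  show "linear_map K (Sp (line_mod i a P) t) (Sp (line_mod i a Q) t) (line_map i a Q h t)"
    unfolding line_mod_simps[OF Q a] line_mod_simps[OF P a]
    by (rule induced_linear[OF pmod_hom_linear[OF h] side_submodule[OF P] side_submodule[OF Q] sub])
qed

lemma line_Tr_coset:
  assumes Q: "pmodule K Q" and a: "a $ i = 0" and st: "s \<le> t" and x: "x \<in> carrier (Sp Q (on_line i a s))"
  shows "Tr (line_mod i a Q) s t (line_coset i a Q s x) =
    line_coset i a Q t (Tr Q (on_line i a s) (on_line i a t) x)"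
  unfolding line_mod_simps[OF Q a]
  by (rule induced_coset[OF pmodule.transition[OF Q on_line_mono[OF st]] side_submodule[OF Q]
        side_submodule[OF Q] side_Tr[OF Q on_line_mono[OF st]] x])

lemma line_carrierE:
  assumes "pmodule K Q" "a $ i = 0" "X \<in> carrier (Sp (line_mod i a Q) t)"
  obtains x where "x \<in> carrier (Sp Q (on_line i a t))"
    "X = line_coset i a Q t x"
  using assms(3) that unfolding line_mod_simps[OF assms(1,2)] by (auto simp: carrier_quot_vs)

lemma pmod_hom_line_map:
  assumes h: "pmod_hom K P Q h" and a: "a $ i = 0"
  shows "pmod_hom K (line_mod i a P) (line_mod i a Q) (line_map i a Q h)"
  unfolding pmod_hom_def pmod_hom_axioms_def
proof (intro conjI allI impI)
  note P = pmod_hom_source[OF h] and Q = pmod_hom_target[OF h]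
  show "pmodule K (line_mod i a P)" "pmodule K (line_mod i a Q)" by (rule pmodule_line_mod[OF _ a]; fact)+
  show "linear_map K (Sp (line_mod i a P) t) (Sp (line_mod i a Q) t) (line_map i a Q h t)" for t
  proof -
    interpret vectorspace K "Sp P (on_line i a t)" by (rule pmodule.space[OF P])
    show ?thesis by (rule line_map_coset(2)[OF h a M.zero_closed])
  qed
  fix s t X assume st: "s \<le> t" and "X \<in> carrier (Sp (line_mod i a P) s)"
  then obtain x where x: "x \<in> carrier (Sp P (on_line i a s))"
    "X = line_coset i a P s x"
    using line_carrierE[OF P a] by blast
  show "line_map i a Q h t (Tr (line_mod i a P) s t X) = Tr (line_mod i a Q) s t (line_map i a Q h s X)"
    unfolding x(2) line_Tr_coset[OF P a st x(1)] line_map_coset(1)[OF h a x(1)]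
      line_map_coset(1)[OF h a pmodule_Tr_closed[OF P on_line_mono[OF st] x(1)]]
      line_Tr_coset[OF Q a st linear_map_closed[OF pmod_hom_linear[OF h] x(1)]]
      pmod_hom_natural[OF h on_line_mono[OF st] x(1)] ..
qed

text \<open>Generators with a smaller coordinate across the line are divided out on it, and those
  with a larger one are never alive there, so exactly these remain.\<close>

definition line_gens :: "2 \<Rightarrow> real^2 \<Rightarrow> 'e set \<Rightarrow> ('e \<Rightarrow> real^2) \<Rightarrow> 'e set" where
  "line_gens i a E deg = {e \<in> E. deg e $ other i = a $ other i}"

text \<open>At a degree below the line no generator of the line is alive, and transitions leave
  coordinates unchanged; this gives one direction. Conversely the support is finite and lies
  strictly below the line, so its greatest coordinate across the line is the height of a possible
  source.\<close>

lemma free_coords_side_iff: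
  assumes g: "free_coords K P E deg g" and a: "a $ i = 0" and x: "x \<in> carrier (Sp P b)"
    and b: "b $ other i = a $ other i"
  shows "x \<in> side P (other i) (a $ other i) b \<longleftrightarrow> (\<forall>e\<in>line_gens i a E deg. g b x e = \<zero>\<^bsub>K\<^esub>)"
proof
  assume "x \<in> side P (other i) (a $ other i) b"
  then obtain c u where c: "c \<le> b" "c $ other i < a $ other i" "u \<in> carrier (Sp P c)" "x = Tr P c b u"
    by (rule sideE)
  have eq: "g b x = g c u" using free_coords_Tr[OF g c(1,3)] c(4) by simp
  show "\<forall>e\<in>line_gens i a E deg. g b x e = \<zero>\<^bsub>K\<^esub>"
  proof
    fix e assume "e \<in> line_gens i a E deg"
    then have "\<not> deg e $ other i \<le> c $ other i" using c(2) by (simp add: line_gens_def)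
    then have "\<not> deg e \<le> c" unfolding less_eq_vec_def by blast
    then show "g b x e = \<zero>\<^bsub>K\<^esub>" unfolding eq using fin_funsD(3)[OF coords_mem[OF g c(3)], of e] by simp
  qed
next
  assume z: "\<forall>e\<in>line_gens i a E deg. g b x e = \<zero>\<^bsub>K\<^esub>"
  note mem = coords_mem[OF g x]
  define S where "S = {e. g b x e \<noteq> \<zero>\<^bsub>K\<^esub>}"
  have fS: "finite S" unfolding S_def by (rule fin_funsD(2)[OF mem])
  have S: "deg e \<le> b" "deg e $ other i < a $ other i" if "e \<in> S" for e
  proof -
    have e: "e \<in> E" "deg e \<le> b" using that fin_funsD(3)[OF mem, of e] by (auto simp: S_def)
    then show "deg e \<le> b" by simp
    have "deg e $ other i \<noteq> a $ other i" using z that e(1) by (auto simp: S_def line_gens_def)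
    moreover have "deg e $ other i \<le> a $ other i"
      using e(2) b unfolding less_eq_vec_def by (metis (no_types))
    ultimately show "deg e $ other i < a $ other i" by simp
  qed
  \<comment> \<open>The extra value \<open>a $ other i - 1\<close> makes the maximum meaningful for
    empty support and keeps it below the line.\<close>
  define y where "y = Max (insert (a $ other i - 1) ((\<lambda>e. deg e $ other i) ` S))"
  have y: "y < a $ other i" "\<And>e. e \<in> S \<Longrightarrow> deg e $ other i \<le> y"
    unfolding y_def using fS S(2) by auto
  define c :: "real^2" where "c = (\<chi> k. if k = i then b $ i else y)"
  have c: "c $ i = b $ i" "c $ other i = y" by (simp_all add: c_def other_neq)
  have cb: "c \<le> b" unfolding less_eq_vec_def forall_other[of _ i] using c y(1) b by simp
  have "deg e \<le> c" if "e \<in> E" "deg e \<le> b" "g b x e \<noteq> \<zero>\<^bsub>K\<^esub>" for e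
  proof -
    have "e \<in> S" using that by (simp add: S_def)
    then show ?thesis
      unfolding less_eq_vec_def forall_other[of _ i] using c y(2) that(2) by (simp add: less_eq_vec_def)
  qed
  then obtain u where "u \<in> carrier (Sp P c)" "Tr P c b u = x"
    using free_coords_lift[OF g cb x] by blast
  then show "x \<in> side P (other i) (a $ other i) b"
    using sideI[OF cb, of "other i" "a $ other i" u P] c(2) y(1) by simp
qed

text \<open>Deleting the coordinates of generators off the line is a linear map whose kernel is
  exactly the submodule divided out, so it descends to coordinates on the quotient.\<close>

lemma line_coords:
  assumes g: "free_coords K P E deg g" and a: "a $ i = 0"
  shows "\<exists>gl. free_coords K (line_mod i a P) (line_gens i a E deg) (\<lambda>e. deg e $ i) gl"
proof -
  note P = coords_pmodule[OF g]
  note K = pmodule_field[OF P] and V = pmodule.space[OF P] and S = side_submodule[OF P]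
  interpret field K by fact
  let ?p = "on_line i a" and ?E = "line_gens i a E deg"
  let ?S = "\<lambda>t. side P (other i) (a $ other i) (?p t)"
  define T where "T = (\<lambda>t x e. if e \<in> ?E then g (?p t) x e else \<zero>\<^bsub>K\<^esub>)"
  have on_line: "e \<in> ?E \<Longrightarrow> deg e \<le> ?p t \<longleftrightarrow> deg e $ i \<le> t" for e t
    unfolding less_eq_vec_def forall_other[of _ i] using a by (simp add: line_gens_def)
  have set_eq: "{e \<in> E. ?p t \<in> {deg e..}} \<inter> ?E = {e \<in> ?E. t \<in> {deg e $ i..}}" for t
    using on_line by (auto simp: line_gens_def)
  have Tlin: "linear_map K (Sp P (?p t)) (fun_vs K {e \<in> ?E. t \<in> {deg e $ i..}}) (T t)" for t
  proof (rule linear_mapI[OF V vectorspace_fun_vs[OF K]])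
    fix x assume x: "x \<in> carrier (Sp P (?p t))"
    show "T t x \<in> carrier (fun_vs K {e \<in> ?E. t \<in> {deg e $ i..}})"
      unfolding T_def set_eq[symmetric] fun_vs_simps by (rule fin_funs_restrict[OF K coords_mem[OF g x]])
    show "T t (x \<oplus>\<^bsub>Sp P (?p t)\<^esub> y) = T t x \<oplus>\<^bsub>fun_vs K {e \<in> ?E. t \<in> {deg e $ i..}}\<^esub> T t y"
      if "y \<in> carrier (Sp P (?p t))" for y
      using linear_map_add[OF coords_linear[OF g] x that] by (auto simp: T_def)
    show "T t (c \<odot>\<^bsub>Sp P (?p t)\<^esub> x) = c \<odot>\<^bsub>fun_vs K {e \<in> ?E. t \<in> {deg e $ i..}}\<^esub> T t x"
      if "c \<in> carrier K" for c
      using linear_map_smult[OF coords_linear[OF g] that x] that by (auto simp: T_def)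
  qed
  have Tzero: "T t x = (\<lambda>_. \<zero>\<^bsub>K\<^esub>) \<longleftrightarrow> x \<in> ?S t" if x: "x \<in> carrier (Sp P (?p t))" for t x
    unfolding free_coords_side_iff[OF g a x on_line_simps(2)] T_def fun_eq_iff by auto
  \<comment> \<open>The truncated coordinates are constant on each coset, so their image is a
    singleton and \<open>the_elem\<close> reads off its member.\<close>
  define gl where "gl = (\<lambda>t X. the_elem (T t ` X))"
  have gl: "gl t (?S t +>\<^bsub>Sp P (?p t)\<^esub> x) = T t x" if x: "x \<in> carrier (Sp P (?p t))" for t x
  proof -
    have "T t y = T t x" if y: "y \<in> ?S t +>\<^bsub>Sp P (?p t)\<^esub> x" for y
    proof -
      obtain w where w: "w \<in> ?S t" "y = w \<oplus>\<^bsub>Sp P (?p t)\<^esub> x" using coset_memE[OF V S y] .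
      have wV: "w \<in> carrier (Sp P (?p t))" using w(1) submodule.subset[OF S] by blast
      have "T t w = (\<lambda>_. \<zero>\<^bsub>K\<^esub>)" using Tzero[OF wV] w(1) by simp
      then have "T t y = (\<lambda>e. \<zero>\<^bsub>K\<^esub> \<oplus>\<^bsub>K\<^esub> T t x e)" using linear_map_add[OF Tlin wV x] w(2) by simp
      also have "\<dots> = T t x"
        using fin_funsD(1)[OF linear_map_closed[OF Tlin x, unfolded fun_vs_simps]] by simp
      finally show ?thesis .
    qed
    then have "T t ` (?S t +>\<^bsub>Sp P (?p t)\<^esub> x) = {T t x}" using coset_self[OF V S x] by blast
    then show ?thesis by (simp add: gl_def)
  qed
  have gl_lin: "linear_map K (Sp (line_mod i a P) t) (fun_vs K {e \<in> ?E. t \<in> {deg e $ i..}}) (gl t)" for t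
    unfolding line_mod_simps[OF P a] by (rule quot_vs_linear_map[OF V S vectorspace_fun_vs[OF K] Tlin gl])
  have "free_coords K (line_mod i a P) ?E (\<lambda>e. deg e $ i) gl"
    unfolding coords_def
  proof (intro conjI allI impI pmodule_line_mod[OF P a] gl_lin)
    fix t
    show "bij_betw (gl t) (carrier (Sp (line_mod i a P) t)) (fin_funs K {e \<in> ?E. t \<in> {deg e $ i..}})"
      unfolding bij_betw_def
    proof
      show "inj_on (gl t) (carrier (Sp (line_mod i a P) t))"
      proof (rule linear_map_inj_onI[OF gl_lin])
        fix X assume "X \<in> carrier (Sp (line_mod i a P) t)" and z: "gl t X = \<zero>\<^bsub>fun_vs K {e \<in> ?E. t \<in> {deg e $ i..}}\<^esub>"
        then obtain x where x: "x \<in> carrier (Sp P (?p t))" "X = ?S t +>\<^bsub>Sp P (?p t)\<^esub> x"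
          using line_carrierE[OF P a] by blast
        then have "x \<in> ?S t" using z gl[OF x(1)] Tzero[OF x(1)] by simp
        then show "X = \<zero>\<^bsub>Sp (line_mod i a P) t\<^esub>"
          unfolding x(2) line_mod_simps[OF P a] using coset_eq_self_iff[OF V S x(1)] by simp
      qed
      show "gl t ` carrier (Sp (line_mod i a P) t) = fin_funs K {e \<in> ?E. t \<in> {deg e $ i..}}"
      proof (rule equalityI; rule subsetI)
        fix c assume "c \<in> gl t ` carrier (Sp (line_mod i a P) t)"
        then show "c \<in> fin_funs K {e \<in> ?E. t \<in> {deg e $ i..}}" using linear_map_closed[OF gl_lin] by auto
      next
        fix c assume c: "c \<in> fin_funs K {e \<in> ?E. t \<in> {deg e $ i..}}"
        then have "c \<in> fin_funs K {e \<in> E. ?p t \<in> {deg e..}}"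
          by (rule fin_funs_mono) (use on_line in \<open>auto simp: line_gens_def\<close>)
        then obtain x where x: "x \<in> carrier (Sp P (?p t))" "g (?p t) x = c" by (rule coords_surj[OF g])
        have "T t x = c" using x(2) fin_funsD(3)[OF c] by (auto simp: T_def fun_eq_iff)
        then show "c \<in> gl t ` carrier (Sp (line_mod i a P) t)"
          using gl[OF x(1)] x(1) unfolding line_mod_simps[OF P a] by (force simp: carrier_quot_vs)
      qed
    qed
  next
    fix s t X assume st: "s \<le> t" and "X \<in> carrier (Sp (line_mod i a P) s)"
    then obtain x where x: "x \<in> carrier (Sp P (?p s))" "X = ?S s +>\<^bsub>Sp P (?p s)\<^esub> x"
      using line_carrierE[OF P a] by blast
    have "gl t (Tr (line_mod i a P) s t X) = T t (Tr P (?p s) (?p t) x)"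
      unfolding x(2) line_Tr_coset[OF P a st x(1)]
      by (rule gl[OF pmodule_Tr_closed[OF P on_line_mono[OF st] x(1)]])
    also have "\<dots> = T s x"
      unfolding T_def free_coords_Tr[OF g on_line_mono[OF st] x(1)] ..
    also have "\<dots> = gl s X" unfolding x(2) gl[OF x(1)] ..
    also have "\<dots> = (\<lambda>e. if s \<in> {deg e $ i..} \<and> t \<in> {deg e $ i..} then gl s X e else \<zero>\<^bsub>K\<^esub>)"
    proof
      fix e
      have "gl s X \<in> fin_funs K {e \<in> ?E. s \<in> {deg e $ i..}}"
        using linear_map_closed[OF gl_lin, of X s] \<open>X \<in> _\<close> by simp
      from fin_funsD(3)[OF this, of e] show "gl s X e = (if s \<in> {deg e $ i..} \<and> t \<in> {deg e $ i..} then gl s X e else \<zero>\<^bsub>K\<^esub>)"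
        using st by auto
    qed
    finally show "gl t (Tr (line_mod i a P) s t X) =
      (\<lambda>e. if s \<in> {deg e $ i..} \<and> t \<in> {deg e $ i..} then gl s X e else \<zero>\<^bsub>K\<^esub>)" .
  qed
  then show ?thesis by blast
qed

section \<open>Matchings of one-parameter free modules\<close>

text \<open>The form in which \<open>barcode_free\<close> delivers barcodes; over the real line the
  same expression gives multisets of rays.\<close>

definition quadrant_mset :: "'e set \<Rightarrow> ('e \<Rightarrow> 'i::order) \<Rightarrow> 'i set mset" where
  "quadrant_mset E deg = (\<lambda>J. card {e \<in> E. {deg e..} = J})"

lemma quadrant_mset_atLeast: "quadrant_mset E deg {d..} = card {e \<in> E. deg e = d}"
  by (simp add: quadrant_mset_def)

lemma rep_quadrant_iff: "({d..}, j) \<in> rep (quadrant_mset E deg) \<longleftrightarrow> j < card {e \<in> E. deg e = d}"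
  by (simp add: rep_def quadrant_mset_atLeast)

lemma rep_quadrantE:
  assumes "p \<in> rep (quadrant_mset E deg)"
  obtains d j where "p = ({d..}, j)" "j < card {e \<in> E. deg e = d}"
proof -
  obtain J j where p: "p = (J, j)" by (cases p)
  have "j < card {e \<in> E. {deg e..} = J}" using assms p by (simp add: rep_def quadrant_mset_def)
  moreover from this have "{e \<in> E. {deg e..} = J} \<noteq> {}" by (metis card.empty not_less_zero)
  then obtain d where "J = {d..}" by auto
  ultimately show thesis using that[of d j] p by simp
qed

lemma left_end_atLeast: "left_end {t..} = (ereal t, True)"
proof -
  have "Inf (ereal ` {t..}) = ereal t" by (rule cInf_eq_minimum) auto
  then show ?thesis by (simp add: left_end_def)
qed

lemma right_end_atLeast: "right_end {t..} = (\<infinity>, False)"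
proof -
  have "Sup (ereal ` {t..}) = \<infinity>"
  proof (rule SUP_PInfty)
    fix n :: nat
    show "\<exists>x\<in>{t..}. ereal (real n) \<le> ereal x" by (intro bexI[of _ "max t (real n)"]) auto
  qed
  then show ?thesis by (auto simp: right_end_def)
qed

text \<open>Rays with the same left endpoint are equal, so the rank of a copy is its index alone and
  copies are matched with themselves. An epimorphism between modules with equal barcodes contributes
  this identity.\<close>

lemma endpoint_matching_left_refl:
  "endpoint_matching left_end (quadrant_mset E d) (quadrant_mset E d) = Id_on (rep (quadrant_mset E d))"
proof -
  let ?A = "quadrant_mset E d"
  have rank: "card (predecessors left_end ?A ({t..}, j)) = j" if "j < card {e \<in> E. d e = t}" for t j
  proof -
    have "predecessors left_end ?A ({t..}, j) = (\<lambda>k. ({t..}, k)) ` {..<j}"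
    proof (rule equalityI; rule subsetI)
      fix q assume "q \<in> predecessors left_end ?A ({t..}, j)"
      then have q: "q \<in> rep ?A" "left_end (fst q) = left_end {t..}"
        "{t..} \<subset> fst q \<or> (fst q = {t..} \<and> snd q < j)" by (auto simp: predecessors_def)
      obtain t' k where tk: "q = ({t'..}, k)" using q(1) by (rule rep_quadrantE)
      then have "t' = t" using q(2) by (simp add: left_end_atLeast)
      then show "q \<in> (\<lambda>k. ({t..}, k)) ` {..<j}" using q(3) tk by auto
    next
      fix q assume "q \<in> (\<lambda>k. ({t..}, k)) ` {..<j}"
      then obtain k where "q = ({t..}, k)" "k < j" by auto
      then show "q \<in> predecessors left_end ?A ({t..}, j)"
        using that by (simp add: predecessors_def rep_quadrant_iff)
    qed
    then show ?thesis by (simp add: card_image inj_on_def)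
  qed
  show ?thesis
  proof (rule equalityI; rule subsetI)
    fix z assume "z \<in> endpoint_matching left_end ?A ?A"
    then obtain p q where z: "z = (p, q)" "p \<in> rep ?A" "q \<in> rep ?A" "left_end (fst p) = left_end (fst q)"
      "card (predecessors left_end ?A p) = card (predecessors left_end ?A q)"
      by (auto simp: endpoint_matching_def)
    obtain t j where p: "p = ({t..}, j)" "j < card {e \<in> E. d e = t}" using z(2) by (rule rep_quadrantE)
    obtain t' k where q: "q = ({t'..}, k)" "k < card {e \<in> E. d e = t'}" using z(3) by (rule rep_quadrantE)
    have "t = t'" using z(4) p(1) q(1) by (simp add: left_end_atLeast)
    moreover have "j = k" using z(5) unfolding p(1) q(1) rank[OF p(2)] rank[OF q(2)] .
    ultimately show "z \<in> Id_on (rep ?A)" using z p q by (auto intro: Id_onI)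
  qed (auto simp: endpoint_matching_def)
qed

section \<open>Sorted generator degrees on a line\<close>

locale gen_degrees =
  fixes E :: "'e set" and d :: "'e \<Rightarrow> real"
  assumes fin: "finite {e \<in> E. d e \<le> t}"
begin

definition below :: "real \<Rightarrow> nat" where "below t = card {e \<in> E. d e < t}"
definition upto :: "real \<Rightarrow> nat" where "upto t = card {e \<in> E. d e \<le> t}"
definition num_at :: "real \<Rightarrow> nat" where "num_at t = card {e \<in> E. d e = t}"

lemma fin_less: "finite {e \<in> E. d e < t}"
  by (rule finite_subset[OF _ fin[of t]]) auto

lemma upto_eq: "upto t = below t + num_at t"
proof -
  have "finite {e \<in> E. d e = t}" by (rule finite_subset[OF _ fin[of t]]) auto
  then have "card ({e \<in> E. d e < t} \<union> {e \<in> E. d e = t}) = below t + num_at t"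
    unfolding below_def num_at_def by (intro card_Un_disjoint[OF fin_less]) auto
  moreover have "{e \<in> E. d e < t} \<union> {e \<in> E. d e = t} = {e \<in> E. d e \<le> t}" by auto
  ultimately show ?thesis by (simp add: upto_def)
qed

lemma upto_mono: "s \<le> t \<Longrightarrow> upto s \<le> upto t"
  unfolding upto_def by (intro card_mono fin) auto

lemma upto_le_below: "s < t \<Longrightarrow> upto s \<le> below t"
  unfolding upto_def below_def by (intro card_mono fin_less) auto

text \<open>In the list of degrees sorted with repetitions and numbered from 0, copy
  \<open>j\<close> of \<open>t\<close> stands at position \<open>below t + j\<close>. The strict
  inequality reflects the numbering from 0: the degrees up to \<open>s\<close> fill the positions
  before \<open>upto s\<close>.\<close>

lemma rank_less_iff:
  assumes "j < num_at t"
  shows "below t + j < upto s \<longleftrightarrow> t \<le> s"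
proof
  assume "t \<le> s"
  then show "below t + j < upto s" using upto_mono[of t s] upto_eq[of t] assms by simp
next
  assume "below t + j < upto s"
  then show "t \<le> s" using upto_le_below[of s t] by (cases "t \<le> s") auto
qed

text \<open>The count \<open>upto\<close> jumps only at degrees that occur, so the least occurring
  degree with \<open>n < upto t\<close> is the one whose copies cover position
  \<open>n\<close>.\<close>

lemma rank_surj:
  assumes "n < upto s"
  shows "\<exists>t j. j < num_at t \<and> below t + j = n"
proof -
  define X where "X = {t \<in> d ` {e \<in> E. d e \<le> s}. n < upto t}"
  have fX: "finite X" using fin[of s] by (simp add: X_def)
  \<comment> \<open>The greatest occurring degree up to \<open>s\<close> belongs to
    \<open>X\<close>, since \<open>upto\<close> does not grow between it and
    \<open>s\<close>.\<close>
  have ne: "X \<noteq> {}"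
  proof -
    have f: "finite (d ` {e \<in> E. d e \<le> s})" using fin[of s] by simp
    have "{e \<in> E. d e \<le> s} \<noteq> {}" using assms by (metis card.empty not_less_zero upto_def)
    then have "Max (d ` {e \<in> E. d e \<le> s}) \<in> d ` {e \<in> E. d e \<le> s}" using f by (intro Max_in) auto
    moreover have "d e \<le> Max (d ` {e \<in> E. d e \<le> s})" if "e \<in> E" "d e \<le> s" for e
      using f that by (intro Max_ge) auto
    then have "{e \<in> E. d e \<le> s} \<subseteq> {e \<in> E. d e \<le> Max (d ` {e \<in> E. d e \<le> s})}" by auto
    then have "upto s \<le> upto (Max (d ` {e \<in> E. d e \<le> s}))"
      unfolding upto_def by (intro card_mono fin)
    ultimately show ?thesis using assms by (auto simp: X_def)
  qed
  define t where "t = Min X"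
  have "t \<in> X" unfolding t_def by (rule Min_in[OF fX ne])
  then have t: "n < upto t" "t \<le> s" by (auto simp: X_def)
  \<comment> \<open>Otherwise the greatest occurring degree before \<open>t\<close> would already
    belong to \<open>X\<close>, against the minimality of \<open>t\<close>.\<close>
  have "below t \<le> n"
  proof (rule ccontr)
    assume "\<not> below t \<le> n"
    then have n: "n < below t" by simp
    have f: "finite (d ` {e \<in> E. d e < t})" using fin_less by simp
    have "{e \<in> E. d e < t} \<noteq> {}" using n by (metis below_def card.empty not_less_zero)
    then have m: "Max (d ` {e \<in> E. d e < t}) \<in> d ` {e \<in> E. d e < t}" using f by (intro Max_in) auto
    have "d e \<le> Max (d ` {e \<in> E. d e < t})" if "e \<in> E" "d e < t" for e
      using f that by (intro Max_ge) auto
    then have "{e \<in> E. d e < t} \<subseteq> {e \<in> E. d e \<le> Max (d ` {e \<in> E. d e < t})}" by auto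
    then have "below t \<le> upto (Max (d ` {e \<in> E. d e < t}))"
      unfolding below_def upto_def by (intro card_mono fin)
    then have "Max (d ` {e \<in> E. d e < t}) \<in> X" using m n t(2) by (auto simp: X_def)
    then have "t \<le> Max (d ` {e \<in> E. d e < t})" unfolding t_def by (rule Min_le[OF fX])
    then show False using m by auto
  qed
  then have "n - below t < num_at t \<and> below t + (n - below t) = n"
    using t(1) upto_eq[of t] by auto
  then show ?thesis by blast
qed

text \<open>All rays share the open right endpoint at infinity, and a ray is longer exactly when it
  starts earlier. The predecessors are thus the copies of smaller degrees together with the earlier
  copies of \<open>t\<close>.\<close>

lemma card_predecessors_right:
  assumes "j < num_at t"
  shows "card (predecessors right_end (quadrant_mset E d) ({t..}, j)) = below t + j"
proof -
  let ?A = "quadrant_mset E d"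
  have finJ: "finite {e \<in> E. {d e..} = J}" for J
  proof (cases "{e \<in> E. {d e..} = J} = {}")
    case False
    then obtain s where "J = {s..}" by auto
    then show ?thesis by (intro finite_subset[OF _ fin[of s]]) auto
  next
    case True then show ?thesis by (simp only: finite.emptyI)
  qed
  obtain \<beta> where \<beta>: "bij_betw \<beta> (rep ?A) E" "\<And>p. p \<in> rep ?A \<Longrightarrow> {d (\<beta> p)..} = fst p"
    using rep_bij[where \<phi> = "\<lambda>e. {d e..}" and E = E, OF finJ] unfolding quadrant_mset_def by blast
  define L where "L = {p \<in> rep ?A. {t..} \<subset> fst p}"
  have "\<beta> ` L = {e \<in> E. d e < t}"
  proof (rule equalityI; rule subsetI)
    fix e assume "e \<in> \<beta> ` L"
    then obtain p where p: "p \<in> rep ?A" "{t..} \<subset> fst p" "e = \<beta> p" by (auto simp: L_def)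
    have "e \<in> E" using bij_betwE[OF \<beta>(1)] p by blast
    moreover have "{t..} \<subset> {d e..}" using p \<beta>(2)[OF p(1)] by simp
    then have "d e < t" by (auto simp: psubset_eq less_le)
    ultimately show "e \<in> {e \<in> E. d e < t}" by simp
  next
    fix e assume e: "e \<in> {e \<in> E. d e < t}"
    then obtain p where p: "p \<in> rep ?A" "e = \<beta> p" using bij_betw_imp_surj_on[OF \<beta>(1)] by blast
    have "{t..} \<subset> {d e..}" using e by (auto simp: psubset_eq)
    then have "p \<in> L" using p \<beta>(2)[OF p(1)] by (simp add: L_def)
    then show "e \<in> \<beta> ` L" using p(2) by blast
  qed
  moreover have inj: "inj_on \<beta> L"
    by (rule inj_on_subset[OF bij_betw_imp_inj_on[OF \<beta>(1)]]) (auto simp: L_def)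
  ultimately have cL: "card L = below t" and fL: "finite L"
    using card_image[OF inj] finite_imageD[OF _ inj] fin_less[of t] by (auto simp: below_def)
  have "predecessors right_end ?A ({t..}, j) = L \<union> (\<lambda>k. ({t..}, k)) ` {..<j}"
  proof (rule equalityI; rule subsetI)
    fix q assume "q \<in> predecessors right_end ?A ({t..}, j)"
    then show "q \<in> L \<union> (\<lambda>k. ({t..}, k)) ` {..<j}" by (auto simp: predecessors_def L_def)
  next
    fix q assume q: "q \<in> L \<union> (\<lambda>k. ({t..}, k)) ` {..<j}"
    then have qA: "q \<in> rep ?A" using assms by (auto simp: L_def rep_quadrant_iff num_at_def)
    then obtain s k where "q = ({s..}, k)" by (rule rep_quadrantE)
    then show "q \<in> predecessors right_end ?A ({t..}, j)"
      using q qA by (auto simp: predecessors_def L_def right_end_atLeast)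
  qed
  moreover have "card (L \<union> (\<lambda>k. ({t..}, k)) ` {..<j}) = card L + card ((\<lambda>k. ({t..}, k)) ` {..<j})"
    using fL by (intro card_Un_disjoint) (auto simp: L_def)
  ultimately show ?thesis using cL by (simp add: card_image inj_on_def)
qed

lemma rank_inj:
  assumes "j < num_at t" "k < num_at s" "below t + j = below s + k"
  shows "t = s" "j = k"
proof -
  have "t \<le> s" using rank_less_iff[OF assms(1), of s] rank_less_iff[OF assms(2), of s] assms(3) by simp
  moreover have "s \<le> t" using rank_less_iff[OF assms(1), of t] rank_less_iff[OF assms(2), of t] assms(3) by simp
  ultimately show "t = s" "j = k" using assms(3) by simp_all
qed

end

text \<open>Matched copies have equal positions in the two sorted lists. By the first inequality a
  position taken by degree \<open>s\<close> in \<open>E\<close> is filled by a degree at most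
  \<open>s\<close> in \<open>E'\<close>; by the second the degree drops by at most \<epsilon>. The
  same inequalities guarantee that each position of one list exists in the other.\<close>

lemma right_matching:
  assumes A: "gen_degrees E d" and B: "gen_degrees E' d'"
    and le: "\<And>t. card {e \<in> E. d e \<le> t} \<le> card {e \<in> E'. d' e \<le> t}"
    and ge: "\<And>t. card {e \<in> E'. d' e \<le> t} \<le> card {e \<in> E. d e \<le> t + \<epsilon>}"
  defines "R \<equiv> endpoint_matching right_end (quadrant_mset E d) (quadrant_mset E' d')"
  shows "bijective_matching (quadrant_mset E d) (quadrant_mset E' d') R"
    and "(p, q) \<in> R \<Longrightarrow> \<exists>s j t k. p = ({s..}, j) \<and> q = ({t..}, k) \<and> s - \<epsilon> \<le> t \<and> t \<le> s"
proof -
  interpret A: gen_degrees E d by fact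
  interpret B: gen_degrees E' d' by fact
  let ?A = "quadrant_mset E d" and ?B = "quadrant_mset E' d'"
  have R_iff: "(({s..}, j), ({t..}, k)) \<in> R \<longleftrightarrow> j < A.num_at s \<and> k < B.num_at t \<and> A.below s + j = B.below t + k" for s j t k
    unfolding R_def endpoint_matching_def
    using A.card_predecessors_right[of j s] B.card_predecessors_right[of k t]
    by (auto simp: rep_quadrant_iff A.num_at_def B.num_at_def right_end_atLeast)
  have RE: "\<exists>s j t k. p = ({s..}, j) \<and> q = ({t..}, k) \<and> j < A.num_at s \<and> k < B.num_at t \<and> A.below s + j = B.below t + k"
    if "(p, q) \<in> R" for p q
  proof -
    have "p \<in> rep ?A" "q \<in> rep ?B" using that by (auto simp: R_def endpoint_matching_def)
    then obtain s j t k where "p = ({s..}, j)" "q = ({t..}, k)" using rep_quadrantE by metis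
    then show ?thesis using that R_iff by blast
  qed
  have le': "A.upto t \<le> B.upto t" and ge': "B.upto t \<le> A.upto (t + \<epsilon>)" for t
    using le ge by (simp_all add: A.upto_def B.upto_def)
  have rA: "A.below s + j < A.upto s" if "j < A.num_at s" for s j using A.rank_less_iff[OF that] by simp
  have rB: "B.below s + j < B.upto s" if "j < B.num_at s" for s j using B.rank_less_iff[OF that] by simp
  show "\<exists>s j t k. p = ({s..}, j) \<and> q = ({t..}, k) \<and> s - \<epsilon> \<le> t \<and> t \<le> s" if pq: "(p, q) \<in> R"
  proof -
    obtain s j t k where *: "p = ({s..}, j)" "q = ({t..}, k)" "j < A.num_at s" "k < B.num_at t" "A.below s + j = B.below t + k"
      using RE[OF pq] by blast
    have "B.below t + k < B.upto s" using rA[OF *(3)] le'[of s] *(5) by simp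
    then have "t \<le> s" using B.rank_less_iff[OF *(4)] by simp
    moreover have "A.below s + j < A.upto (t + \<epsilon>)" using rB[OF *(4)] ge'[of t] *(5) by simp
    then have "s \<le> t + \<epsilon>" using A.rank_less_iff[OF *(3)] by simp
    ultimately show ?thesis using *(1,2) by auto
  qed
  show "bijective_matching ?A ?B R"
    unfolding bijective_matching_def is_matching_def
  proof (intro conjI)
    show sub: "R \<subseteq> rep ?A \<times> rep ?B" by (auto simp: R_def endpoint_matching_def)
    show "single_valued R"
    proof (rule single_valuedI)
      fix p q q' assume "(p, q) \<in> R" "(p, q') \<in> R"
      then obtain s j t k s' j' t' k' where 1: "p = ({s..}, j)" "q = ({t..}, k)" "k < B.num_at t" "A.below s + j = B.below t + k"
        and 2: "p = ({s'..}, j')" "q' = ({t'..}, k')" "k' < B.num_at t'" "A.below s' + j' = B.below t' + k'"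
        using RE by metis
      then have "B.below t + k = B.below t' + k'" by simp
      then show "q = q'" using B.rank_inj[OF 1(3) 2(3)] 1(2) 2(2) by simp
    qed
    show "single_valued (R\<inverse>)"
    proof (rule single_valuedI)
      fix q p p' assume "(q, p) \<in> R\<inverse>" "(q, p') \<in> R\<inverse>"
      then have "(p, q) \<in> R" "(p', q) \<in> R" by auto
      then obtain s j t k s' j' t' k' where 1: "p = ({s..}, j)" "q = ({t..}, k)" "j < A.num_at s" "A.below s + j = B.below t + k"
        and 2: "p' = ({s'..}, j')" "q = ({t'..}, k')" "j' < A.num_at s'" "A.below s' + j' = B.below t' + k'"
        using RE by metis
      then have "A.below s + j = A.below s' + j'" by simp
      then show "p = p'" using A.rank_inj[OF 1(3) 2(3)] 1(1) 2(1) by simp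
    qed
    show "Domain R = rep ?A"
    proof
      show "Domain R \<subseteq> rep ?A" using sub by auto
      show "rep ?A \<subseteq> Domain R"
      proof
        fix p assume "p \<in> rep ?A"
        then obtain s j where p: "p = ({s..}, j)" "j < card {e \<in> E. d e = s}" by (rule rep_quadrantE)
        then have j: "j < A.num_at s" by (simp add: A.num_at_def)
        have "A.below s + j < B.upto s" using rA[OF j] le'[of s] by simp
        then obtain t k where "k < B.num_at t" "B.below t + k = A.below s + j" using B.rank_surj by blast
        then have "(p, ({t..}, k)) \<in> R" unfolding p(1) R_iff using j by simp
        then show "p \<in> Domain R" by blast
      qed
    qed
    show "Range R = rep ?B"
    proof
      show "Range R \<subseteq> rep ?B" using sub by auto
      show "rep ?B \<subseteq> Range R"
      proof
        fix q assume "q \<in> rep ?B"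
        then obtain t k where q: "q = ({t..}, k)" "k < card {e \<in> E'. d' e = t}" by (rule rep_quadrantE)
        then have k: "k < B.num_at t" by (simp add: B.num_at_def)
        have "B.below t + k < A.upto (t + \<epsilon>)" using rB[OF k] ge'[of t] by simp
        then obtain s j where "j < A.num_at s" "A.below s + j = B.below t + k" using A.rank_surj by blast
        then have "(({s..}, j), q) \<in> R" unfolding q(1) R_iff using k by simp
        then show "q \<in> Range R" by blast
      qed
    qed
  qed
qed

lemma bijective_matching_relcomp:
  assumes "bijective_matching S T \<sigma>" "bijective_matching T U \<tau>"
  shows "bijective_matching S U (\<sigma> O \<tau>)"
proof -
  note s = assms[unfolded bijective_matching_def is_matching_def]
  have "single_valued (\<sigma> O \<tau>)" using s by (intro single_valued_relcomp) auto
  moreover have "single_valued ((\<sigma> O \<tau>)\<inverse>)"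
    unfolding converse_relcomp using s by (intro single_valued_relcomp) auto
  moreover have "Domain (\<sigma> O \<tau>) = Domain \<sigma>" using s by blast
  moreover have "Range (\<sigma> O \<tau>) = Range \<tau>" using s by blast
  moreover have "\<sigma> O \<tau> \<subseteq> rep S \<times> rep U" using s by blast
  ultimately show ?thesis using s unfolding bijective_matching_def is_matching_def by simp
qed

section \<open>Direction matchings\<close>

lemma line_gens_below:
  assumes "a $ i = 0"
  shows "{e \<in> line_gens i a E deg. deg e $ i \<le> t} \<subseteq> {e \<in> E. deg e \<le> on_line i a t}"
  unfolding less_eq_vec_def forall_other[of _ i] using assms by (auto simp: line_gens_def)

definition line_base :: "2 \<Rightarrow> real^2 \<Rightarrow> real^2" where
  "line_base i b = b - (b $ i) *\<^sub>R axis i 1"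

lemma line_base:
  "line_base i b $ i = 0" "on_line i (line_base i b) (b $ i) = b"
  by (simp_all add: line_base_def on_line_def)

text \<open>Matchings on different lines do not interfere, because a degree lies on one line only
  and has one parameter there.\<close>

lemma on_line_inject:
  assumes "a $ i = 0" "a' $ i = 0" "on_line i a s = on_line i a' s'"
  shows "a = a'" "s = s'"
proof -
  have "on_line i a s $ i = on_line i a' s' $ i" "on_line i a s $ other i = on_line i a' s' $ other i"
    using assms(3) by simp_all
  then show "s = s'" "a = a'"
    using assms(1,2) by (simp_all add: vec_eq_iff forall_other[of _ i])
qed

lemma rep_line_iff:
  assumes "a $ i = 0"
  shows "({s..}, j) \<in> rep (quadrant_mset (line_gens i a E deg) (\<lambda>e. deg e $ i)) \<longleftrightarrow>
    ({on_line i a s..}, j) \<in> rep (quadrant_mset E deg)"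
proof -
  have "{e \<in> line_gens i a E deg. deg e $ i = s} = {e \<in> E. deg e = on_line i a s}"
    unfolding vec_eq_iff forall_other[of _ i] using assms by (auto simp: line_gens_def)
  then show ?thesis by (simp add: rep_quadrant_iff)
qed

lemma axis_component [simp]: "axis i (x :: real) $ i = x" "axis i (x :: real) $ other i = 0"
  by (simp_all add: axis_def other_neq)

section \<open>Monomorphisms with cokernel trivial in one direction\<close>

text \<open>Both steps of the factorization are instances: the image in the intermediate module with
  direction 1, and the intermediate module in \<open>N\<close> with direction 2. The last assumption
  is \<epsilon>-triviality of the cokernel along direction \<open>i\<close>, phrased through
  elements.\<close>

locale direction_inclusion =
  fixes K :: "('k, 'm) ring_scheme" and P :: "(real^2, 'k, 'v) pmod" and Q :: "(real^2, 'k, 'w) pmod"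
    and h :: "real^2 \<Rightarrow> 'v \<Rightarrow> 'w" and i :: 2 and \<epsilon> :: real
    and E :: "'e set" and deg :: "'e \<Rightarrow> real^2" and g and E' :: "'f set" and deg' :: "'f \<Rightarrow> real^2" and g'
  assumes h: "pmod_hom K P Q h" and inj: "\<And>b. inj_on (h b) (carrier (Sp P b))" and eps: "0 \<le> \<epsilon>"
    and gP: "free_coords K P E deg g" and gQ: "free_coords K Q E' deg' g'"
    and pfdP: "pfd K P" and pfdQ: "pfd K Q"
    and coker: "\<And>b x. x \<in> carrier (Sp Q b) \<Longrightarrow>
      Tr Q b (b + \<epsilon> *\<^sub>R axis i 1) x \<in> im_set P h (b + \<epsilon> *\<^sub>R axis i 1)"
begin

lemma P: "pmodule K P" and Q: "pmodule K Q"
  using pmod_homD(1,2)[OF h] .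

abbreviation shift :: "real^2" where "shift \<equiv> \<epsilon> *\<^sub>R axis i 1"

lemma shift: "b \<le> b + shift" "(b + shift) $ other i = b $ other i"
proof -
  show "b \<le> b + shift" "(b + shift) $ other i = b $ other i"
    unfolding less_eq_vec_def forall_other[of _ i] using eps by simp_all
qed

lemma on_line_shift: "on_line i a (t + \<epsilon>) = on_line i a t + shift"
  by (simp add: on_line_def scaleR_left_distrib)

text \<open>If the image of \<open>x\<close> comes from a degree \<open>c\<close> below the line,
  its source is hit by \<open>h\<close> after a shift by \<epsilon>; the shift runs parallel to the
  line, so the shifted \<open>c\<close> is still below it. By injectivity the shifted
  \<open>x\<close> comes from below, and freeness of \<open>P\<close> removes the shift, which does
  not alter coordinates.\<close>

lemma side_reflect:
  assumes a: "a $ i = 0" and x: "x \<in> carrier (Sp P (on_line i a t))"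
    and hx: "h (on_line i a t) x \<in> line_side i a Q t"
  shows "x \<in> line_side i a P t"
proof -
  let ?b = "on_line i a t"
  obtain c u where c: "c \<le> ?b" "c $ other i < a $ other i" "u \<in> carrier (Sp Q c)" "h ?b x = Tr Q c ?b u"
    using hx by (rule sideE)
  obtain p where p: "p \<in> carrier (Sp P (c + shift))" "Tr Q c (c + shift) u = h (c + shift) p"
    using coker[OF c(3)] by (auto simp: im_set_def)
  have cb: "c + shift \<le> ?b + shift" using c(1) by simp
  have "h (?b + shift) (Tr P ?b (?b + shift) x) = Tr Q ?b (?b + shift) (Tr Q c ?b u)"
    using pmod_hom_natural[OF h shift(1) x] c(4) by simp
  also have "\<dots> = Tr Q c (?b + shift) u"
    by (rule pmodule.transition_comp[OF Q c(1) shift(1) c(3)])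
  also have "\<dots> = Tr Q (c + shift) (?b + shift) (Tr Q c (c + shift) u)"
    by (rule pmodule.transition_comp[OF Q shift(1) cb c(3), symmetric])
  also have "\<dots> = h (?b + shift) (Tr P (c + shift) (?b + shift) p)"
    unfolding p(2) by (rule pmod_hom_natural[OF h cb p(1), symmetric])
  finally have "Tr P ?b (?b + shift) x = Tr P (c + shift) (?b + shift) p"
    by (rule inj_onD[OF inj]) (rule pmodule_Tr_closed[OF P shift(1) x], rule pmodule_Tr_closed[OF P cb p(1)])
  moreover have "Tr P (c + shift) (?b + shift) p \<in> side P (other i) (a $ other i) (?b + shift)"
    using c(2) shift(2)[of c] by (intro sideI[OF cb _ p(1)]) simp
  ultimately have "\<forall>e\<in>line_gens i a E deg. g (?b + shift) (Tr P ?b (?b + shift) x) e = \<zero>\<^bsub>K\<^esub>"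
    using free_coords_side_iff[OF gP a pmodule_Tr_closed[OF P shift(1) x]] shift(2)[of ?b] by simp
  then have "\<forall>e\<in>line_gens i a E deg. g ?b x e = \<zero>\<^bsub>K\<^esub>"
    unfolding free_coords_Tr[OF gP shift(1) x] .
  then show ?thesis unfolding free_coords_side_iff[OF gP a x on_line_simps(2)] .
qed

lemma line_map_inj:
  assumes a: "a $ i = 0"
  shows "inj_on (line_map i a Q h t) (carrier (Sp (line_mod i a P) t))"
proof (rule linear_map_inj_onI[OF pmod_hom_linear[OF pmod_hom_line_map[OF h a]]])
  fix X assume "X \<in> carrier (Sp (line_mod i a P) t)" and z: "line_map i a Q h t X = \<zero>\<^bsub>Sp (line_mod i a Q) t\<^esub>"
  then obtain x where x: "x \<in> carrier (Sp P (on_line i a t))"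
    "X = line_coset i a P t x"
    using line_carrierE[OF P a] by blast
  note hx = linear_map_closed[OF pmod_hom_linear[OF h] x(1)]
  have "line_coset i a Q t (h (on_line i a t) x) =
      line_side i a Q t"
    using z unfolding x(2) line_map_coset(1)[OF h a x(1)] line_mod_simps(1)[OF Q a] quot_vs_simps .
  then have "h (on_line i a t) x \<in> line_side i a Q t"
    unfolding coset_eq_self_iff[OF pmodule.space[OF Q] side_submodule[OF Q] hx] .
  then have "x \<in> line_side i a P t" by (rule side_reflect[OF a x(1)])
  then show "X = \<zero>\<^bsub>Sp (line_mod i a P) t\<^esub>"
    unfolding x(2) line_mod_simps(1)[OF P a] quot_vs_simps
      coset_eq_self_iff[OF pmodule.space[OF P] side_submodule[OF P] x(1)] .
qed

lemma line_coker:
  assumes a: "a $ i = 0" and X: "X \<in> carrier (Sp (line_mod i a Q) t)"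
  shows "Tr (line_mod i a Q) t (t + \<epsilon>) X \<in> im_set (line_mod i a P) (line_map i a Q h) (t + \<epsilon>)"
proof -
  let ?b = "on_line i a t"
  obtain x where x: "x \<in> carrier (Sp Q ?b)" "X = side Q (other i) (a $ other i) ?b +>\<^bsub>Sp Q ?b\<^esub> x"
    using line_carrierE[OF Q a X] .
  obtain p where p: "p \<in> carrier (Sp P (?b + shift))" "Tr Q ?b (?b + shift) x = h (?b + shift) p"
    using coker[OF x(1)] by (auto simp: im_set_def)
  have p': "p \<in> carrier (Sp P (on_line i a (t + \<epsilon>)))" using p(1) by (simp add: on_line_shift)
  have "Tr (line_mod i a Q) t (t + \<epsilon>) X = line_map i a Q h (t + \<epsilon>)
      (line_coset i a P (t + \<epsilon>) p)"
    unfolding x(2) line_map_coset(1)[OF h a p'] using line_Tr_coset[OF Q a _ x(1), of "t + \<epsilon>"] eps p(2)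
    by (simp add: on_line_shift)
  moreover have "line_coset i a P (t + \<epsilon>) p
      \<in> carrier (Sp (line_mod i a P) (t + \<epsilon>))"
    unfolding line_mod_simps(1)[OF P a] quot_vs_simps carrier_quot_vs using p' by blast
  ultimately show ?thesis by (simp add: im_set_def)
qed

abbreviation line_matching :: "real^2 \<Rightarrow> (real set, real set) matching" where
  "line_matching a \<equiv> induced_matching K (line_mod i a P) (line_mod i a Q) (line_map i a Q h)"

text \<open>Injectivity on the line makes the image isomorphic to the source, so both have the same
  barcode and only the monomorphism half of the matching does any work. The counts required by
  \<open>right_matching\<close> are dimensions at single parameters.\<close>

lemma line_matching:
  assumes a: "a $ i = 0"
  shows "bijective_matching (quadrant_mset (line_gens i a E deg) (\<lambda>e. deg e $ i))
      (quadrant_mset (line_gens i a E' deg') (\<lambda>e. deg' e $ i)) (line_matching a)"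
    and "(p, q) \<in> line_matching a \<Longrightarrow> \<exists>s j t k. p = ({s..}, j) \<and> q = ({t..}, k) \<and> s - \<epsilon> \<le> t \<and> t \<le> s"
proof -
  let ?P = "line_mod i a P" and ?Q = "line_mod i a Q" and ?f = "line_map i a Q h"
  let ?E = "line_gens i a E deg" and ?E' = "line_gens i a E' deg'"
  let ?d = "\<lambda>e. deg e $ i" and ?d' = "\<lambda>e. deg' e $ i"
  note f = pmod_hom_line_map[OF h a]
  note LP = pmod_hom_source[OF f] and LQ = pmod_hom_target[OF f]
  obtain gp where gp: "free_coords K ?P ?E ?d gp" using line_coords[OF gP a] by blast
  obtain gq where gq: "free_coords K ?Q ?E' ?d' gq" using line_coords[OF gQ a] by blast
  obtain gi where gi: "free_coords K (im_mod ?P ?Q ?f) ?E ?d gi"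
    using coords_im_mod[OF gp f line_map_inj[OF a]] by blast
  have fin: "finite {e \<in> ?E. ?d e \<le> t}" for t
    using coords_pfd_iff[OF gP] pfdP by (intro finite_subset[OF line_gens_below[OF a]]) simp
  have fin': "finite {e \<in> ?E'. ?d' e \<le> t}" for t
    using coords_pfd_iff[OF gQ] pfdQ by (intro finite_subset[OF line_gens_below[OF a]]) simp
  have pfd: "pfd K ?P" "pfd K (im_mod ?P ?Q ?f)" "pfd K ?Q"
    using coords_pfd_iff[OF gp] coords_pfd_iff[OF gi] coords_pfd_iff[OF gq] fin fin' by simp_all
  have bars: "barcode K ?P = quadrant_mset ?E ?d" "barcode K (im_mod ?P ?Q ?f) = quadrant_mset ?E ?d"
    "barcode K ?Q = quadrant_mset ?E' ?d'"
    unfolding quadrant_mset_def by (rule barcode_free[OF gp pfd(1)] barcode_free[OF gi pfd(2)] barcode_free[OF gq pfd(3)])+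
  have dims: "vectorspace.dim K (Sp ?P t) = card {e \<in> ?E. ?d e \<le> t}"
    "vectorspace.dim K (Sp (im_mod ?P ?Q ?f) t) = card {e \<in> ?E. ?d e \<le> t}"
    "vectorspace.dim K (Sp ?Q t) = card {e \<in> ?E'. ?d' e \<le> t}" for t
    using coords_dim[OF gp, of t] coords_dim[OF gi, of t] coords_dim[OF gq, of t] fin fin' by simp_all
  have le: "card {e \<in> ?E. ?d e \<le> t} \<le> card {e \<in> ?E'. ?d' e \<le> t}" for t
    using injective_dim_le[OF pmod_hom_linear[OF f] line_map_inj[OF a], of t] pfd
    unfolding dims by (simp add: pfd_def)
  \<comment> \<open>Moving by \<epsilon> on the line of \<open>Q\<close> is injective by freeness
    and ends in the image of \<open>P\<close>, so the dimension of \<open>Q\<close> at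
    \<open>t\<close> is bounded by that of the image at \<open>t + \<epsilon>\<close>.\<close>
  have ge: "card {e \<in> ?E'. ?d' e \<le> t} \<le> card {e \<in> ?E. ?d e \<le> t + \<epsilon>}" for t
  proof -
    have te: "t \<le> t + \<epsilon>" using eps by simp
    have Sp_im: "Sp (im_mod ?P ?Q ?f) (t + \<epsilon>) = (Sp ?Q (t + \<epsilon>))\<lparr>carrier := im_set ?P ?f (t + \<epsilon>)\<rparr>"
      by (simp add: im_mod_def Sp_sub_mod)
    have "linear_map K (Sp ?Q t) (Sp (im_mod ?P ?Q ?f) (t + \<epsilon>)) (Tr ?Q t (t + \<epsilon>))"
      unfolding Sp_im
      by (rule linear_map_restrict_codomain[OF pmodule.transition[OF LQ te]
            pmodule.space[OF pmodule_im_mod[OF f], of "t + \<epsilon>", unfolded Sp_im] line_coker[OF a]])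
    moreover have "inj_on (Tr ?Q t (t + \<epsilon>)) (carrier (Sp ?Q t))"
      using tame_inj[OF free_coords_tame[OF gq pfd(3)] te] by (intro inj_onI)
    ultimately have "vectorspace.dim K (Sp ?Q t) \<le> vectorspace.dim K (Sp (im_mod ?P ?Q ?f) (t + \<epsilon>))"
      using pfd by (intro injective_dim_le) (simp_all add: pfd_def)
    then show ?thesis unfolding dims .
  qed
  have deg: "gen_degrees ?E ?d" "gen_degrees ?E' ?d'" using fin fin' by (simp_all add: gen_degrees_def)
  have sub: "endpoint_matching right_end (quadrant_mset ?E ?d) (quadrant_mset ?E' ?d') \<subseteq>
      rep (quadrant_mset ?E ?d) \<times> rep (quadrant_mset ?E' ?d')"
    by (auto simp: endpoint_matching_def)
  have eq: "line_matching a = endpoint_matching right_end (quadrant_mset ?E ?d) (quadrant_mset ?E' ?d')"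
    unfolding induced_matching_def bars endpoint_matching_left_refl using sub by blast
  show "bijective_matching (quadrant_mset ?E ?d) (quadrant_mset ?E' ?d') (line_matching a)"
    unfolding eq by (rule right_matching(1)[OF deg le ge])
  show "\<exists>s j t k. p = ({s..}, j) \<and> q = ({t..}, k) \<and> s - \<epsilon> \<le> t \<and> t \<le> s" if "(p, q) \<in> line_matching a"
    using that unfolding eq by (rule right_matching(2)[OF deg le ge])
qed

lemma barcodes: "barcode K P = quadrant_mset E deg" "barcode K Q = quadrant_mset E' deg'"
  unfolding quadrant_mset_def by (rule barcode_free[OF gP pfdP] barcode_free[OF gQ pfdQ])+

lemma dir_matchingE:
  assumes "(p, q) \<in> dir_matching K P Q h i"
  obtains a s j t k where "a $ i = 0" "p = ({on_line i a s..}, j)" "q = ({on_line i a t..}, k)"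
    "(({s..}, j), ({t..}, k)) \<in> line_matching a"
  using assms unfolding dir_matching_def by auto

lemma dir_matching_shift:
  assumes "(p, q) \<in> dir_matching K P Q h i"
  shows "\<exists>b b' j k. p = ({b..}, j) \<and> q = ({b'..}, k) \<and> b $ i - \<epsilon> \<le> b' $ i \<and> b' $ i \<le> b $ i \<and>
    b' $ other i = b $ other i"
proof -
  obtain a s j t k where a: "a $ i = 0" "p = ({on_line i a s..}, j)" "q = ({on_line i a t..}, k)"
    "(({s..}, j), ({t..}, k)) \<in> line_matching a" using assms by (rule dir_matchingE)
  have "s - \<epsilon> \<le> t" "t \<le> s" using line_matching(2)[OF a(1,4)] by auto
  then show ?thesis using a(1) unfolding a(2,3)
    by (intro exI[of _ "on_line i a s"] exI[of _ "on_line i a t"] exI[of _ j] exI[of _ k]) simp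
qed

text \<open>Bijectivity is checked one line at a time: \<open>line_base\<close> finds the line
  through a given degree, and the copy indices on the line are those in the plane.\<close>

lemma dir_matching_bijective:
  "bijective_matching (barcode K P) (barcode K Q) (dir_matching K P Q h i)"
  unfolding bijective_matching_def is_matching_def barcodes
proof (intro conjI)
  let ?R = "dir_matching K P Q h i" and ?A = "quadrant_mset E deg" and ?B = "quadrant_mset E' deg'"
  have line: "line_matching a \<subseteq> rep (quadrant_mset (line_gens i a E deg) (\<lambda>e. deg e $ i)) \<times>
      rep (quadrant_mset (line_gens i a E' deg') (\<lambda>e. deg' e $ i))"
    "single_valued (line_matching a)" "single_valued ((line_matching a)\<inverse>)"
    "Domain (line_matching a) = rep (quadrant_mset (line_gens i a E deg) (\<lambda>e. deg e $ i))"
    "Range (line_matching a) = rep (quadrant_mset (line_gens i a E' deg') (\<lambda>e. deg' e $ i))"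
    if "a $ i = 0" for a
    using line_matching(1)[OF that] by (auto simp: bijective_matching_def is_matching_def)
  show sub: "?R \<subseteq> rep ?A \<times> rep ?B"
  proof
    fix z assume z: "z \<in> ?R"
    obtain p q where pq: "z = (p, q)" by (cases z)
    obtain a s j t k where a: "a $ i = 0" "p = ({on_line i a s..}, j)" "q = ({on_line i a t..}, k)"
      "(({s..}, j), ({t..}, k)) \<in> line_matching a" using z unfolding pq by (rule dir_matchingE)
    have "({s..}, j) \<in> rep (quadrant_mset (line_gens i a E deg) (\<lambda>e. deg e $ i))"
      "({t..}, k) \<in> rep (quadrant_mset (line_gens i a E' deg') (\<lambda>e. deg' e $ i))"
      using line(1)[OF a(1)] a(4) by auto
    then show "z \<in> rep ?A \<times> rep ?B" unfolding pq a(2,3) by (simp add: rep_line_iff[OF a(1)])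
  qed
  show "single_valued ?R"
  proof (rule single_valuedI)
    fix p q q' assume 1: "(p, q) \<in> ?R" and 2: "(p, q') \<in> ?R"
    obtain a s j t k where a: "a $ i = 0" "p = ({on_line i a s..}, j)" "q = ({on_line i a t..}, k)"
      "(({s..}, j), ({t..}, k)) \<in> line_matching a" using 1 by (rule dir_matchingE)
    obtain a' s' j' t' k' where a': "a' $ i = 0" "p = ({on_line i a' s'..}, j')" "q' = ({on_line i a' t'..}, k')"
      "(({s'..}, j'), ({t'..}, k')) \<in> line_matching a'" using 2 by (rule dir_matchingE)
    have eq: "on_line i a s = on_line i a' s'" "j = j'" using a(2) a'(2) by simp_all
    have "a' = a" "s' = s" "j' = j" using on_line_inject[OF a(1) a'(1) eq(1)] eq(2) by simp_all
    then have "(({s..}, j), ({t'..}, k')) \<in> line_matching a" using a'(4) by simp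
    then have "({t..}, k) = ({t'..}, k')" using single_valuedD[OF line(2)[OF a(1)] a(4)] by blast
    then show "q = q'" using a(3) a'(3) \<open>a' = a\<close> by simp
  qed
  show "single_valued (?R\<inverse>)"
  proof (rule single_valuedI)
    fix q p p' assume "(q, p) \<in> ?R\<inverse>" "(q, p') \<in> ?R\<inverse>"
    then have 1: "(p, q) \<in> ?R" and 2: "(p', q) \<in> ?R" by simp_all
    obtain a s j t k where a: "a $ i = 0" "p = ({on_line i a s..}, j)" "q = ({on_line i a t..}, k)"
      "(({s..}, j), ({t..}, k)) \<in> line_matching a" using 1 by (rule dir_matchingE)
    obtain a' s' j' t' k' where a': "a' $ i = 0" "p' = ({on_line i a' s'..}, j')" "q = ({on_line i a' t'..}, k')"
      "(({s'..}, j'), ({t'..}, k')) \<in> line_matching a'" using 2 by (rule dir_matchingE)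
    have eq: "on_line i a t = on_line i a' t'" "k = k'" using a(3) a'(3) by simp_all
    have "a' = a" "t' = t" "k' = k" using on_line_inject[OF a(1) a'(1) eq(1)] eq(2) by simp_all
    then have "(({s'..}, j'), ({t..}, k)) \<in> line_matching a" using a'(4) by simp
    then have "({s..}, j) = ({s'..}, j')"
      using single_valuedD[OF line(3)[OF a(1)], of "({t..}, k)" "({s..}, j)" "({s'..}, j')"] a(4) by simp
    then show "p = p'" using a(2) a'(2) \<open>a' = a\<close> by simp
  qed
  show "Domain ?R = rep ?A"
  proof
    show "Domain ?R \<subseteq> rep ?A" using sub by auto
    show "rep ?A \<subseteq> Domain ?R"
    proof
      fix p assume p: "p \<in> rep ?A"
      then obtain b j where b: "p = ({b..}, j)" by (rule rep_quadrantE)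
      define a where "a = line_base i b"
      have a: "a $ i = 0" "on_line i a (b $ i) = b" by (simp_all add: a_def line_base)
      have "({b $ i..}, j) \<in> Domain (line_matching a)"
        unfolding line(4)[OF a(1)] rep_line_iff[OF a(1)] a(2) using p b by simp
      then obtain q where q: "(({b $ i..}, j), q) \<in> line_matching a" by blast
      then obtain t k where "q = ({t..}, k)" using line_matching(2)[OF a(1) q] by blast
      then have "(({on_line i a (b $ i)..}, j), ({on_line i a t..}, k)) \<in> ?R"
        using q a(1) unfolding dir_matching_def by blast
      then show "p \<in> Domain ?R" unfolding a(2) b by blast
    qed
  qed
  show "Range ?R = rep ?B"
  proof
    show "Range ?R \<subseteq> rep ?B" using sub by auto
    show "rep ?B \<subseteq> Range ?R"
    proof
      fix q assume q: "q \<in> rep ?B"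
      then obtain b k where b: "q = ({b..}, k)" by (rule rep_quadrantE)
      define a where "a = line_base i b"
      have a: "a $ i = 0" "on_line i a (b $ i) = b" by (simp_all add: a_def line_base)
      have "({b $ i..}, k) \<in> Range (line_matching a)"
        unfolding line(5)[OF a(1)] rep_line_iff[OF a(1)] a(2) using q b by simp
      then obtain p where p: "(p, ({b $ i..}, k)) \<in> line_matching a" by blast
      then obtain s j where "p = ({s..}, j)" using line_matching(2)[OF a(1) p] by blast
      then have "(({on_line i a s..}, j), ({on_line i a (b $ i)..}, k)) \<in> ?R"
        using p a(1) unfolding dir_matching_def by blast
      then show "q \<in> Range ?R" unfolding a(2) b by blast
    qed
  qed
qed

end

section \<open>Composition of the two directions\<close>

text \<open>The diagonal shift kills the class of \<open>n\<close>, and a coset is the zero of the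
  quotient exactly if its representative lies in the submodule.\<close>

lemma coker_trivial:
  assumes f: "pmod_hom K M N f" and eps: "eps_trivial \<epsilon> (coker_mod M N f)" and "0 \<le> \<epsilon>"
    and n: "n \<in> carrier (Sp N b)"
  shows "Tr N b (b + vec \<epsilon>) n \<in> im_set M f (b + vec \<epsilon>)"
proof -
  note N = pmod_hom_target[OF f] and im = im_set_submodule[OF f]
  have le: "b \<le> b + vec \<epsilon>" using \<open>0 \<le> \<epsilon>\<close> by (simp add: less_eq_vec_def)
  let ?X = "im_set M f b +>\<^bsub>Sp N b\<^esub> n"
  have "?X \<in> carrier (Sp (coker_mod M N f) b)"
    using n by (auto simp: coker_mod_def quot_mod_def carrier_quot_vs)
  then have "Tr (coker_mod M N f) b (b + vec \<epsilon>) ?X = im_set M f (b + vec \<epsilon>)"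
    using eps unfolding eps_trivial_def by (auto simp: coker_mod_def quot_mod_def)
  also have "Tr (coker_mod M N f) b (b + vec \<epsilon>) ?X =
      im_set M f (b + vec \<epsilon>) +>\<^bsub>Sp N (b + vec \<epsilon>)\<^esub> Tr N b (b + vec \<epsilon>) n"
    using induced_coset[OF pmodule.transition[OF N le] im im im_set_Tr[OF f le] n]
    by (simp add: coker_mod_def quot_mod_def)
  finally show ?thesis
    unfolding coset_eq_self_iff[OF pmodule.space[OF N] im pmodule_Tr_closed[OF N le n]] .
qed

theorem theorem6p4:
  fixes K :: "('k, 'm) ring_scheme"
    and M :: "(real^2, 'k, 'v) pmod" and N :: "(real^2, 'k, 'w) pmod"
    and f :: "real^2 \<Rightarrow> 'v \<Rightarrow> 'w" and \<epsilon> :: real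
  assumes "field K"
    and "0 \<le> \<epsilon>"
    and "pmodule K M" and "pfd K M" and "free_mod K M"
    and "pmodule K N" and "pfd K N" and "free_mod K N"
    and "pmod_mono K M N f"
    and "eps_trivial \<epsilon> (coker_mod M N f)"
  shows "free_mod K (L_mod \<epsilon> M N f) \<and>
    bijective_matching (barcode K M) (barcode K N) (chi K \<epsilon> M N f) \<and>
    (\<forall>b j. ({b..}, j) \<in> rep (barcode K M) \<longrightarrow>
      (\<exists>b' j'. (({b..}, j), ({b'..}, j')) \<in> chi K \<epsilon> M N f \<and>
        (\<forall>i. b $ i - \<epsilon> \<le> b' $ i \<and> b' $ i \<le> b $ i)))"
proof -
  note pfdM = \<open>pfd K M\<close> and pfdN = \<open>pfd K N\<close> and N = \<open>pmodule K N\<close>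
  have f: "pmod_hom K M N f" and inj: "\<And>a. inj_on (f a) (carrier (Sp M a))"
    using \<open>pmod_mono K M N f\<close> by (simp_all add: pmod_mono_def)
  obtain EM :: "((real^2) \<times> 'v) set" and dM gM where gM: "free_coords K M EM dM gM"
    using free_modD[OF \<open>free_mod K M\<close>] by blast
  obtain EN :: "((real^2) \<times> 'w) set" and dN gN where gN: "free_coords K N EN dN gN"
    using free_modD[OF \<open>free_mod K N\<close>] by blast
  define I where "I = im_mod M N f"
  obtain gI where gI: "free_coords K I EM dM gI"
    using coords_im_mod[OF gM f inj] unfolding I_def by blast
  have pfdI: "pfd K I" using coords_pfd_iff[OF gI] coords_pfd_iff[OF gM] pfdM by simp
  have "0 \<le> \<epsilon> *\<^sub>R axis 1 (1 :: real)"
    using \<open>0 \<le> \<epsilon>\<close> by (simp add: less_eq_vec_def axis_def)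
  then interpret pullback_module K M N f "\<epsilon> *\<^sub>R axis 1 1"
    by (intro pullback_module.intro f)
  have L_mod_eq: "L_mod \<epsilon> M N f = L" by (simp add: L_mod_def pull_def[abs_def])
  have pL: "pmodule K L" by (rule pmodule_pull)
  have pfdL: "pfd K L" by (rule pfd_sub_mod[OF N pmodule_pull pull_carrier pfdN])
  have tameL: "tame L" by (rule tame_pull[OF gM gN pfdM pfdN inj])
  obtain EL :: "((real^2) \<times> 'w) set" and gL where gL: "free_coords K L EL fst gL"
    using tame_free[OF pL pfdL tameL] by blast
  have freeL: "free_mod K (L_mod \<epsilon> M N f)" using free_modI[OF gL] by (simp add: L_mod_eq)
  have inclI: "pmod_hom K I L (\<lambda>a x. x)" and inclL: "pmod_hom K L N (\<lambda>a x. x)"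
    unfolding I_def im_mod_def
    by (rule sub_mod_inclusion[OF N _ pmodule_pull im_set_subset_pull pull_carrier];
        rule pmodule_im_mod[OF f, unfolded im_mod_def])+
  \<comment> \<open>Here the cokernel condition is the definition of the intermediate module, whose
    elements enter the image after moving by \<epsilon> in direction 1.\<close>
  interpret D1: direction_inclusion K I L "\<lambda>a x. x" 1 \<epsilon> EM dM gI EL fst gL
  proof (rule direction_inclusion.intro[OF inclI _ \<open>0 \<le> \<epsilon>\<close> gI gL pfdI pfdL])
    fix b x assume "x \<in> carrier (Sp L b)"
    then show "Tr L b (b + \<epsilon> *\<^sub>R axis 1 1) x \<in> im_set I (\<lambda>a x. x) (b + \<epsilon> *\<^sub>R axis 1 1)"
      by (simp add: pull_def I_def im_mod_def im_set_def)
  qed simp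
  interpret D2: direction_inclusion K L N "\<lambda>a x. x" 2 \<epsilon> EL fst gL EN dN gN
  proof (rule direction_inclusion.intro[OF inclL _ \<open>0 \<le> \<epsilon>\<close> gL gN pfdL pfdN])
    fix b x assume x: "x \<in> carrier (Sp N b)"
    let ?b = "b + \<epsilon> *\<^sub>R axis 2 1"
    \<comment> \<open>The diagonal shift is the shift in direction 2 followed by that in direction
      1. Hence an element of \<open>N\<close> moved in direction 2 satisfies the condition defining
      the intermediate module.\<close>
    have v: "?b + \<epsilon> *\<^sub>R axis 1 1 = b + vec \<epsilon>" by (simp add: vec_eq_iff forall_2 axis_def)
    have le: "b \<le> ?b" using \<open>0 \<le> \<epsilon>\<close> by (simp add: less_eq_vec_def axis_def)
    have "Tr N ?b (?b + \<epsilon> *\<^sub>R axis 1 1) (Tr N b ?b x) = Tr N b (?b + \<epsilon> *\<^sub>R axis 1 1) x"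
      by (rule pmodule.transition_comp[OF N le le_shift x])
    also have "\<dots> \<in> im_set M f (?b + \<epsilon> *\<^sub>R axis 1 1)"
      unfolding v by (rule coker_trivial[OF f \<open>eps_trivial \<epsilon> (coker_mod M N f)\<close> \<open>0 \<le> \<epsilon>\<close> x])
    finally show "Tr N b ?b x \<in> im_set L (\<lambda>a x. x) ?b"
      using pmodule_Tr_closed[OF N le x] by (simp add: pull_def im_set_def)
  qed simp
  have chi_eq: "chi K \<epsilon> M N f = dir_matching K I L (\<lambda>a x. x) 1 O dir_matching K L N (\<lambda>a x. x) 2"
    by (simp add: chi_def I_def L_mod_eq)
  \<comment> \<open>Coordinates of \<open>M\<close> are transported to the image with the same
    labels and degrees, so both barcodes are the same quadrant count.\<close>
  have "barcode K M = barcode K I"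
    unfolding D1.barcodes quadrant_mset_def by (rule barcode_free[OF gM pfdM])
  then have bij: "bijective_matching (barcode K M) (barcode K N) (chi K \<epsilon> M N f)"
    unfolding chi_eq using bijective_matching_relcomp[OF D1.dir_matching_bijective D2.dir_matching_bijective]
    by simp
  have "\<exists>b' j'. (({b..}, j), ({b'..}, j')) \<in> chi K \<epsilon> M N f \<and> (\<forall>i. b $ i - \<epsilon> \<le> b' $ i \<and> b' $ i \<le> b $ i)"
    if "({b..}, j) \<in> rep (barcode K M)" for b j
  proof -
    have "({b..}, j) \<in> Domain (chi K \<epsilon> M N f)" using that bij by (simp add: bijective_matching_def)
    then obtain p q where p: "(({b..}, j), p) \<in> dir_matching K I L (\<lambda>a x. x) 1"
      and q: "(p, q) \<in> dir_matching K L N (\<lambda>a x. x) 2"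
      unfolding chi_eq by blast
    obtain b1 j1 where 1: "p = ({b1..}, j1)" "b $ 1 - \<epsilon> \<le> b1 $ 1" "b1 $ 1 \<le> b $ 1" "b1 $ 2 = b $ 2"
      using D1.dir_matching_shift[OF p] by (auto simp: other_def)
    obtain b2 j2 where 2: "q = ({b2..}, j2)" "b1 $ 2 - \<epsilon> \<le> b2 $ 2" "b2 $ 2 \<le> b1 $ 2" "b2 $ 1 = b1 $ 1"
      using D2.dir_matching_shift[OF q] 1(1) by (auto simp: other_def)
    have "(({b..}, j), ({b2..}, j2)) \<in> chi K \<epsilon> M N f"
      unfolding chi_eq 2(1)[symmetric] using p q by blast
    \<comment> \<open>The direction-1 matching keeps the second coordinate and the direction-2
      matching keeps the first, so each coordinate moves only once and the bounds do not add
      up.\<close>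
    moreover have "\<forall>i. b $ i - \<epsilon> \<le> b2 $ i \<and> b2 $ i \<le> b $ i" using 1 2 by (simp add: forall_2)
    ultimately show ?thesis by blast
  qed
  then show ?thesis using freeL bij by blast
qed

end
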